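(* Let $d\ge1$ and let $K_{(\cdot,\cdot)}:(\mathbb{N}_0^d\setminus\{O\})^2\to[0,\infty)$ be a mapping that can be written as $K_{\alpha,\beta}=K(\alpha,\beta)$ for $\alpha,\beta\in\mathbb{N}_0^d\setminus\{O\}$, for some continuous function $K:(\mathbb{R}_*^d)^2\to[0,\infty)$ with $K(x,y)=K(y,x)$ satisfying $$c_1(|x|+|y|)^\gamma\Phi_p\Big(\frac{|x|}{|x|+|y|}\Big)\le K(x,y)\le c_2(|x|+|y|)^\gamma\Phi_p\Big(\frac{|x|}{|x|+|y|}\Big),\qquad x,y\in\mathbb{R}_*^d,$$ with $\Phi_p(s)=s^{-p}(1-s)^{-p}$ for $0<s<1$, for some constants $0<c_1\le c_2<\infty$, some $\gamma\in[0,1)$ and some $p\in\mathbb{R}$ with $\gamma+2p\ge0$ and $0\le\gamma+p<1$. Let $\{n_{\alpha,0}\}_{\alpha\in\mathbb{N}_0^d\setminus\{O\}}$ be nonnegative numbers satisfying $0<\sum_{\alpha\in\mathbb{N}_0^d\setminus\{O\}}|\alpha|^{1+r}n_{\alpha,0}<\infty$ for some $r>0$. Then there is a solution $\{n_\alpha(\cdot)\}_{\alpha\in\mathbb{N}_0^d\setminus\{O\}}$ of the discrete coagulation equation with kernel $K_{\alpha,\beta}$ such that $n_\alpha(0)=n_{\alpha,0}$ and, for each $t>0$, $$\sum_{\alpha\in\mathbb{N}_0^d\setminus\{O\}}|\alpha|n_\alpha(t)=\sum_{\alpha\in\mathbb{N}_0^d\setminus\{O\}}|\alpha|n_{\alpha,0}=:m_0\in(0,\infty).$$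 Moreover, there exists a positive function $\delta\in C(0,\infty)$ with $\lim_{t\to\infty}\delta(t)=0$ such that $$\lim_{t\to\infty}\left|\sum_{\{\delta(t)t^{\frac1{1-\gamma}}\le|\alpha|\le(\delta(t))^{-1}t^{\frac1{1-\gamma}}\}\cap\{|\frac{\alpha}{|\alpha|}-\theta_0|\le\delta(t)\}}|\alpha|\,n_\alpha(t)-m_0\right|=0,$$ where $\theta_0:=\frac{1}{m_0}\sum_{\alpha\in\mathbb{N}_0^d\setminus\{O\}}\alpha\, n_{\alpha,0}\in\Delta^{d-1}$.
   Context: Notation: $\mathbb{N}_0=\{0,1,2,\dots\}$; $O=(0,\dots,0)$; $\mathbb{R}_*^d=[0,\infty)^d\setminus\{O\}$; $|x|=\sum_{j=1}^d|x_j|$ for $x\in\mathbb{R}^d$; $\Delta^{d-1}=\{\theta\in\mathbb{R}_*^d:|\theta|=1\}$; $\mathcal{M}_+(\mathbb{R}_*^d)$ is the set of nonnegative Radon measures on $\mathbb{R}_*^d$, endowed with the weak-$*$ topology (duality with $C_c(\mathbb{R}_*^d)$). The discrete coagulation equation is $$\partial_tn_\alpha=\frac12\sum_{\beta<\alpha}K_{\alpha-\beta,\beta}n_{\alpha-\beta}n_\beta-n_\alpha\sum_{\beta>O}K_{\alpha,\beta}n_\beta,\qquad\alpha\in\mathbb{N}_0^d\setminus\{O\},$$ where $\beta<\alpha$ means $\beta_k\le\alpha_k$ for all $k$ and $\beta\ne\alpha$ (sums run over indices in $\mathbb{N}_0^d\setminus\{O\}$). A solution $\{n_\alpha(\cdot)\}$,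 $n_\alpha(t)\ge 0$, is understood in the sense that the measure $f(\cdot,t)=\sum_{\alpha}n_\alpha(t)\delta_\alpha$ ($\delta_\alpha$ the Dirac mass at $\alpha$) is a weak solution of the continuous coagulation equation with kernel $K$ and initial value $f_0=\sum_\alpha n_{\alpha,0}\delta_\alpha$, in the following sense. Definition (weak solution). Let $f_0\in\mathcal{M}_+(\mathbb{R}_*^d)$ satisfy $\int|x|f_0(dx)<\infty$. A function $f\in C([0,\infty);\mathcal{M}_+(\mathbb{R}_*^d))$ (weak-$*$ topology) is a weak solution with initial value $f_0$ if $f(\cdot,0)=f_0$; for each $1<T<\infty$, $$\sup_{t\in[1/T,T]}\Big[\int_{\{|x|\ge1\}}|x|^{\gamma+p}f(dx,t)+\int_{\{|x|\le1\}}|x|^{1-p}f(dx,t)\Big]<\infty;$$ $\int_{\mathbb{R}_*^d}xf(dx,t)=\int_{\mathbb{R}_*^d}xf_0(dx)$ for all $t>0$; and for all $\varphi\in C_c^1(\mathbb{R}_*^d\times(0,\infty))$, $$0=\int_0^\infty\!\!\int_{\mathbb{R}_*^d}f(dx,t)\partial_t\varphi(x,t)\,dt+\frac12\int_0^\infty\!\!\int_{\mathbb{R}_*^d}\int_{\mathbb{R}_*^d}K(x,y)f(dx,t)f(dy,t)[\varphi(x+y,t)-\varphi(x,t)-\varphi(y,t)]\,dt.$$ *)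

theory Defs
  imports "HOL-Analysis.Analysis"
begin

definition l1norm :: "real ^ 'd \<Rightarrow> real"
  where "l1norm x = (\<Sum>j\<in>UNIV. \<bar>x $ j\<bar>)"

definition Rstar :: "(real ^ 'd) set"
  where "Rstar = {x. \<forall>j. 0 \<le> x $ j} - {0}"

definition unit_simplex :: "(real ^ 'd) set"
  where "unit_simplex = {\<theta> \<in> Rstar. l1norm \<theta> = 1}"


section \<open>Radon measures with the weak-star topology\<close>

text \<open>
  \<^term>\<open>Rstar\<close> is locally compact, Hausdorff and second countable, so a Borel measure on it is
  Radon as soon as it is finite on compact sets; regularity is then automatic.
\<close>

definition radon_measures :: "(real ^ 'd) measure set"
  where "radon_measures =
    {\<mu>. sets \<mu> = sets (restrict_space borel Rstar) \<and>
        (\<forall>C. compact C \<and> C \<subseteq> Rstar \<longrightarrow> emeasure \<mu> C < \<infinity>)}"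

text \<open>
  Only the values on \<^term>\<open>Rstar\<close> matter. The support is compact in \<^term>\<open>Rstar\<close>, so it stays away
  from the origin, but it may meet the faces of the orthant.
\<close>

definition Cc_Rstar :: "(real ^ 'd \<Rightarrow> real) set"
  where "Cc_Rstar =
    {\<phi>. continuous_on Rstar \<phi> \<and>
        (\<exists>C. compact C \<and> C \<subseteq> Rstar \<and> (\<forall>x \<in> Rstar - C. \<phi> x = 0))}"

text \<open>The coarsest topology that makes all the pairings with \<^term>\<open>Cc_Rstar\<close> continuous.\<close>

definition weak_star_topology :: "(real ^ 'd) measure topology"
  where "weak_star_topology =
    pullback_topology radon_measures
      (\<lambda>\<mu>. restrict (\<lambda>\<phi>. \<integral>x. \<phi> x \<partial>\<mu>) Cc_Rstar)
      (product_topology (\<lambda>_. euclideanreal) Cc_Rstar)"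


section \<open>Weak solutions of the continuous coagulation equation\<close>

text \<open>
  \<open>C\<^sup>1\<close> is meant up to the faces of the orthant: the derivative is taken within the convex set
  \<^term>\<open>Rstar \<times> {0<..}\<close>, which has nonempty interior, so that it is unique.
\<close>

definition C1c_Rstar_time :: "((real ^ 'd) \<times> real \<Rightarrow> real) set"
  where "C1c_Rstar_time =
    {\<phi>. (\<exists>D :: (real ^ 'd) \<times> real \<Rightarrow> ((real ^ 'd) \<times> real) \<Rightarrow>\<^sub>L real.
            continuous_on (Rstar \<times> {0<..}) D \<and>
            (\<forall>z \<in> Rstar \<times> {0<..}.
               (\<phi> has_derivative blinfun_apply (D z)) (at z within Rstar \<times> {0<..}))) \<and>
        (\<exists>C. compact C \<and> C \<subseteq> Rstar \<times> {0<..} \<and> (\<forall>z \<in> Rstar \<times> {0<..} - C. \<phi> z = 0))}"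

definition \<Phi> :: "real \<Rightarrow> real \<Rightarrow> real"
  where "\<Phi> p s = s powr (- p) * (1 - s) powr (- p)"

definition coag_integrand ::
    "(real ^ 'd \<Rightarrow> real ^ 'd \<Rightarrow> real) \<Rightarrow> ((real ^ 'd) \<times> real \<Rightarrow> real) \<Rightarrow> real \<Rightarrow>
     real ^ 'd \<Rightarrow> real ^ 'd \<Rightarrow> real"
  where "coag_integrand K \<phi> t x y = K x y * (\<phi> (x + y, t) - \<phi> (x, t) - \<phi> (y, t))"

text \<open>
  The integrability conditions in the last two clauses only say that the integrals exist; they
  are there because the Lebesgue integral of a non-integrable function is \<open>0\<close> by convention.
\<close>

definition weak_solution ::
    "real \<Rightarrow> real \<Rightarrow> (real ^ 'd \<Rightarrow> real ^ 'd \<Rightarrow> real) \<Rightarrow> (real ^ 'd) measure \<Rightarrow>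
     (real \<Rightarrow> (real ^ 'd) measure) \<Rightarrow> bool"
  where "weak_solution \<gamma> p K f0 f \<longleftrightarrow>
    f0 \<in> radon_measures \<and>
    (\<integral>\<^sup>+x. ennreal (l1norm x) \<partial>f0) < \<infinity> \<and>
    continuous_map (top_of_set {0..}) weak_star_topology f \<and>
    f 0 = f0 \<and>
    (\<forall>T>1. (SUP t\<in>{1/T..T}.
        (\<integral>\<^sup>+x\<in>{x. 1 \<le> l1norm x}. ennreal (l1norm x powr (\<gamma> + p)) \<partial>f t) +
        (\<integral>\<^sup>+x\<in>{x. l1norm x \<le> 1}. ennreal (l1norm x powr (1 - p)) \<partial>f t)) < \<infinity>) \<and>
    (\<forall>t>0. has_bochner_integral (f t) (\<lambda>x. x) (\<integral>x. x \<partial>f0)) \<and>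
    (\<forall>\<phi>\<in>C1c_Rstar_time.
        (\<forall>t>0. integrable (f t) (\<lambda>x. deriv (\<lambda>s. \<phi> (x, s)) t) \<and>
               integrable (f t \<Otimes>\<^sub>M f t) (\<lambda>(x, y). coag_integrand K \<phi> t x y)) \<and>
        set_integrable lborel {0<..} (\<lambda>t. \<integral>x. deriv (\<lambda>s. \<phi> (x, s)) t \<partial>f t) \<and>
        set_integrable lborel {0<..} (\<lambda>t. \<integral>x. (\<integral>y. coag_integrand K \<phi> t x y \<partial>f t) \<partial>f t) \<and>
        0 = (LINT t:{0<..}|lborel. (\<integral>x. deriv (\<lambda>s. \<phi> (x, s)) t \<partial>f t)) +
            1/2 * (LINT t:{0<..}|lborel. (\<integral>x. (\<integral>y. coag_integrand K \<phi> t x y \<partial>f t) \<partial>f t)))"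


section \<open>The discrete coagulation equation\<close>

definition vec_of_nat :: "nat ^ 'd \<Rightarrow> real ^ 'd"
  where "vec_of_nat \<alpha> = (\<chi> j. real (\<alpha> $ j))"

abbreviation nonzero_indices :: "(nat ^ 'd) set"
  where "nonzero_indices \<equiv> {\<alpha>. \<alpha> \<noteq> 0}"

text \<open>The sum of the Dirac masses \<open>c \<alpha> \<delta>\<^sub>\<alpha>\<close>, as the image of the weighted counting measure.\<close>

definition atomic_measure :: "(nat ^ 'd \<Rightarrow> real) \<Rightarrow> (real ^ 'd) measure"
  where "atomic_measure c =
    distr (point_measure nonzero_indices (\<lambda>\<alpha>. ennreal (c \<alpha>)))
      (restrict_space borel Rstar) vec_of_nat"

text \<open>
  A solution of the discrete equation is by definition a weak solution of the continuous
  equation carried by the lattice. \<open>K\<close> is a continuous kernel that extends the discrete one.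
\<close>

definition discrete_coagulation_solution ::
    "real \<Rightarrow> real \<Rightarrow> (real ^ 'd \<Rightarrow> real ^ 'd \<Rightarrow> real) \<Rightarrow> (nat ^ 'd \<Rightarrow> real) \<Rightarrow>
     (nat ^ 'd \<Rightarrow> real \<Rightarrow> real) \<Rightarrow> bool"
  where "discrete_coagulation_solution \<gamma> p K n0 n \<longleftrightarrow>
    (\<forall>\<alpha>\<in>nonzero_indices. \<forall>t\<ge>0. 0 \<le> n \<alpha> t) \<and>
    weak_solution \<gamma> p K (atomic_measure n0) (\<lambda>t. atomic_measure (\<lambda>\<alpha>. n \<alpha> t))"

definition total_mass :: "(nat ^ 'd \<Rightarrow> real) \<Rightarrow> real"
  where "total_mass n0 = (\<Sum>\<^sub>\<infinity>\<alpha>\<in>nonzero_indices. l1norm (vec_of_nat \<alpha>) * n0 \<alpha>)"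

definition mean_direction :: "(nat ^ 'd \<Rightarrow> real) \<Rightarrow> real ^ 'd"
  where "mean_direction n0 =
    (1 / total_mass n0) *\<^sub>R (\<Sum>\<^sub>\<infinity>\<alpha>\<in>nonzero_indices. n0 \<alpha> *\<^sub>R vec_of_nat \<alpha>)"

text \<open>The indices of size comparable to \<open>R\<close> and of direction close to \<open>\<theta>\<close>, with tolerance \<open>\<delta>\<close>.\<close>

definition localization_indices :: "real \<Rightarrow> real \<Rightarrow> real ^ 'd \<Rightarrow> (nat ^ 'd) set"
  where "localization_indices \<delta> R \<theta> =
    {\<alpha>\<in>nonzero_indices.
       \<delta> * R \<le> l1norm (vec_of_nat \<alpha>) \<and> l1norm (vec_of_nat \<alpha>) \<le> inverse \<delta> * R \<and>
       l1norm ((1 / l1norm (vec_of_nat \<alpha>)) *\<^sub>R vec_of_nat \<alpha> - \<theta>) \<le> \<delta>}"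

end

theory Submission
  imports Defs "HOL-Complex_Analysis.Great_Picard"
begin

text \<open>
  The truncated kernels, which vanish for \<open>|\<alpha>| + |\<beta>| > N\<close>, define finite systems; their explicit
  Euler schemes satisfy all the estimates with finite sums only, and these pass to a
  pointwise limit. Each estimate is the evolution of a test sum \<open>\<Sum>\<^sub>\<alpha> \<phi>(\<alpha>) n\<^sub>\<alpha>\<close>, whose rate is
  \<open>1/2 \<Sum> K n\<^sub>\<alpha> n\<^sub>\<beta> (\<phi>(\<alpha> + \<beta>) - \<phi>(\<alpha>) - \<phi>(\<beta>))\<close>.

  The concave function \<open>|\<alpha>| powr (1 - s)\<close> with \<open>0 < s < 1 - \<gamma>\<close> yields \<open>M' \<le> - c M powr (1 + (1 - \<gamma>) / s)\<close>,
  hence the decay \<open>t powr (- s / (1 - \<gamma>))\<close>: no mass stays far below \<open>R = t powr (1 / (1 - \<gamma>))\<close>. The convex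
  function \<open>|\<alpha>|\<^sup>2 / (|\<alpha>| + A)\<close> shows that no mass escapes far above \<open>R\<close>; it also gives the uniform
  integrability that makes the limit conserve mass. Finally, \<open>|\<alpha> - |\<alpha>| \<theta>\<^sub>0|\<^sup>2 / |\<alpha>|\<close> is subadditive and
  its dissipation controls the variance of the directions: since \<open>K / (|\<alpha>| + |\<beta>|)\<close> is of order \<open>1 / t\<close> in
  the window around \<open>R\<close>, and \<open>1 / t\<close> is not integrable at infinity, the variance tends to zero.
\<close>

section \<open>Lattice sizes and truncated sums\<close>

text \<open>Heuristics behind the exponents: a population of mass m concentrated near size R has
  about m / R particles, and the kernel is of order \<open>R powr \<gamma>\<close> there, so a
  particle collides at a rate of order \<open>R powr (\<gamma> - 1)\<close>. Growth at this rate
  gives R of order \<open>t powr (1 / (1 - \<gamma>))\<close>, where the rate is exactly of order 1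
  / t. The long-time estimates are scale invariant at this R: the powers of t cancel, and what
  remains depends on the relative width of the window. For the upper tail with p > 0 this is reached
  only because the rate of the convex test function contains the moment of order
  \<open>1 - pp\<close>, whose own decay supplies the missing power of t. The obstacle is that a
  truncated system freezes once its mass nears the truncation size, so no decay can hold for all
  times at fixed N. Hence the recurrent form of the estimates: a constant independent of T, and for
  every T a threshold N0 beyond which the estimate holds up to time T. Explicit Euler steps are
  chosen because nonnegativity and conservation then hold exactly at each step and follow by
  induction.\<close>

definition sz :: "nat ^ 'd \<Rightarrow> real"
  where "sz \<alpha> = l1norm (vec_of_nat \<alpha>)"

definition lat :: "real \<Rightarrow> (nat ^ 'd) set"
  where "lat N = {\<alpha>. \<alpha> \<noteq> 0 \<and> sz \<alpha> \<le> N}"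

definition splits :: "nat ^ 'd \<Rightarrow> ((nat ^ 'd) \<times> (nat ^ 'd)) set"
  where "splits \<alpha> = {(\<beta>, \<beta>'). \<beta> \<noteq> 0 \<and> \<beta>' \<noteq> 0 \<and> \<beta> + \<beta>' = \<alpha>}"

definition cut :: "real \<Rightarrow> (nat ^ 'd \<Rightarrow> nat ^ 'd \<Rightarrow> real) \<Rightarrow> nat ^ 'd \<Rightarrow> nat ^ 'd \<Rightarrow> real"
  where "cut N k \<alpha> \<beta> = (if sz \<alpha> + sz \<beta> \<le> N then k \<alpha> \<beta> else 0)"

definition coag_rate ::
    "real \<Rightarrow> (nat ^ 'd \<Rightarrow> nat ^ 'd \<Rightarrow> real) \<Rightarrow> (nat ^ 'd \<Rightarrow> real) \<Rightarrow> nat ^ 'd \<Rightarrow> real"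
  where "coag_rate N k u \<alpha> =
    1 / 2 * (\<Sum>(\<beta>, \<beta>')\<in>splits \<alpha>. k \<beta> \<beta>' * u \<beta> * u \<beta>') - u \<alpha> * (\<Sum>\<beta>\<in>lat N. k \<alpha> \<beta> * u \<beta>)"

lemma vec_of_nat_add: "vec_of_nat (\<alpha> + \<beta>) = vec_of_nat \<alpha> + vec_of_nat \<beta>"
  by (simp add: vec_of_nat_def vec_eq_iff)

lemma vec_of_nat_eq_iff [simp]: "vec_of_nat \<alpha> = vec_of_nat \<beta> \<longleftrightarrow> \<alpha> = \<beta>"
  by (simp add: vec_of_nat_def vec_eq_iff)

lemma vec_of_nat_0 [simp]: "vec_of_nat 0 = 0"
  by (simp add: vec_of_nat_def vec_eq_iff)

lemma vec_of_nat_in_Rstar: "\<alpha> \<noteq> 0 \<Longrightarrow> vec_of_nat \<alpha> \<in> Rstar"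
  using vec_of_nat_eq_iff[of \<alpha> 0, unfolded vec_of_nat_0]
  by (simp add: Rstar_def del: vec_of_nat_eq_iff) (simp add: vec_of_nat_def)

lemma sz_eq_sum: "sz \<alpha> = real (\<Sum>j\<in>UNIV. \<alpha> $ j)"
  by (simp add: sz_def l1norm_def vec_of_nat_def)

lemma sz_add: "sz (\<alpha> + \<beta>) = sz \<alpha> + sz \<beta>"
  by (simp add: sz_eq_sum sum.distrib)

lemma sz_ge_1: assumes "\<alpha> \<noteq> 0" shows "1 \<le> sz \<alpha>"
proof -
  obtain j where "\<alpha> $ j \<noteq> 0" using assms by (auto simp: vec_eq_iff)
  hence "(\<Sum>j\<in>UNIV. \<alpha> $ j) \<noteq> 0" by auto
  hence "1 \<le> (\<Sum>j\<in>UNIV. \<alpha> $ j)" by linarith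
  thus ?thesis unfolding sz_eq_sum by linarith
qed

lemma sz_nonneg [simp]: "0 \<le> sz \<alpha>"
  by (simp add: sz_def l1norm_def sum_nonneg)

lemma sz_pos: "\<alpha> \<noteq> 0 \<Longrightarrow> 0 < sz \<alpha>"
  using sz_ge_1[of \<alpha>] by linarith

lemma finite_sz_le: "finite {\<alpha> :: nat ^ 'd. sz \<alpha> \<le> r}"
proof -
  have "\<alpha> $ j \<le> nat \<lfloor>r\<rfloor>" if "sz \<alpha> \<le> r" for \<alpha> :: "nat ^ 'd" and j
  proof -
    have "\<alpha> $ j \<le> (\<Sum>j\<in>UNIV. \<alpha> $ j)" by (rule member_le_sum) auto
    hence "real (\<alpha> $ j) \<le> r" using that unfolding sz_eq_sum by linarith
    thus ?thesis by linarith
  qed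
  hence "{\<alpha> :: nat ^ 'd. sz \<alpha> \<le> r} \<subseteq> vec_lambda ` (UNIV \<rightarrow>\<^sub>E {..nat \<lfloor>r\<rfloor>})"
    by (auto intro!: image_eqI[where x="vec_nth _"])
  moreover have "finite (UNIV \<rightarrow>\<^sub>E {..nat \<lfloor>r\<rfloor>} :: ('d \<Rightarrow> nat) set)"
    by (intro finite_PiE) auto
  ultimately show ?thesis by (meson finite_imageI finite_subset)
qed

lemma finite_lat [simp]: "finite (lat N)"
  by (rule finite_subset[OF _ finite_sz_le[of N]]) (auto simp: lat_def)

lemma finite_lat_Collect [simp]: "finite {\<alpha>. \<alpha> \<noteq> 0 \<and> sz \<alpha> \<le> N}"
  using finite_lat[of N] by (simp only: lat_def)

lemma lat_nonzero: "\<alpha> \<in> lat N \<Longrightarrow> \<alpha> \<noteq> 0"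
  by (simp add: lat_def)

lemma lat_mono: "N \<le> N' \<Longrightarrow> lat N \<subseteq> lat N'"
  by (auto simp: lat_def)

lemma add_nonzero: "\<alpha> \<noteq> 0 \<Longrightarrow> \<alpha> + \<beta> \<noteq> (0 :: nat ^ 'd)"
  by (auto simp: vec_eq_iff)

lemma splits_subset: "splits \<alpha> \<subseteq> lat (sz \<alpha>) \<times> lat (sz \<alpha>)"
  by (auto simp: splits_def lat_def sz_add)

lemma finite_splits [simp]: "finite (splits \<alpha>)"
  by (rule finite_subset[OF splits_subset]) simp

lemma cut_sym: "k \<alpha> \<beta> = k \<beta> \<alpha> \<Longrightarrow> cut N k \<alpha> \<beta> = cut N k \<beta> \<alpha>"
  by (simp add: cut_def add.commute)

text \<open>Weak form of the truncated equation. The gain is regrouped by the value of \<alpha> +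
  \<beta>, and the loss is written half with \<phi> \<alpha> and half with \<phi> \<beta> by the
  symmetry of \<open>k\<close>. Every rate estimate below is a choice of \<phi> in this
  identity.\<close>

lemma sum_coag_rate:
  fixes k :: "nat ^ 'd \<Rightarrow> nat ^ 'd \<Rightarrow> real"
  assumes sym: "\<And>\<alpha> \<beta>. \<alpha> \<noteq> 0 \<Longrightarrow> \<beta> \<noteq> 0 \<Longrightarrow> k \<alpha> \<beta> = k \<beta> \<alpha>"
  shows "(\<Sum>\<alpha>\<in>lat N. \<phi> \<alpha> * coag_rate N (cut N k) u \<alpha>) =
    1 / 2 * (\<Sum>\<alpha>\<in>lat N. \<Sum>\<beta>\<in>lat N. cut N k \<alpha> \<beta> * u \<alpha> * u \<beta> * (\<phi> (\<alpha> + \<beta>) - \<phi> \<alpha> - \<phi> \<beta>))"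
proof -
  define L where "L = (lat N :: (nat ^ 'd) set)"
  define c where "c = cut N k"
  define S where "S = {x \<in> L \<times> L. fst x + snd x \<in> L}"
  have fin: "finite L" "finite S" by (auto simp: L_def S_def)
  have split: "{x \<in> S. fst x + snd x = \<alpha>} = splits \<alpha>" if "\<alpha> \<in> L" for \<alpha>
    using that by (auto simp: S_def splits_def L_def lat_def sz_add) (smt (verit) sz_nonneg)+
  have gain: "(\<Sum>\<alpha>\<in>L. \<phi> \<alpha> * (\<Sum>(\<beta>, \<beta>')\<in>splits \<alpha>. c \<beta> \<beta>' * u \<beta> * u \<beta>')) =
      (\<Sum>\<alpha>\<in>L. \<Sum>\<beta>\<in>L. c \<alpha> \<beta> * u \<alpha> * u \<beta> * \<phi> (\<alpha> + \<beta>))"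
  proof -
    have "(\<Sum>\<alpha>\<in>L. \<phi> \<alpha> * (\<Sum>(\<beta>, \<beta>')\<in>splits \<alpha>. c \<beta> \<beta>' * u \<beta> * u \<beta>')) =
        (\<Sum>\<alpha>\<in>L. \<Sum>x\<in>{x \<in> S. fst x + snd x = \<alpha>}.
          c (fst x) (snd x) * u (fst x) * u (snd x) * \<phi> (fst x + snd x))"
      unfolding sum_distrib_left
      by (intro sum.cong refl) (auto simp: split, auto simp: splits_def)
    also have "\<dots> = (\<Sum>x\<in>S. c (fst x) (snd x) * u (fst x) * u (snd x) * \<phi> (fst x + snd x))"
      using fin by (intro sum.group) (auto simp: S_def)
    \<comment> \<open>Pairs whose sum lies outside \<open>L\<close> contribute nothing because the
      cutoff kernel vanishes there.\<close>
    also have "\<dots> = (\<Sum>x\<in>L\<times>L. c (fst x) (snd x) * u (fst x) * u (snd x) * \<phi> (fst x + snd x))"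
      using fin
      by (intro sum.mono_neutral_left) (auto simp: S_def c_def cut_def L_def lat_def sz_add add_nonzero)
    finally show ?thesis by (simp add: sum.cartesian_product case_prod_beta)
  qed
  have loss1: "(\<Sum>\<alpha>\<in>L. \<phi> \<alpha> * (u \<alpha> * (\<Sum>\<beta>\<in>L. c \<alpha> \<beta> * u \<beta>))) =
      (\<Sum>\<alpha>\<in>L. \<Sum>\<beta>\<in>L. c \<alpha> \<beta> * u \<alpha> * u \<beta> * \<phi> \<alpha>)"
    by (simp add: sum_distrib_left mult_ac)
  have loss2: "(\<Sum>\<alpha>\<in>L. \<Sum>\<beta>\<in>L. c \<alpha> \<beta> * u \<alpha> * u \<beta> * \<phi> \<alpha>) =
      (\<Sum>\<alpha>\<in>L. \<Sum>\<beta>\<in>L. c \<alpha> \<beta> * u \<alpha> * u \<beta> * \<phi> \<beta>)"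
  proof (subst sum.swap, intro sum.cong refl)
    fix \<alpha> \<beta> assume "\<alpha> \<in> L" "\<beta> \<in> L"
    hence "c \<beta> \<alpha> = c \<alpha> \<beta>" unfolding c_def by (intro cut_sym sym) (auto simp: L_def lat_def)
    thus "c \<beta> \<alpha> * u \<beta> * u \<alpha> * \<phi> \<beta> = c \<alpha> \<beta> * u \<alpha> * u \<beta> * \<phi> \<beta>" by simp
  qed
  have "(\<Sum>\<alpha>\<in>L. \<phi> \<alpha> * coag_rate N c u \<alpha>) =
      1 / 2 * (\<Sum>\<alpha>\<in>L. \<phi> \<alpha> * (\<Sum>(\<beta>, \<beta>')\<in>splits \<alpha>. c \<beta> \<beta>' * u \<beta> * u \<beta>'))
      - (\<Sum>\<alpha>\<in>L. \<phi> \<alpha> * (u \<alpha> * (\<Sum>\<beta>\<in>L. c \<alpha> \<beta> * u \<beta>)))"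
    by (simp add: coag_rate_def L_def right_diff_distrib sum_subtractf sum_distrib_left mult_ac)
  also have "\<dots> = 1 / 2 * (\<Sum>\<alpha>\<in>L. \<Sum>\<beta>\<in>L. c \<alpha> \<beta> * u \<alpha> * u \<beta> * (\<phi> (\<alpha> + \<beta>) - \<phi> \<alpha> - \<phi> \<beta>))"
    unfolding gain loss1 right_diff_distrib sum_subtractf using loss2 by simp
  finally show ?thesis by (simp add: L_def c_def)
qed

lemma sum_coag_rate_additive:
  fixes k :: "nat ^ 'd \<Rightarrow> nat ^ 'd \<Rightarrow> real"
  assumes "\<And>\<alpha> \<beta>. \<alpha> \<noteq> 0 \<Longrightarrow> \<beta> \<noteq> 0 \<Longrightarrow> k \<alpha> \<beta> = k \<beta> \<alpha>"
    and "\<And>\<alpha> \<beta>. \<phi> (\<alpha> + \<beta>) = \<phi> \<alpha> + \<phi> \<beta>"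
  shows "(\<Sum>\<alpha>\<in>lat N. \<phi> \<alpha> * coag_rate N (cut N k) u \<alpha>) = 0"
  using assms(2) by (simp add: sum_coag_rate[OF assms(1)])

section \<open>Elementary inequalities\<close>

text \<open>The increment factors explicitly. Two of its factors are bounded by 1 and 2, and
  \<open>x / (x + A)\<close> is below both 1 and \<open>x / A\<close>, hence below every power of
  \<open>x / A\<close> in between. The free \<theta> is set to \<open>gap\<close> later, so that
  this power of x completes the growth of the kernel to a linear one.\<close>

lemma convex_test_increment:
  fixes x y A \<theta> :: real
  assumes "0 < x" "0 < y" "0 < A" "0 \<le> \<theta>" "\<theta> \<le> 1"
  shows "(x + y)\<^sup>2 / (x + y + A) - x\<^sup>2 / (x + A) - y\<^sup>2 / (y + A) \<le> 2 * y * (x / A) powr \<theta>"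
    (is "?D \<le> _")
proof -
  have "?D = A * x * y * (x + y + 2 * A) / ((x + A) * (y + A) * (x + y + A))"
  proof -
    have "x + A \<noteq> 0" "y + A \<noteq> 0" "x + y + A \<noteq> 0" using assms by auto
    thus ?thesis by (simp add: divide_simps) algebra
  qed
  also have "\<dots> = y * (x / (x + A)) * (A / (y + A)) * ((x + y + 2 * A) / (x + y + A))"
    by simp
  also have "\<dots> \<le> y * (x / (x + A)) * 1 * 2"
    using assms by (intro mult_mono) (auto simp: divide_simps)
  also have "x / (x + A) \<le> (x / A) powr \<theta>"
  proof (cases "x \<le> A")
    case True
    have "x / (x + A) \<le> x / A" using assms by (intro divide_left_mono) auto
    also have "\<dots> = (x / A) powr 1" using assms by simp
    also have "\<dots> \<le> (x / A) powr \<theta>" using assms True by (intro powr_mono') auto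
    finally show ?thesis .
  next
    case False
    have "x / (x + A) \<le> 1" using assms by simp
    also have "1 \<le> (x / A) powr \<theta>" using assms False by (intro ge_one_powr_ge_zero) auto
    finally show ?thesis .
  qed
  finally show ?thesis using assms by (simp add: mult_ac)
qed

text \<open>Each of x and y contributes itself times a decreasing factor z powr (- s), which after
  merging is evaluated at x + y. For x this factor does not increase; for y it shrinks by at least 2
  powr (- s), as x + y is at least 2 * y. Merging thus destroys a fixed fraction of the smaller
  term.\<close>

lemma subadditive_powr_gap:
  fixes x y s :: real
  assumes "0 < y" "y \<le> x" "0 < s"
  shows "(1 - 2 powr (- s)) * y powr (1 - s) \<le> x powr (1 - s) + y powr (1 - s) - (x + y) powr (1 - s)"
proof -
  have *: "z powr (1 - s) = z * z powr (- s)" if "0 < z" for z :: real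
    using that powr_mult_base[of z "- s"] by simp
  have "(x + y) powr (- s) \<le> x powr (- s)" using assms by (intro powr_mono2') auto
  moreover have "(x + y) powr (- s) \<le> (2 * y) powr (- s)" using assms by (intro powr_mono2') auto
  hence "(x + y) powr (- s) \<le> 2 powr (- s) * y powr (- s)" by (simp add: powr_mult)
  ultimately have "x * (x + y) powr (- s) + y * (x + y) powr (- s) \<le> x * x powr (- s) + y * (2 powr (- s) * y powr (- s))"
    using assms by (intro add_mono mult_left_mono) auto
  thus ?thesis using assms by (simp add: * algebra_simps)
qed

text \<open>Concavity: the power lies below its tangent at b, here in the form of Young's
  inequality. It bounds one term of a Riemann sum for the integral of t powr (- \<kappa>) by a
  telescoping difference.\<close>

lemma powr_increment_ge:
  fixes a b \<kappa> :: real
  assumes "0 \<le> a" "a \<le> b" "0 < b" "0 \<le> \<kappa>" "\<kappa> < 1"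
  shows "(1 - \<kappa>) * (b - a) * b powr (- \<kappa>) \<le> b powr (1 - \<kappa>) - a powr (1 - \<kappa>)"
proof -
  have "a powr (1 - \<kappa>) * b powr \<kappa> \<le> (1 - \<kappa>) * a + \<kappa> * b"
    using assms by (cases "a = 0") (auto intro: Youngs_inequality_0)
  hence "a powr (1 - \<kappa>) * (b powr \<kappa> * b powr (- \<kappa>)) \<le> ((1 - \<kappa>) * a + \<kappa> * b) * b powr (- \<kappa>)"
    by (metis mult.assoc mult_right_mono powr_ge_zero)
  moreover have "b powr \<kappa> * b powr (- \<kappa>) = 1" using assms by (simp flip: powr_add)
  moreover have "b powr (1 - \<kappa>) = b * b powr (- \<kappa>)" using assms powr_mult_base[of b "- \<kappa>"] by simp
  ultimately show ?thesis by (simp add: algebra_simps)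
qed

text \<open>Both signs of q occur, because the exponents - p and \<gamma> + 2 * p - 1 have no fixed
  sign; each side of the ratio condition serves one of them.\<close>

lemma powr_ge_of_ratio:
  fixes u r L q :: real
  assumes "0 < r" "1 \<le> L" "r / L \<le> u" "u \<le> L * r"
  shows "L powr (- \<bar>q\<bar>) * r powr q \<le> u powr q"
proof (cases "0 \<le> q")
  case True
  have "(r / L) powr q \<le> u powr q" using assms True by (intro powr_mono2) auto
  thus ?thesis using True by (simp add: powr_divide powr_minus_divide)
next
  case False
  have "0 < u" using assms by (smt (verit) divide_pos_pos)
  hence "(L * r) powr q \<le> u powr q" using assms False by (intro powr_mono2') auto
  thus ?thesis using False by (simp add: powr_mult)
qed

text \<open>A perfectly inelastic collision of masses x, y with momenta v, w: the loss of twice the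
  kinetic energy is the reduced mass times the squared relative velocity.\<close>

lemma kinetic_identity:
  fixes v w :: "'a::real_inner"
  assumes "0 < x" "0 < y"
  shows "(norm v)\<^sup>2 / x + (norm w)\<^sup>2 / y - (norm (v + w))\<^sup>2 / (x + y) =
    x * y / (x + y) * (norm (v /\<^sub>R x - w /\<^sub>R y))\<^sup>2"
proof -
  have "(norm (v + w))\<^sup>2 = (norm v)\<^sup>2 + 2 * (v \<bullet> w) + (norm w)\<^sup>2"
    by (simp add: power2_norm_eq_inner inner_add_left inner_add_right inner_commute)
  moreover have "(norm (v /\<^sub>R x - w /\<^sub>R y))\<^sup>2 = (norm v)\<^sup>2 / x\<^sup>2 - 2 * (v \<bullet> w) / (x * y) + (norm w)\<^sup>2 / y\<^sup>2"
    unfolding power2_norm_eq_inner inner_diff_left inner_diff_right inner_scaleR_left inner_scaleR_right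
    by (simp add: inner_commute[of w v] algebra_simps power2_eq_square divide_inverse)
  ultimately show ?thesis using assms by (simp add: divide_simps power2_eq_square) algebra
qed

text \<open>Lagrange's identity for masses \<open>X a * u a\<close> and velocities
  \<open>w a /\<^sub>R X a\<close>: the squared relative velocities summed over all pairs give twice
  the total mass times the energy, minus twice the squared total momentum. It turns dissipation over
  pairs into a variance.\<close>

lemma sum_pairs_kinetic:
  fixes w :: "'b \<Rightarrow> 'a::real_inner" and X u :: "'b \<Rightarrow> real"
  assumes "\<And>a. a \<in> S \<Longrightarrow> 0 < X a"
  shows "(\<Sum>a\<in>S. \<Sum>b\<in>S. X a * X b * (norm (w a /\<^sub>R X a - w b /\<^sub>R X b))\<^sup>2 * u a * u b) =
    2 * (\<Sum>a\<in>S. X a * u a) * (\<Sum>a\<in>S. (norm (w a))\<^sup>2 / X a * u a) - 2 * (norm (\<Sum>a\<in>S. u a *\<^sub>R w a))\<^sup>2"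
proof -
  have pw: "X a * X b * (norm (w a /\<^sub>R X a - w b /\<^sub>R X b))\<^sup>2 * u a * u b =
      (X b * u b) * ((norm (w a))\<^sup>2 / X a * u a) + (X a * u a) * ((norm (w b))\<^sup>2 / X b * u b)
      - 2 * ((u a *\<^sub>R w a) \<bullet> (u b *\<^sub>R w b))" if "a \<in> S" "b \<in> S" for a b
    using assms[OF that(1)] assms[OF that(2)]
    by (simp add: power2_norm_eq_inner inner_diff_left inner_diff_right inner_commute)
      (simp add: field_simps power2_eq_square)
  have n: "(norm (\<Sum>a\<in>S. u a *\<^sub>R w a))\<^sup>2 = (\<Sum>a\<in>S. \<Sum>b\<in>S. (u a *\<^sub>R w a) \<bullet> (u b *\<^sub>R w b))"
    unfolding power2_norm_eq_inner inner_sum_left inner_sum_right by (rule sum.swap)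
  have e1: "(\<Sum>a\<in>S. \<Sum>b\<in>S. (X a * u a) * ((norm (w b))\<^sup>2 / X b * u b)) =
      (\<Sum>a\<in>S. X a * u a) * (\<Sum>a\<in>S. (norm (w a))\<^sup>2 / X a * u a)"
    by (simp only: sum_product)
  have e2: "(\<Sum>a\<in>S. \<Sum>b\<in>S. (X b * u b) * ((norm (w a))\<^sup>2 / X a * u a)) =
      (\<Sum>a\<in>S. X a * u a) * (\<Sum>a\<in>S. (norm (w a))\<^sup>2 / X a * u a)"
    by (subst sum.swap) (rule e1)
  have "(\<Sum>a\<in>S. \<Sum>b\<in>S. X a * X b * (norm (w a /\<^sub>R X a - w b /\<^sub>R X b))\<^sup>2 * u a * u b) =
    (\<Sum>a\<in>S. \<Sum>b\<in>S. (X b * u b) * ((norm (w a))\<^sup>2 / X a * u a) + (X a * u a) * ((norm (w b))\<^sup>2 / X b * u b)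
      - 2 * ((u a *\<^sub>R w a) \<bullet> (u b *\<^sub>R w b)))"
    by (intro sum.cong refl pw)
  also have "\<dots> = 2 * (\<Sum>a\<in>S. X a * u a) * (\<Sum>a\<in>S. (norm (w a))\<^sup>2 / X a * u a)
      - (\<Sum>a\<in>S. \<Sum>b\<in>S. 2 * ((u a *\<^sub>R w a) \<bullet> (u b *\<^sub>R w b)))"
    by (simp only: sum.distrib sum_subtractf e1 e2)
  also have "(\<Sum>a\<in>S. \<Sum>b\<in>S. 2 * ((u a *\<^sub>R w a) \<bullet> (u b *\<^sub>R w b))) =
      2 * (\<Sum>a\<in>S. \<Sum>b\<in>S. (u a *\<^sub>R w a) \<bullet> (u b *\<^sub>R w b))"
    by (simp only: sum_distrib_left)
  finally show ?thesis unfolding n .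
qed

section \<open>Coagulation of a lattice population\<close>

text \<open>The bounds are the homogeneous ones multiplied out: (x + y) powr \<gamma> times
  \<open>\<Phi> p (x / (x + y))\<close> equals (x + y) powr (\<gamma> + 2 * p) * x powr (- p) * y
  powr (- p).\<close>

locale coag_kernel =
  fixes k :: "nat ^ 'd \<Rightarrow> nat ^ 'd \<Rightarrow> real" and c1 c2 \<gamma> p :: real
  assumes k_sym: "\<alpha> \<noteq> 0 \<Longrightarrow> \<beta> \<noteq> 0 \<Longrightarrow> k \<alpha> \<beta> = k \<beta> \<alpha>"
    and k_lower: "\<alpha> \<noteq> 0 \<Longrightarrow> \<beta> \<noteq> 0 \<Longrightarrow>
      c1 * ((sz \<alpha> + sz \<beta>) powr (\<gamma> + 2 * p) * sz \<alpha> powr (- p) * sz \<beta> powr (- p)) \<le> k \<alpha> \<beta>"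
    and k_upper: "\<alpha> \<noteq> 0 \<Longrightarrow> \<beta> \<noteq> 0 \<Longrightarrow>
      k \<alpha> \<beta> \<le> c2 * ((sz \<alpha> + sz \<beta>) powr (\<gamma> + 2 * p) * sz \<alpha> powr (- p) * sz \<beta> powr (- p))"
    and c_pos: "0 < c1" "0 < c2"
    and \<gamma>: "0 \<le> \<gamma>" "\<gamma> < 1"
    and \<gamma>p: "0 \<le> \<gamma> + 2 * p" "0 \<le> \<gamma> + p" "\<gamma> + p < 1"
begin

text \<open>
  Sizes on the lattice are at least \<open>1\<close>, so that upper bounds for the kernel remain true
  with \<open>p\<close> replaced by its positive part.
\<close>

definition pp :: real where "pp = max p 0"

text \<open>The kernel grows at most like the power \<gamma> + pp of the larger size
  (\<open>k_upper_ordered\<close>); \<open>gap\<close> is what is missing to linear growth, and it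
  becomes the decay exponent of the tails.\<close>

definition gap :: real where "gap = 1 - \<gamma> - pp"

definition C2 :: real where "C2 = c2 * 2 powr (\<gamma> + 2 * p)"

lemma pp_nonneg: "0 \<le> pp" and gap_pos: "0 < gap" and gap_le_1: "gap \<le> 1" and C2_pos: "0 < C2"
  and pp_less: "pp < 1 - \<gamma>"
  using \<gamma> \<gamma>p c_pos by (auto simp: pp_def gap_def C2_def)

lemma k_nonneg: "\<alpha> \<noteq> 0 \<Longrightarrow> \<beta> \<noteq> 0 \<Longrightarrow> 0 \<le> k \<alpha> \<beta>"
  using k_lower[of \<alpha> \<beta>] c_pos by (smt (verit) mult_nonneg_nonneg powr_ge_zero)

lemma cut_nonneg: "\<alpha> \<noteq> 0 \<Longrightarrow> \<beta> \<noteq> 0 \<Longrightarrow> 0 \<le> cut N k \<alpha> \<beta>"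
  and cut_le: "\<alpha> \<noteq> 0 \<Longrightarrow> \<beta> \<noteq> 0 \<Longrightarrow> cut N k \<alpha> \<beta> \<le> k \<alpha> \<beta>"
  using k_nonneg[of \<alpha> \<beta>] by (auto simp: cut_def)

text \<open>x + y is at most 2 * x, which gives a power of x and the constant in \<open>C2\<close>.
  For p < 0 the factor y powr (- p) is increasing in y and is absorbed into the power of x.\<close>

lemma k_upper_ordered:
  assumes "\<alpha> \<noteq> 0" "\<beta> \<noteq> 0" "sz \<beta> \<le> sz \<alpha>"
  shows "k \<alpha> \<beta> \<le> C2 * (sz \<alpha> powr (\<gamma> + pp) * sz \<beta> powr (- pp))"
proof -
  define x y where "x = sz \<alpha>" and "y = sz \<beta>"
  have xy: "1 \<le> y" "y \<le> x" using assms sz_ge_1 by (auto simp: x_def y_def)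
  have "(x + y) powr (\<gamma> + 2 * p) \<le> (2 * x) powr (\<gamma> + 2 * p)"
    using xy \<gamma>p by (intro powr_mono2) auto
  hence "(x + y) powr (\<gamma> + 2 * p) * x powr (- p) * y powr (- p)
      \<le> 2 powr (\<gamma> + 2 * p) * x powr (\<gamma> + 2 * p) * x powr (- p) * y powr (- p)"
    by (intro mult_right_mono) (auto simp: powr_mult)
  also have "\<dots> = 2 powr (\<gamma> + 2 * p) * (x powr (\<gamma> + p) * y powr (- p))"
    using powr_add[of x "\<gamma> + 2 * p" "- p"] by (simp add: add.commute)
  also have "x powr (\<gamma> + p) * y powr (- p) \<le> x powr (\<gamma> + pp) * y powr (- pp)"
  proof (cases "0 \<le> p")
    case False
    have "y powr (- p) \<le> x powr (- p)" using xy False by (intro powr_mono2) auto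
    hence "x powr (\<gamma> + p) * y powr (- p) \<le> x powr (\<gamma> + p) * x powr (- p)"
      by (intro mult_left_mono) auto
    also have "\<dots> = x powr \<gamma>" by (simp flip: powr_add)
    finally show ?thesis using False xy by (simp add: pp_def)
  qed (simp add: pp_def)
  finally have *: "(x + y) powr (\<gamma> + 2 * p) * x powr (- p) * y powr (- p)
      \<le> 2 powr (\<gamma> + 2 * p) * (x powr (\<gamma> + pp) * y powr (- pp))" by simp
  have "k \<alpha> \<beta> \<le> c2 * ((x + y) powr (\<gamma> + 2 * p) * x powr (- p) * y powr (- p))"
    using k_upper[OF assms(1,2)] by (simp add: x_def y_def)
  also have "\<dots> \<le> c2 * (2 powr (\<gamma> + 2 * p) * (x powr (\<gamma> + pp) * y powr (- pp)))"
    using * c_pos by (intro mult_left_mono) auto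
  finally show ?thesis by (simp add: C2_def x_def y_def)
qed

lemma k_upper_product:
  assumes "\<alpha> \<noteq> 0" "\<beta> \<noteq> 0"
  shows "k \<alpha> \<beta> \<le> C2 * (sz \<alpha> powr (\<gamma> + pp) * sz \<beta> powr (\<gamma> + pp))"
proof -
  have *: "k \<alpha> \<beta> \<le> C2 * (sz \<alpha> powr (\<gamma> + pp) * sz \<beta> powr (\<gamma> + pp))"
    if "\<alpha> \<noteq> 0" "\<beta> \<noteq> 0" "sz \<beta> \<le> sz \<alpha>" for \<alpha> \<beta>
  proof -
    have "sz \<beta> powr (- pp) \<le> sz \<beta> powr (\<gamma> + pp)"
      using sz_ge_1[OF that(2)] pp_nonneg \<gamma> by (intro powr_mono) auto
    hence "C2 * (sz \<alpha> powr (\<gamma> + pp) * sz \<beta> powr (- pp)) \<le> C2 * (sz \<alpha> powr (\<gamma> + pp) * sz \<beta> powr (\<gamma> + pp))"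
      using C2_pos by (intro mult_left_mono) auto
    with k_upper_ordered[OF that] show ?thesis by linarith
  qed
  show ?thesis
  proof (cases "sz \<beta> \<le> sz \<alpha>")
    case False
    thus ?thesis using *[of \<beta> \<alpha>] assms k_sym[OF assms] by (simp add: mult.commute)
  qed (use * assms in auto)
qed

lemma k_lower_block:
  assumes "\<alpha> \<noteq> 0" "\<beta> \<noteq> 0" "0 < b" "b \<le> sz \<alpha>" "sz \<alpha> \<le> 2 * b" "b \<le> sz \<beta>" "sz \<beta> \<le> 2 * b"
  shows "c1 * b powr \<gamma> \<le> k \<alpha> \<beta>"
proof -
  have 1: "(2 * b) powr (\<gamma> + 2 * p) \<le> (sz \<alpha> + sz \<beta>) powr (\<gamma> + 2 * p)"
    using assms \<gamma>p by (intro powr_mono2) auto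
  \<comment> \<open>The sign of p decides whether the sizes are compared with 2 * b or with b; the
    three exponents add up to \<gamma> in either case.\<close>
  have "b powr \<gamma> \<le> (sz \<alpha> + sz \<beta>) powr (\<gamma> + 2 * p) * sz \<alpha> powr (- p) * sz \<beta> powr (- p)"
  proof (cases "0 \<le> p")
    case True
    have "(2 * b) powr (- p) \<le> sz \<alpha> powr (- p)" "(2 * b) powr (- p) \<le> sz \<beta> powr (- p)"
      using assms True by (auto intro!: powr_mono2')
    with 1 have "(2 * b) powr (\<gamma> + 2 * p) * (2 * b) powr (- p) * (2 * b) powr (- p)
        \<le> (sz \<alpha> + sz \<beta>) powr (\<gamma> + 2 * p) * sz \<alpha> powr (- p) * sz \<beta> powr (- p)"
      by (intro mult_mono) auto
    moreover have "(2 * b) powr (\<gamma> + 2 * p) * (2 * b) powr (- p) * (2 * b) powr (- p) = (2 * b) powr \<gamma>"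
      by (simp flip: powr_add)
    moreover have "b powr \<gamma> \<le> (2 * b) powr \<gamma>" using assms \<gamma> by (intro powr_mono2) auto
    ultimately show ?thesis by linarith
  next
    case False
    have "b powr (- p) \<le> sz \<alpha> powr (- p)" "b powr (- p) \<le> sz \<beta> powr (- p)"
      using assms False by (auto intro!: powr_mono2)
    moreover have "b powr (\<gamma> + 2 * p) \<le> (sz \<alpha> + sz \<beta>) powr (\<gamma> + 2 * p)"
      using assms \<gamma>p by (intro powr_mono2) auto
    ultimately have "b powr (\<gamma> + 2 * p) * b powr (- p) * b powr (- p)
        \<le> (sz \<alpha> + sz \<beta>) powr (\<gamma> + 2 * p) * sz \<alpha> powr (- p) * sz \<beta> powr (- p)"
      by (intro mult_mono) auto
    moreover have "b powr (\<gamma> + 2 * p) * b powr (- p) * b powr (- p) = b powr \<gamma>"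
      by (simp flip: powr_add)
    ultimately show ?thesis by linarith
  qed
  hence "c1 * b powr \<gamma> \<le> c1 * ((sz \<alpha> + sz \<beta>) powr (\<gamma> + 2 * p) * sz \<alpha> powr (- p) * sz \<beta> powr (- p))"
    using c_pos by (intro mult_left_mono) auto
  with k_lower[OF assms(1,2)] show ?thesis by linarith
qed

text \<open>With \<theta> = gap in \<open>convex_test_increment\<close>, the powers of the larger
  size combine to x powr (\<gamma> + pp) * x powr gap = x, which sums to the mass; of the smaller
  size the power 1 - pp is left. The negative power of A is the gain.\<close>

lemma convex_test_rate:
  assumes u: "\<And>\<alpha>. \<alpha> \<in> lat N \<Longrightarrow> 0 \<le> u \<alpha>" and A: "0 < A"
  shows "(\<Sum>\<alpha>\<in>lat N. (sz \<alpha>)\<^sup>2 / (sz \<alpha> + A) * coag_rate N (cut N k) u \<alpha>) \<le>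
    2 * C2 * A powr (- gap) * (\<Sum>\<alpha>\<in>lat N. sz \<alpha> * u \<alpha>) * (\<Sum>\<alpha>\<in>lat N. sz \<alpha> powr (1 - pp) * u \<alpha>)"
proof -
  define \<phi> where "\<phi> \<alpha> = (sz \<alpha>)\<^sup>2 / (sz \<alpha> + A)" for \<alpha> :: "nat ^ 'd"
  define B where "B = 2 * C2 * A powr (- gap)"
  have B: "0 \<le> B" using C2_pos by (simp add: B_def)
  have ordered: "cut N k \<alpha> \<beta> * (\<phi> (\<alpha> + \<beta>) - \<phi> \<alpha> - \<phi> \<beta>) \<le> B * (sz \<alpha> * sz \<beta> powr (1 - pp))"
    if "\<alpha> \<noteq> 0" "\<beta> \<noteq> 0" "sz \<beta> \<le> sz \<alpha>" for \<alpha> \<beta>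
  proof -
    define x y where "x = sz \<alpha>" and "y = sz \<beta>"
    have xy: "0 < x" "0 < y" using that sz_pos by (auto simp: x_def y_def)
    have "\<phi> (\<alpha> + \<beta>) - \<phi> \<alpha> - \<phi> \<beta> \<le> 2 * y * (x / A) powr gap"
      using convex_test_increment[OF xy A, of gap] gap_pos gap_le_1
      by (simp add: \<phi>_def sz_add x_def y_def)
    hence "cut N k \<alpha> \<beta> * (\<phi> (\<alpha> + \<beta>) - \<phi> \<alpha> - \<phi> \<beta>) \<le> cut N k \<alpha> \<beta> * (2 * y * (x / A) powr gap)"
      using cut_nonneg that by (intro mult_left_mono) auto
    also have "\<dots> \<le> (C2 * (x powr (\<gamma> + pp) * y powr (- pp))) * (2 * y * (x / A) powr gap)"
      using cut_le[OF that(1,2), of N] k_upper_ordered[OF that] xy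
      by (intro mult_right_mono) (auto simp: x_def y_def)
    also have "\<dots> = B * ((x powr (\<gamma> + pp) * x powr gap) * (y * y powr (- pp)))"
      by (simp add: B_def powr_divide powr_minus_divide mult_ac)
    also have "x powr (\<gamma> + pp) * x powr gap = x" using xy by (simp add: gap_def flip: powr_add)
    also have "y * y powr (- pp) = y powr (1 - pp)" using xy powr_mult_base[of y "- pp"] by simp
    finally show ?thesis by (simp add: x_def y_def)
  qed
  \<comment> \<open>The ordered bound applies to one of the two orders only. Adding both right-hand
    sides makes it symmetric at the cost of a factor 2, which the 1 / 2 of the weak form
    cancels.\<close>
  have pair: "cut N k \<alpha> \<beta> * u \<alpha> * u \<beta> * (\<phi> (\<alpha> + \<beta>) - \<phi> \<alpha> - \<phi> \<beta>) \<le>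
      B * ((sz \<alpha> * u \<alpha>) * (sz \<beta> powr (1 - pp) * u \<beta>)) + B * ((sz \<alpha> powr (1 - pp) * u \<alpha>) * (sz \<beta> * u \<beta>))"
    if ab: "\<alpha> \<in> lat N" "\<beta> \<in> lat N" for \<alpha> \<beta>
  proof -
    have nz: "\<alpha> \<noteq> 0" "\<beta> \<noteq> 0" using ab by (auto simp: lat_def)
    have "cut N k \<alpha> \<beta> * (\<phi> (\<alpha> + \<beta>) - \<phi> \<alpha> - \<phi> \<beta>) \<le>
        B * (sz \<alpha> * sz \<beta> powr (1 - pp)) + B * (sz \<alpha> powr (1 - pp) * sz \<beta>)"
    proof (cases "sz \<beta> \<le> sz \<alpha>")
      case True
      have "0 \<le> B * (sz \<alpha> powr (1 - pp) * sz \<beta>)" using B by simp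
      with ordered[OF nz True] show ?thesis by linarith
    next
      case False
      have "cut N k \<alpha> \<beta> * (\<phi> (\<alpha> + \<beta>) - \<phi> \<alpha> - \<phi> \<beta>) \<le> B * (sz \<beta> * sz \<alpha> powr (1 - pp))"
        using ordered[OF nz(2,1)] False cut_sym[of k \<alpha> \<beta> N] k_sym[OF nz] by (simp add: add.commute algebra_simps)
      moreover have "0 \<le> B * (sz \<alpha> * sz \<beta> powr (1 - pp))" using B by simp
      ultimately show ?thesis by (simp add: mult.commute)
    qed
    hence "u \<alpha> * u \<beta> * (cut N k \<alpha> \<beta> * (\<phi> (\<alpha> + \<beta>) - \<phi> \<alpha> - \<phi> \<beta>)) \<le>
        u \<alpha> * u \<beta> * (B * (sz \<alpha> * sz \<beta> powr (1 - pp)) + B * (sz \<alpha> powr (1 - pp) * sz \<beta>))"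
      using u ab by (intro mult_left_mono) auto
    thus ?thesis by (simp add: algebra_simps)
  qed
  have dbl: "(\<Sum>\<alpha>\<in>lat N. \<Sum>\<beta>\<in>lat N. B * (f \<alpha> * g \<beta>)) = B * ((\<Sum>\<alpha>\<in>lat N. f \<alpha>) * (\<Sum>\<beta>\<in>lat N. g \<beta>))"
    for f g :: "nat ^ 'd \<Rightarrow> real"
    by (simp only: sum_product) (simp only: sum_distrib_left)
  have "(\<Sum>\<alpha>\<in>lat N. \<phi> \<alpha> * coag_rate N (cut N k) u \<alpha>) =
      1 / 2 * (\<Sum>\<alpha>\<in>lat N. \<Sum>\<beta>\<in>lat N. cut N k \<alpha> \<beta> * u \<alpha> * u \<beta> * (\<phi> (\<alpha> + \<beta>) - \<phi> \<alpha> - \<phi> \<beta>))"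
    by (rule sum_coag_rate[OF k_sym])
  also have "\<dots> \<le> 1 / 2 * (\<Sum>\<alpha>\<in>lat N. \<Sum>\<beta>\<in>lat N.
      B * ((sz \<alpha> * u \<alpha>) * (sz \<beta> powr (1 - pp) * u \<beta>)) + B * ((sz \<alpha> powr (1 - pp) * u \<alpha>) * (sz \<beta> * u \<beta>)))"
    by (intro mult_left_mono sum_mono pair) auto
  also have "\<dots> = 1 / 2 * (B * ((\<Sum>\<alpha>\<in>lat N. sz \<alpha> * u \<alpha>) * (\<Sum>\<alpha>\<in>lat N. sz \<alpha> powr (1 - pp) * u \<alpha>)) +
      B * ((\<Sum>\<alpha>\<in>lat N. sz \<alpha> powr (1 - pp) * u \<alpha>) * (\<Sum>\<alpha>\<in>lat N. sz \<alpha> * u \<alpha>)))"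
    by (simp only: sum.distrib dbl)
  finally show ?thesis by (simp add: \<phi>_def B_def mult_ac distrib_left)
qed

text \<open>
  Pairs within one dyadic block of sizes already dissipate enough, by the Cauchy-Schwarz inequality
  over the blocks. The lower bound on \<open>N\<close> keeps the blocks that carry half of the moment below the
  truncation.
\<close>

lemma moment_dissipation:
  assumes s: "0 < s" "s < 1 - \<gamma>" and m: "0 < m"
  obtains c where "0 < c"
    "\<And>N u. (\<And>\<alpha>. \<alpha> \<in> lat N \<Longrightarrow> 0 \<le> u \<alpha>) \<Longrightarrow> (\<Sum>\<alpha>\<in>lat N. sz \<alpha> * u \<alpha>) \<le> m \<Longrightarrow>
      0 < (\<Sum>\<alpha>\<in>lat N. sz \<alpha> powr (1 - s) * u \<alpha>) \<Longrightarrow>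
      4 * (2 * m / (\<Sum>\<alpha>\<in>lat N. sz \<alpha> powr (1 - s) * u \<alpha>)) powr (1 / s) \<le> N \<Longrightarrow>
      (\<Sum>\<alpha>\<in>lat N. sz \<alpha> powr (1 - s) * coag_rate N (cut N k) u \<alpha>) \<le>
        - c * (\<Sum>\<alpha>\<in>lat N. sz \<alpha> powr (1 - s) * u \<alpha>) powr (1 + (1 - \<gamma>) / s)"
proof
  \<comment> \<open>The exponent left over by Cauchy-Schwarz: 1 - s = (\<gamma> + (1 - s)) / 2 +
    \<kappa> / 2. It is positive because s < 1 - \<gamma>, so the geometric sum of
    \<open>b i powr \<kappa>\<close> is comparable to its last term.\<close>
  define \<kappa> where "\<kappa> = 1 - s - \<gamma>"
  define q where "q = (2::real) powr \<kappa>"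
  define c0 where "c0 = 1 - 2 powr (- s)"
  define c where "c = c1 * c0 / 2 * (1 / 16 * ((q - 1) / (2 powr \<kappa> * (2 * m) powr (\<kappa> / s))))"
  have \<kappa>: "0 < \<kappa>" using s by (simp add: \<kappa>_def)
  have q: "1 < q" using \<kappa> by (simp add: q_def)
  have c0: "0 < c0" using s by (simp add: c0_def powr_minus_divide)
  show "0 < c" using c_pos c0 q m by (simp add: c_def)
  fix N :: real and u :: "nat ^ 'd \<Rightarrow> real"
  assume u: "\<And>\<alpha>. \<alpha> \<in> lat N \<Longrightarrow> 0 \<le> u \<alpha>" and um: "(\<Sum>\<alpha>\<in>lat N. sz \<alpha> * u \<alpha>) \<le> m"
  define M where "M = (\<Sum>\<alpha>\<in>lat N. sz \<alpha> powr (1 - s) * u \<alpha>)"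
  assume "0 < (\<Sum>\<alpha>\<in>lat N. sz \<alpha> powr (1 - s) * u \<alpha>)"
    and "4 * (2 * m / (\<Sum>\<alpha>\<in>lat N. sz \<alpha> powr (1 - s) * u \<alpha>)) powr (1 / s) \<le> N"
  hence M: "0 < M" and N: "4 * (2 * m / M) powr (1 / s) \<le> N" by (auto simp: M_def)
  \<comment> \<open>Chosen so that y powr (- s) * m = M / 2: sizes above y carry at most half of the
    moment, because their mass is at most m.\<close>
  define y where "y = (2 * m / M) powr (1 / s)"
  define L where "L = (lat N :: (nat ^ 'd) set)"
  have finL: "finite L" by (simp add: L_def)
  have Lnz: "\<alpha> \<noteq> 0" if "\<alpha> \<in> L" for \<alpha> using that by (simp add: L_def lat_def)
  have "M \<le> (\<Sum>\<alpha>\<in>L. sz \<alpha> * u \<alpha>)" unfolding M_def L_def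
  proof (intro sum_mono mult_right_mono u)
    fix \<alpha> :: "nat ^ 'd" assume "\<alpha> \<in> lat N"
    hence "1 \<le> sz \<alpha>" using sz_ge_1 lat_nonzero by blast
    hence "sz \<alpha> powr (1 - s) \<le> sz \<alpha> powr 1" using s by (intro powr_mono) auto
    thus "sz \<alpha> powr (1 - s) \<le> sz \<alpha>" by simp
  qed
  hence Mm: "M \<le> m" using um by (simp add: L_def)
  have y1: "1 \<le> y" unfolding y_def using M Mm s m by (intro ge_one_powr_ge_zero) auto
  have ys: "y powr s = 2 * m / M" using M m s by (simp add: y_def powr_powr)
  obtain n :: nat where n: "2 ^ n \<le> y" "y < 2 ^ (n + 1)"
  proof -
    define n where "n = nat \<lfloor>log 2 y\<rfloor>"
    have "0 \<le> log 2 y" using y1 by simp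
    hence "real n \<le> log 2 y" "log 2 y < real (n + 1)" unfolding n_def by linarith+
    hence "2 powr real n \<le> y" "y < 2 powr real (n + 1)" using y1 by (simp_all add: le_log_iff log_less_iff)
    thus ?thesis using that[of n] by (simp only: powr_realpow zero_less_numeral)
  qed
  define B where "B i = {\<alpha> \<in> L. 2 ^ i \<le> sz \<alpha> \<and> sz \<alpha> < 2 ^ (i + 1)}" for i :: nat
  define \<nu> where "\<nu> i = (\<Sum>\<alpha>\<in>B i. u \<alpha>)" for i
  define b where "b i = (2::real) ^ i" for i :: nat
  have b: "0 < b i" for i by (simp add: b_def)
  have finB: "finite (B i)" for i using finL by (simp add: B_def)
  have B_index: "i = j" if "\<alpha> \<in> B i" "\<alpha> \<in> B j" for \<alpha> i j
  proof -
    have "i \<le> j" if "\<alpha> \<in> B i" "\<alpha> \<in> B j" for i j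
    proof -
      have "(2::real) ^ i < 2 ^ (j + 1)" using that by (auto simp: B_def)
      hence "i < j + 1" using power_strict_increasing_iff[of "2::real" i "j + 1"] by simp
      thus ?thesis by simp
    qed
    thus ?thesis using that by (meson antisym)
  qed
  have \<nu>: "0 \<le> \<nu> i" for i unfolding \<nu>_def by (rule sum_nonneg) (auto simp: B_def L_def intro: u)
  define S where "S = (\<Sum>i<n+1. b i powr (\<gamma> + (1 - s)) * (\<nu> i)\<^sup>2)"
  define f where "f \<alpha> \<beta> = cut N k \<alpha> \<beta> * u \<alpha> * u \<beta> *
    (sz \<alpha> powr (1 - s) + sz \<beta> powr (1 - s) - (sz \<alpha> + sz \<beta>) powr (1 - s))" for \<alpha> \<beta>
  have gap_ord: "c0 * b' powr (1 - s) \<le> sz \<alpha> powr (1 - s) + sz \<beta> powr (1 - s) - (sz \<alpha> + sz \<beta>) powr (1 - s)"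
    if "0 < b'" "b' \<le> sz \<beta>" "sz \<beta> \<le> sz \<alpha>" for \<alpha> \<beta> :: "nat ^ 'd" and b'
  proof -
    have "b' powr (1 - s) \<le> sz \<beta> powr (1 - s)" using that s \<gamma> by (intro powr_mono2) auto
    hence "c0 * b' powr (1 - s) \<le> c0 * sz \<beta> powr (1 - s)" using c0 by (intro mult_left_mono) auto
    with subadditive_powr_gap[of "sz \<beta>" "sz \<alpha>" s] that s show ?thesis by (simp add: c0_def)
  qed
  have gap_b: "c0 * b' powr (1 - s) \<le> sz \<alpha> powr (1 - s) + sz \<beta> powr (1 - s) - (sz \<alpha> + sz \<beta>) powr (1 - s)"
    if "0 < b'" "b' \<le> sz \<alpha>" "b' \<le> sz \<beta>" for \<alpha> \<beta> :: "nat ^ 'd" and b'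
    using gap_ord[of b' \<beta> \<alpha>] gap_ord[of b' \<alpha> \<beta>] that by (cases "sz \<beta> \<le> sz \<alpha>") (auto simp: algebra_simps)
  have f0: "0 \<le> f \<alpha> \<beta>" if "\<alpha> \<in> L" "\<beta> \<in> L" for \<alpha> \<beta>
  proof -
    have "0 \<le> c0 * 1 powr (1 - s)" using c0 by simp
    also have "\<dots> \<le> sz \<alpha> powr (1 - s) + sz \<beta> powr (1 - s) - (sz \<alpha> + sz \<beta>) powr (1 - s)"
      using that Lnz sz_ge_1 by (intro gap_b) auto
    finally show ?thesis unfolding f_def using that u Lnz cut_nonneg
      by (intro mult_nonneg_nonneg) (auto simp: L_def)
  qed
  have fB: "c1 * c0 * b i powr (\<gamma> + (1 - s)) * (u \<alpha> * u \<beta>) \<le> f \<alpha> \<beta>"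
    if "i < n + 1" "\<alpha> \<in> B i" "\<beta> \<in> B i" for i \<alpha> \<beta>
  proof -
    have ab: "\<alpha> \<noteq> 0" "\<beta> \<noteq> 0" "b i \<le> sz \<alpha>" "sz \<alpha> \<le> 2 * b i" "b i \<le> sz \<beta>" "sz \<beta> \<le> 2 * b i"
      "\<alpha> \<in> lat N" "\<beta> \<in> lat N"
      using that Lnz by (auto simp: B_def b_def L_def)
    have "(2::real) ^ i \<le> 2 ^ n" using that by (intro power_increasing) auto
    hence "b i \<le> y" using n(1) unfolding b_def by linarith
    \<comment> \<open>Both sizes are at most 2 * b i, hence at most 2 * y; this is the origin of the
      factor 4 in the condition on N.\<close>
    hence "sz \<alpha> + sz \<beta> \<le> N" using ab N by (simp add: y_def)
    hence "c1 * b i powr \<gamma> \<le> cut N k \<alpha> \<beta>"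
      using k_lower_block[OF ab(1,2) b ab(3-6)] by (simp add: cut_def)
    hence "(c1 * b i powr \<gamma>) * (c0 * b i powr (1 - s)) \<le> cut N k \<alpha> \<beta> *
       (sz \<alpha> powr (1 - s) + sz \<beta> powr (1 - s) - (sz \<alpha> + sz \<beta>) powr (1 - s))"
      using c0 c_pos ab by (intro mult_mono gap_b) (auto simp: b_def cut_nonneg)
    hence "(u \<alpha> * u \<beta>) * ((c1 * b i powr \<gamma>) * (c0 * b i powr (1 - s))) \<le> (u \<alpha> * u \<beta>) * (cut N k \<alpha> \<beta> *
       (sz \<alpha> powr (1 - s) + sz \<beta> powr (1 - s) - (sz \<alpha> + sz \<beta>) powr (1 - s)))"
      using u ab by (intro mult_left_mono) auto
    thus ?thesis by (simp add: f_def powr_add mult_ac)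
  qed
  \<comment> \<open>Pairs from different blocks are dropped; their terms are nonnegative by
    subadditivity of the power.\<close>
  have D: "c1 * c0 * S \<le> (\<Sum>\<alpha>\<in>L. \<Sum>\<beta>\<in>L. f \<alpha> \<beta>)"
  proof -
    have "c1 * c0 * S = (\<Sum>i<n+1. \<Sum>\<alpha>\<in>B i. \<Sum>\<beta>\<in>B i. c1 * c0 * b i powr (\<gamma> + (1 - s)) * (u \<alpha> * u \<beta>))"
      unfolding S_def \<nu>_def power2_eq_square sum_product
      by (simp only: sum_distrib_left mult.assoc)
    also have "\<dots> \<le> (\<Sum>i<n+1. \<Sum>\<alpha>\<in>B i. \<Sum>\<beta>\<in>B i. f \<alpha> \<beta>)"
      by (intro sum_mono fB) auto
    also have "\<dots> = (\<Sum>i<n+1. \<Sum>x\<in>B i \<times> B i. f (fst x) (snd x))"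
      by (simp add: sum.cartesian_product case_prod_beta)
    also have "\<dots> = (\<Sum>x\<in>(\<Union>i<n+1. B i \<times> B i). f (fst x) (snd x))"
      using finB B_index by (intro sum.UNION_disjoint[symmetric]) auto
    also have "\<dots> \<le> (\<Sum>x\<in>L \<times> L. f (fst x) (snd x))"
      using finL f0 by (intro sum_mono2) (auto simp: B_def)
    also have "\<dots> = (\<Sum>\<alpha>\<in>L. \<Sum>\<beta>\<in>L. f \<alpha> \<beta>)"
      by (simp add: sum.cartesian_product case_prod_beta)
    finally show ?thesis .
  qed
  have large: "(\<Sum>\<alpha>\<in>{\<alpha>\<in>L. y \<le> sz \<alpha>}. sz \<alpha> powr (1 - s) * u \<alpha>) \<le> M / 2"
  proof -
    have "(\<Sum>\<alpha>\<in>{\<alpha>\<in>L. y \<le> sz \<alpha>}. sz \<alpha> powr (1 - s) * u \<alpha>)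
        \<le> (\<Sum>\<alpha>\<in>{\<alpha>\<in>L. y \<le> sz \<alpha>}. y powr (- s) * (sz \<alpha> * u \<alpha>))"
    proof (intro sum_mono)
      fix \<alpha> assume a: "\<alpha> \<in> {\<alpha>\<in>L. y \<le> sz \<alpha>}"
      have "sz \<alpha> powr (1 - s) = sz \<alpha> * sz \<alpha> powr (- s)" using powr_mult_base[of "sz \<alpha>" "- s"] by simp
      also have "\<dots> \<le> sz \<alpha> * y powr (- s)"
        using a y1 s by (intro mult_left_mono powr_mono2') auto
      finally have "sz \<alpha> powr (1 - s) * u \<alpha> \<le> sz \<alpha> * y powr (- s) * u \<alpha>"
        using a u by (intro mult_right_mono) (auto simp: L_def)
      thus "sz \<alpha> powr (1 - s) * u \<alpha> \<le> y powr (- s) * (sz \<alpha> * u \<alpha>)" by (simp add: mult_ac)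
    qed
    also have "\<dots> = y powr (- s) * (\<Sum>\<alpha>\<in>{\<alpha>\<in>L. y \<le> sz \<alpha>}. sz \<alpha> * u \<alpha>)" by (simp add: sum_distrib_left)
    also have "\<dots> \<le> y powr (- s) * (\<Sum>\<alpha>\<in>L. sz \<alpha> * u \<alpha>)"
      using finL u by (intro mult_left_mono sum_mono2) (auto simp: L_def)
    also have "\<dots> \<le> y powr (- s) * m" using um by (intro mult_left_mono) (auto simp: L_def)
    also have "\<dots> = M / 2" using ys M m by (simp add: powr_minus_divide)
    finally show ?thesis .
  qed
  have small: "(\<Sum>\<alpha>\<in>{\<alpha>\<in>L. sz \<alpha> < y}. sz \<alpha> powr (1 - s) * u \<alpha>) \<le> 2 * (\<Sum>i<n+1. b i powr (1 - s) * \<nu> i)"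
  proof -
    have sub: "{\<alpha>\<in>L. sz \<alpha> < y} \<subseteq> (\<Union>i<n+1. B i)"
    proof
      fix \<alpha> assume a: "\<alpha> \<in> {\<alpha>\<in>L. sz \<alpha> < y}"
      hence a1: "1 \<le> sz \<alpha>" "sz \<alpha> < y" "\<alpha> \<in> L" using Lnz sz_ge_1 by auto
      define i where "i = nat \<lfloor>log 2 (sz \<alpha>)\<rfloor>"
      have "0 \<le> log 2 (sz \<alpha>)" using a1 by simp
      hence "real i \<le> log 2 (sz \<alpha>)" "log 2 (sz \<alpha>) < real (i + 1)" unfolding i_def by linarith+
      hence "2 powr real i \<le> sz \<alpha>" "sz \<alpha> < 2 powr real (i + 1)"
        using a1 by (simp_all add: le_log_iff log_less_iff)
      hence i: "2 ^ i \<le> sz \<alpha>" "sz \<alpha> < 2 ^ (i + 1)" by (simp_all only: powr_realpow zero_less_numeral)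
      have "(2::real) ^ i < 2 ^ (n + 1)" using i a1 n by linarith
      hence "i < n + 1" using power_strict_increasing_iff[of "2::real" i "n + 1"] by simp
      with i a1 show "\<alpha> \<in> (\<Union>i<n+1. B i)" by (auto simp: B_def)
    qed
    have "(\<Sum>\<alpha>\<in>{\<alpha>\<in>L. sz \<alpha> < y}. sz \<alpha> powr (1 - s) * u \<alpha>) \<le> (\<Sum>\<alpha>\<in>(\<Union>i<n+1. B i). sz \<alpha> powr (1 - s) * u \<alpha>)"
      using sub finB u by (intro sum_mono2) (auto simp: B_def L_def)
    also have "\<dots> = (\<Sum>i<n+1. \<Sum>\<alpha>\<in>B i. sz \<alpha> powr (1 - s) * u \<alpha>)"
      using finB B_index by (intro sum.UNION_disjoint) auto
    also have "\<dots> \<le> (\<Sum>i<n+1. \<Sum>\<alpha>\<in>B i. 2 * b i powr (1 - s) * u \<alpha>)"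
    proof (intro sum_mono mult_right_mono)
      fix i \<alpha> assume a: "\<alpha> \<in> B i"
      have "sz \<alpha> powr (1 - s) \<le> (2 * b i) powr (1 - s)"
        using a s \<gamma> by (intro powr_mono2) (auto simp: B_def b_def)
      also have "\<dots> = 2 powr (1 - s) * b i powr (1 - s)" by (simp add: powr_mult)
      also have "2 powr (1 - s) \<le> 2 powr (1::real)" using s by (intro powr_mono) auto
      finally show "sz \<alpha> powr (1 - s) \<le> 2 * b i powr (1 - s)" by (simp add: mult_right_mono)
      show "0 \<le> u \<alpha>" using a u by (auto simp: B_def L_def)
    qed
    also have "\<dots> = 2 * (\<Sum>i<n+1. b i powr (1 - s) * \<nu> i)"
      by (simp only: \<nu>_def sum_distrib_left mult.assoc)
    finally show ?thesis .
  qed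
  have "M = (\<Sum>\<alpha>\<in>{\<alpha>\<in>L. sz \<alpha> < y}. sz \<alpha> powr (1 - s) * u \<alpha>) + (\<Sum>\<alpha>\<in>{\<alpha>\<in>L. y \<le> sz \<alpha>}. sz \<alpha> powr (1 - s) * u \<alpha>)"
    unfolding M_def L_def[symmetric] using finL
    by (subst sum.union_disjoint[symmetric]) (auto intro!: sum.cong)
  hence M4: "M / 4 \<le> (\<Sum>i<n+1. b i powr (1 - s) * \<nu> i)" using large small by linarith
  have CS: "(\<Sum>i<n+1. b i powr (1 - s) * \<nu> i)\<^sup>2 \<le> S * (\<Sum>i<n+1. b i powr \<kappa>)"
  proof -
    have "(\<Sum>i<n+1. b i powr (1 - s) * \<nu> i) =
        (\<Sum>i<n+1. (b i powr ((\<gamma> + (1 - s)) / 2) * \<nu> i) * b i powr (\<kappa> / 2))"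
    proof (intro sum.cong refl)
      fix i
      have "(\<gamma> + (1 - s)) / 2 + \<kappa> / 2 = 1 - s" unfolding \<kappa>_def by argo
      hence "b i powr (1 - s) = b i powr ((\<gamma> + (1 - s)) / 2) * b i powr (\<kappa> / 2)"
        by (metis powr_add)
      thus "b i powr (1 - s) * \<nu> i = (b i powr ((\<gamma> + (1 - s)) / 2) * \<nu> i) * b i powr (\<kappa> / 2)"
        by simp
    qed
    hence "(\<Sum>i<n+1. b i powr (1 - s) * \<nu> i)\<^sup>2 \<le>
        (\<Sum>i<n+1. (b i powr ((\<gamma> + (1 - s)) / 2) * \<nu> i)\<^sup>2) * (\<Sum>i<n+1. (b i powr (\<kappa> / 2))\<^sup>2)"
      by (simp only: Cauchy_Schwarz_ineq_sum)
    also have "(b i powr (z / 2))\<^sup>2 = b i powr z" for i z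
      unfolding power2_eq_square by (simp flip: powr_add)
    hence "(\<Sum>i<n+1. (b i powr ((\<gamma> + (1 - s)) / 2) * \<nu> i)\<^sup>2) * (\<Sum>i<n+1. (b i powr (\<kappa> / 2))\<^sup>2) =
        S * (\<Sum>i<n+1. b i powr \<kappa>)"
      unfolding S_def power_mult_distrib by simp
    finally show ?thesis .
  qed
  have geom: "(\<Sum>i<n+1. b i powr \<kappa>) \<le> 2 powr \<kappa> * (2 * m / M) powr (\<kappa> / s) / (q - 1)"
  proof -
    have bq: "b i powr \<kappa> = q ^ i" for i
      by (simp add: b_def q_def powr_powr mult.commute flip: powr_realpow)
    have "(\<Sum>i<n+1. b i powr \<kappa>) = (q ^ (n + 1) - 1) / (q - 1)"
      unfolding bq using q by (intro geometric_sum) auto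
    also have "\<dots> \<le> q ^ (n + 1) / (q - 1)" using q by (intro divide_right_mono) auto
    also have "q ^ (n + 1) = b (n + 1) powr \<kappa>" by (rule bq[symmetric])
    also have "b (n + 1) powr \<kappa> \<le> (2 * y) powr \<kappa>"
      using n \<kappa> by (intro powr_mono2) (auto simp: b_def)
    also have "\<dots> = 2 powr \<kappa> * (2 * m / M) powr (\<kappa> / s)"
      by (simp add: y_def powr_mult powr_powr)
    finally show ?thesis using q by (simp add: divide_right_mono)
  qed
  have Mp: "0 < M powr (\<kappa> / s)" using M by simp
  have S0: "0 \<le> S" unfolding S_def by (intro sum_nonneg) auto
  \<comment> \<open>At least half of the moment lies below y, and replacing a size by the lower end
    of its block costs another factor 2, hence M / 4. Solving for S produces the power 2 + \<kappa>
    / s of M, which equals 1 + (1 - \<gamma>) / s.\<close>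
  have "(M / 4)\<^sup>2 \<le> S * (2 powr \<kappa> * (2 * m / M) powr (\<kappa> / s) / (q - 1))"
  proof -
    have "(M / 4)\<^sup>2 \<le> (\<Sum>i<n+1. b i powr (1 - s) * \<nu> i)\<^sup>2" using M4 M by (intro power_mono) auto
    also have "\<dots> \<le> S * (\<Sum>i<n+1. b i powr \<kappa>)" by (rule CS)
    also have "\<dots> \<le> S * (2 powr \<kappa> * (2 * m / M) powr (\<kappa> / s) / (q - 1))"
      by (intro mult_left_mono geom S0)
    finally show ?thesis .
  qed
  also have "\<dots> = S * (2 powr \<kappa> * (2 * m) powr (\<kappa> / s) / (q - 1)) / M powr (\<kappa> / s)"
    by (simp add: powr_divide)
  finally have "(M / 4)\<^sup>2 * M powr (\<kappa> / s) \<le> S * (2 powr \<kappa> * (2 * m) powr (\<kappa> / s) / (q - 1))"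
    by (simp only: pos_le_divide_eq[OF Mp])
  hence "1 / 16 * ((q - 1) / (2 powr \<kappa> * (2 * m) powr (\<kappa> / s))) * (M\<^sup>2 * M powr (\<kappa> / s)) \<le> S"
    using q m by (simp add: field_simps)
  moreover have "M\<^sup>2 * M powr (\<kappa> / s) = M powr (1 + (1 - \<gamma>) / s)"
  proof -
    have "M\<^sup>2 = M powr 2" using M by simp
    moreover have "2 + \<kappa> / s = 1 + (1 - \<gamma>) / s" using s by (simp add: \<kappa>_def field_simps)
    ultimately show ?thesis by (metis powr_add)
  qed
  ultimately have S: "1 / 16 * ((q - 1) / (2 powr \<kappa> * (2 * m) powr (\<kappa> / s))) * M powr (1 + (1 - \<gamma>) / s) \<le> S"
    by simp
  have "(\<Sum>\<alpha>\<in>L. sz \<alpha> powr (1 - s) * coag_rate N (cut N k) u \<alpha>) = - (1 / 2 * (\<Sum>\<alpha>\<in>L. \<Sum>\<beta>\<in>L. f \<alpha> \<beta>))"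
    unfolding L_def by (subst sum_coag_rate[OF k_sym])
      (auto simp: f_def sz_add algebra_simps sum_negf sum_subtractf sum.distrib simp flip: sum_distrib_left)
  also have "\<dots> \<le> - (c1 * c0 / 2 * S)" using D by simp
  also have "\<dots> \<le> - (c1 * c0 / 2 * (1 / 16 * ((q - 1) / (2 powr \<kappa> * (2 * m) powr (\<kappa> / s))) * M powr (1 + (1 - \<gamma>) / s)))"
    using S c0 c_pos by (intro le_imp_neg_le mult_left_mono) auto
  also have "\<dots> = - c * M powr (1 + (1 - \<gamma>) / s)" by (simp add: c_def mult_ac)
  finally show "(\<Sum>\<alpha>\<in>lat N. sz \<alpha> powr (1 - s) * coag_rate N (cut N k) u \<alpha>) \<le>
        - c * (\<Sum>\<alpha>\<in>lat N. sz \<alpha> powr (1 - s) * u \<alpha>) powr (1 + (1 - \<gamma>) / s)"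
    by (simp add: L_def M_def)
qed

end

section \<open>The spread of the directions and its dissipation\<close>

definition excess :: "real ^ 'd \<Rightarrow> nat ^ 'd \<Rightarrow> real ^ 'd"
  where "excess \<theta> \<alpha> = vec_of_nat \<alpha> - sz \<alpha> *\<^sub>R \<theta>"

text \<open>With the size as mass and \<open>excess\<close> as momentum in the frame of velocity
  \<theta>, this is twice the kinetic energy. The velocity of \<alpha> is its direction minus
  \<theta>, so the sum over a population is a mass-weighted variance of directions.\<close>

definition spread :: "real ^ 'd \<Rightarrow> nat ^ 'd \<Rightarrow> real"
  where "spread \<theta> \<alpha> = (norm (excess \<theta> \<alpha>))\<^sup>2 / sz \<alpha>"

lemma excess_add: "excess \<theta> (\<alpha> + \<beta>) = excess \<theta> \<alpha> + excess \<theta> \<beta>"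
  by (simp add: excess_def vec_of_nat_add sz_add algebra_simps)

lemma spread_nonneg: "0 \<le> spread \<theta> \<alpha>"
  by (simp add: spread_def)

lemma norm_vec_of_nat_le: "norm (vec_of_nat \<alpha>) \<le> sz \<alpha>"
  unfolding sz_def l1norm_def by (rule norm_le_l1_cart)

lemma spread_le:
  assumes "norm \<theta> \<le> 1" "\<alpha> \<noteq> 0"
  shows "spread \<theta> \<alpha> \<le> 4 * sz \<alpha>"
proof -
  have "norm (excess \<theta> \<alpha>) \<le> norm (vec_of_nat \<alpha>) + norm (sz \<alpha> *\<^sub>R \<theta>)"
    unfolding excess_def by (rule norm_triangle_ineq4)
  also have "norm (sz \<alpha> *\<^sub>R \<theta>) \<le> sz \<alpha>" using mult_left_mono[OF assms(1), of "sz \<alpha>"] by simp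
  finally have "norm (excess \<theta> \<alpha>) \<le> 2 * sz \<alpha>" using norm_vec_of_nat_le[of \<alpha>] by simp
  hence "(norm (excess \<theta> \<alpha>))\<^sup>2 \<le> (2 * sz \<alpha>)\<^sup>2" by (intro power_mono) auto
  hence "spread \<theta> \<alpha> \<le> (2 * sz \<alpha>)\<^sup>2 / sz \<alpha>" unfolding spread_def by (intro divide_right_mono) auto
  thus ?thesis using sz_pos[OF assms(2)] by (simp add: power2_eq_square)
qed

text \<open>\<theta> cancels in the difference, and a direction has Euclidean norm at most 1 because
  its \<open>l1norm\<close> is 1.\<close>

lemma norm_direction_diff_le:
  assumes "\<alpha> \<noteq> 0" "\<beta> \<noteq> 0"
  shows "(norm (excess \<theta> \<alpha> /\<^sub>R sz \<alpha> - excess \<theta> \<beta> /\<^sub>R sz \<beta>))\<^sup>2 \<le> 4"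
proof -
  have "excess \<theta> \<alpha> /\<^sub>R sz \<alpha> - excess \<theta> \<beta> /\<^sub>R sz \<beta> = vec_of_nat \<alpha> /\<^sub>R sz \<alpha> - vec_of_nat \<beta> /\<^sub>R sz \<beta>"
    using sz_pos[OF assms(1)] sz_pos[OF assms(2)] by (simp add: excess_def scaleR_diff_right)
  also have "norm \<dots> \<le> norm (vec_of_nat \<alpha> /\<^sub>R sz \<alpha>) + norm (vec_of_nat \<beta> /\<^sub>R sz \<beta>)"
    by (rule norm_triangle_ineq4)
  also have "\<dots> \<le> 1 + 1"
    using norm_vec_of_nat_le[of \<alpha>] norm_vec_of_nat_le[of \<beta>] sz_pos[OF assms(1)] sz_pos[OF assms(2)]
    by (intro add_mono) (auto simp: divide_simps)
  finally have "(norm (excess \<theta> \<alpha> /\<^sub>R sz \<alpha> - excess \<theta> \<beta> /\<^sub>R sz \<beta>))\<^sup>2 \<le> 2\<^sup>2"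
    by (intro power_mono) auto
  thus ?thesis by simp
qed

context coag_kernel
begin

lemma spread_dissipation_identity:
  "(\<Sum>\<alpha>\<in>lat N. spread \<theta> \<alpha> * coag_rate N (cut N k) u \<alpha>) =
    - (1 / 2 * (\<Sum>\<alpha>\<in>lat N. \<Sum>\<beta>\<in>lat N. cut N k \<alpha> \<beta> * u \<alpha> * u \<beta> *
      (sz \<alpha> * sz \<beta> / (sz \<alpha> + sz \<beta>) * (norm (excess \<theta> \<alpha> /\<^sub>R sz \<alpha> - excess \<theta> \<beta> /\<^sub>R sz \<beta>))\<^sup>2)))"
proof -
  have "spread \<theta> (\<alpha> + \<beta>) - spread \<theta> \<alpha> - spread \<theta> \<beta> =
      - (sz \<alpha> * sz \<beta> / (sz \<alpha> + sz \<beta>) * (norm (excess \<theta> \<alpha> /\<^sub>R sz \<alpha> - excess \<theta> \<beta> /\<^sub>R sz \<beta>))\<^sup>2)"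
    if "\<alpha> \<in> lat N" "\<beta> \<in> lat N" for \<alpha> \<beta>
    using kinetic_identity[OF sz_pos[OF lat_nonzero[OF that(1)]] sz_pos[OF lat_nonzero[OF that(2)]],
        of "excess \<theta> \<alpha>" "excess \<theta> \<beta>"]
    unfolding spread_def excess_add sz_add by linarith
  hence "(\<Sum>\<alpha>\<in>lat N. \<Sum>\<beta>\<in>lat N. cut N k \<alpha> \<beta> * u \<alpha> * u \<beta> * (spread \<theta> (\<alpha> + \<beta>) - spread \<theta> \<alpha> - spread \<theta> \<beta>)) =
    (\<Sum>\<alpha>\<in>lat N. \<Sum>\<beta>\<in>lat N. cut N k \<alpha> \<beta> * u \<alpha> * u \<beta> *
      - (sz \<alpha> * sz \<beta> / (sz \<alpha> + sz \<beta>) * (norm (excess \<theta> \<alpha> /\<^sub>R sz \<alpha> - excess \<theta> \<beta> /\<^sub>R sz \<beta>))\<^sup>2))"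
    by (intro sum.cong refl) simp
  moreover have "(\<Sum>\<alpha>\<in>lat N. spread \<theta> \<alpha> * coag_rate N (cut N k) u \<alpha>) = 1 / 2 * (\<Sum>\<alpha>\<in>lat N. \<Sum>\<beta>\<in>lat N.
      cut N k \<alpha> \<beta> * u \<alpha> * u \<beta> * (spread \<theta> (\<alpha> + \<beta>) - spread \<theta> \<alpha> - spread \<theta> \<beta>))"
    by (rule sum_coag_rate) (rule k_sym)
  ultimately show ?thesis by (simp only: mult_minus_right sum_negf)
qed

lemma spread_rate_nonpos:
  assumes u: "\<And>\<alpha>. \<alpha> \<in> lat N \<Longrightarrow> 0 \<le> u \<alpha>"
  shows "(\<Sum>\<alpha>\<in>lat N. spread \<theta> \<alpha> * coag_rate N (cut N k) u \<alpha>) \<le> 0"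
proof -
  have "0 \<le> (\<Sum>\<alpha>\<in>lat N. \<Sum>\<beta>\<in>lat N. cut N k \<alpha> \<beta> * u \<alpha> * u \<beta> *
      (sz \<alpha> * sz \<beta> / (sz \<alpha> + sz \<beta>) * (norm (excess \<theta> \<alpha> /\<^sub>R sz \<alpha> - excess \<theta> \<beta> /\<^sub>R sz \<beta>))\<^sup>2))"
    using u by (intro sum_nonneg mult_nonneg_nonneg cut_nonneg divide_nonneg_nonneg) (auto simp: lat_def)
  thus ?thesis unfolding spread_dissipation_identity by simp
qed

text \<open>The loss in replacing sizes known up to the ratio 2 / \<epsilon> by R: one factor for
  the power \<gamma> + 2 * p - 1 of the sum of the sizes, and one for each power - p.\<close>

definition low_const :: "real \<Rightarrow> real"
  where "low_const \<epsilon> = c1 * (2 / \<epsilon>) powr (- \<bar>\<gamma> + 2 * p - 1\<bar>) * (2 / \<epsilon>) powr (- \<bar>- p\<bar>) * (2 / \<epsilon>) powr (- \<bar>- p\<bar>)"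

lemma low_const_pos: "0 < \<epsilon> \<Longrightarrow> 0 < low_const \<epsilon>"
  using c_pos by (simp add: low_const_def)

text \<open>This quotient multiplies the mass-weighted squared relative velocity in the dissipation.
  At R = t powr (1 / (1 - \<gamma>)) the lower bound is a constant divided by t.\<close>

lemma k_lower_window:
  assumes "\<alpha> \<noteq> 0" "\<beta> \<noteq> 0" "0 < \<epsilon>" "\<epsilon> \<le> 1" "0 < R"
    and "\<epsilon> * R \<le> sz \<alpha>" "sz \<alpha> \<le> R / \<epsilon>" "\<epsilon> * R \<le> sz \<beta>" "sz \<beta> \<le> R / \<epsilon>"
  shows "low_const \<epsilon> * R powr (\<gamma> - 1) \<le> k \<alpha> \<beta> / (sz \<alpha> + sz \<beta>)"
proof -
  have L: "1 \<le> 2 / \<epsilon>" using assms by simp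
  have *: "R / (2 / \<epsilon>) \<le> z \<and> z \<le> 2 / \<epsilon> * R" if "\<epsilon> * R \<le> z" "z \<le> 2 * (R / \<epsilon>)" for z
    using that assms(3,5) by (simp add: mult.commute) (smt (verit) mult_pos_pos)
  have Re: "0 < R / \<epsilon>" using assms by simp
  have ex: "0 < \<epsilon> * R" using assms by simp
  have w: "R / (2 / \<epsilon>) \<le> sz \<alpha> + sz \<beta> \<and> sz \<alpha> + sz \<beta> \<le> 2 / \<epsilon> * R"
      "R / (2 / \<epsilon>) \<le> sz \<alpha> \<and> sz \<alpha> \<le> 2 / \<epsilon> * R" "R / (2 / \<epsilon>) \<le> sz \<beta> \<and> sz \<beta> \<le> 2 / \<epsilon> * R"
    using assms(6-9) Re ex by (intro *; linarith)+
  note bnd = powr_ge_of_ratio[OF \<open>0 < R\<close> L]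
  have "(2 / \<epsilon>) powr (- \<bar>\<gamma> + 2 * p - 1\<bar>) * R powr (\<gamma> + 2 * p - 1) \<le> (sz \<alpha> + sz \<beta>) powr (\<gamma> + 2 * p - 1)"
    by (intro bnd conjunct1[OF w(1)] conjunct2[OF w(1)])
  moreover have "(2 / \<epsilon>) powr (- \<bar>- p\<bar>) * R powr (- p) \<le> sz \<alpha> powr (- p)"
    by (intro bnd conjunct1[OF w(2)] conjunct2[OF w(2)])
  moreover have "(2 / \<epsilon>) powr (- \<bar>- p\<bar>) * R powr (- p) \<le> sz \<beta> powr (- p)"
    by (intro bnd conjunct1[OF w(3)] conjunct2[OF w(3)])
  ultimately have "((2 / \<epsilon>) powr (- \<bar>\<gamma> + 2 * p - 1\<bar>) * R powr (\<gamma> + 2 * p - 1)) * ((2 / \<epsilon>) powr (- \<bar>- p\<bar>) * R powr (- p))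
      * ((2 / \<epsilon>) powr (- \<bar>- p\<bar>) * R powr (- p))
      \<le> (sz \<alpha> + sz \<beta>) powr (\<gamma> + 2 * p - 1) * sz \<alpha> powr (- p) * sz \<beta> powr (- p)"
    by (intro mult_mono) auto
  hence "c1 * (((2 / \<epsilon>) powr (- \<bar>\<gamma> + 2 * p - 1\<bar>) * R powr (\<gamma> + 2 * p - 1)) * ((2 / \<epsilon>) powr (- \<bar>- p\<bar>) * R powr (- p))
      * ((2 / \<epsilon>) powr (- \<bar>- p\<bar>) * R powr (- p)))
      \<le> c1 * ((sz \<alpha> + sz \<beta>) powr (\<gamma> + 2 * p - 1) * sz \<alpha> powr (- p) * sz \<beta> powr (- p))"
    using c_pos by (intro mult_left_mono) auto
  moreover have "c1 * (((2 / \<epsilon>) powr (- \<bar>\<gamma> + 2 * p - 1\<bar>) * R powr (\<gamma> + 2 * p - 1)) * ((2 / \<epsilon>) powr (- \<bar>- p\<bar>) * R powr (- p))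
      * ((2 / \<epsilon>) powr (- \<bar>- p\<bar>) * R powr (- p))) = low_const \<epsilon> * (R powr (\<gamma> + 2 * p - 1) * R powr (- p) * R powr (- p))"
    by (simp only: low_const_def mult_ac)
  moreover have "R powr (\<gamma> + 2 * p - 1) * R powr (- p) * R powr (- p) = R powr (\<gamma> - 1)"
    by (simp flip: powr_add)
  moreover have "(sz \<alpha> + sz \<beta>) powr (\<gamma> + 2 * p - 1) = (sz \<alpha> + sz \<beta>) powr (\<gamma> + 2 * p) / (sz \<alpha> + sz \<beta>)"
    using sz_pos[OF assms(1)] sz_pos[OF assms(2)] by (simp add: powr_diff)
  ultimately have "low_const \<epsilon> * R powr (\<gamma> - 1) \<le>
      c1 * ((sz \<alpha> + sz \<beta>) powr (\<gamma> + 2 * p) * sz \<alpha> powr (- p) * sz \<beta> powr (- p)) / (sz \<alpha> + sz \<beta>)"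
    by simp
  also have "\<dots> \<le> k \<alpha> \<beta> / (sz \<alpha> + sz \<beta>)"
    by (intro divide_right_mono k_lower assms) simp
  finally show ?thesis .
qed

text \<open>On pairs from the window the dissipation dominates a multiple of the pair sum of
  \<open>sum_pairs_kinetic\<close>, which over all pairs is 2 * m * E minus twice the squared total
  excess. The error 5 * \<eta> is half of 10 * \<eta>: a share of 2 for the total excess and of 8
  for the pairs with a member outside the window.\<close>

lemma spread_rate:
  assumes u: "\<And>\<alpha>. \<alpha> \<in> lat N \<Longrightarrow> 0 \<le> u \<alpha>"
    and \<epsilon>: "0 < \<epsilon>" "\<epsilon> \<le> 1" and R: "0 < R" and N: "2 * (R / \<epsilon>) \<le> N"
    and bad: "(\<Sum>\<alpha>\<in>{\<alpha>\<in>lat N. \<not> (\<epsilon> * R \<le> sz \<alpha> \<and> sz \<alpha> \<le> R / \<epsilon>)}. sz \<alpha> * u \<alpha>) \<le> \<eta>"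
    and v: "(norm (\<Sum>\<alpha>\<in>lat N. u \<alpha> *\<^sub>R excess \<theta> \<alpha>))\<^sup>2 \<le> \<eta> * (\<Sum>\<alpha>\<in>lat N. sz \<alpha> * u \<alpha>)"
  shows "(\<Sum>\<alpha>\<in>lat N. spread \<theta> \<alpha> * coag_rate N (cut N k) u \<alpha>) \<le>
    - (low_const \<epsilon> * R powr (\<gamma> - 1) * (\<Sum>\<alpha>\<in>lat N. sz \<alpha> * u \<alpha>) *
       ((\<Sum>\<alpha>\<in>lat N. spread \<theta> \<alpha> * u \<alpha>) - 5 * \<eta>))"
proof -
  define L where "L = (lat N :: (nat ^ 'd) set)"
  define G where "G = {\<alpha>\<in>L. \<epsilon> * R \<le> sz \<alpha> \<and> sz \<alpha> \<le> R / \<epsilon>}"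
  define m where "m = (\<Sum>\<alpha>\<in>L. sz \<alpha> * u \<alpha>)"
  define E where "E = (\<Sum>\<alpha>\<in>L. spread \<theta> \<alpha> * u \<alpha>)"
  define c where "c = low_const \<epsilon> * R powr (\<gamma> - 1)"
  have c: "0 \<le> c" using low_const_pos[OF \<epsilon>(1)] by (simp add: c_def)
  define g where "g \<alpha> \<beta> = (norm (excess \<theta> \<alpha> /\<^sub>R sz \<alpha> - excess \<theta> \<beta> /\<^sub>R sz \<beta>))\<^sup>2" for \<alpha> \<beta>
  define f where "f \<alpha> \<beta> = sz \<alpha> * sz \<beta> * g \<alpha> \<beta> * u \<alpha> * u \<beta>" for \<alpha> \<beta>
  have fin: "finite L" "finite G" by (auto simp: L_def G_def)
  have GL: "G \<subseteq> L" by (auto simp: G_def)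
  have Lnz: "\<alpha> \<noteq> 0" if "\<alpha> \<in> L" for \<alpha> using that by (simp add: L_def lat_def)
  have uL: "0 \<le> u \<alpha>" if "\<alpha> \<in> L" for \<alpha> using that u by (simp add: L_def)
  have f0: "0 \<le> f \<alpha> \<beta>" if "\<alpha> \<in> L" "\<beta> \<in> L" for \<alpha> \<beta>
    using that by (simp add: f_def g_def uL)
  have m0: "0 \<le> m" unfolding m_def by (intro sum_nonneg mult_nonneg_nonneg uL) auto
  have bad': "(\<Sum>\<alpha>\<in>L-G. sz \<alpha> * u \<alpha>) \<le> \<eta>"
  proof -
    have "{\<alpha>\<in>lat N. \<not> (\<epsilon> * R \<le> sz \<alpha> \<and> sz \<alpha> \<le> R / \<epsilon>)} = L - G" by (auto simp: L_def G_def)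
    thus ?thesis using bad by simp
  qed
  have all: "(\<Sum>\<alpha>\<in>L. \<Sum>\<beta>\<in>L. f \<alpha> \<beta>) = 2 * m * E - 2 * (norm (\<Sum>\<alpha>\<in>L. u \<alpha> *\<^sub>R excess \<theta> \<alpha>))\<^sup>2"
    unfolding f_def g_def m_def E_def spread_def
    using Lnz sz_pos by (intro sum_pairs_kinetic) auto
  \<comment> \<open>Relative velocities are at most 2, so a pair costs at most 4 times the product
    of its masses. Two families of pairs leave \<open>G \<times> G\<close>, each with one factor of
    mass at most \<eta>.\<close>
  have comp: "(\<Sum>\<alpha>\<in>L. \<Sum>\<beta>\<in>L. f \<alpha> \<beta>) \<le> (\<Sum>\<alpha>\<in>G. \<Sum>\<beta>\<in>G. f \<alpha> \<beta>) + 8 * \<eta> * m"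
  proof -
    have f4: "f \<alpha> \<beta> \<le> 4 * ((sz \<alpha> * u \<alpha>) * (sz \<beta> * u \<beta>))" if "\<alpha> \<in> L" "\<beta> \<in> L" for \<alpha> \<beta>
    proof -
      have "sz \<alpha> * sz \<beta> * u \<alpha> * u \<beta> * g \<alpha> \<beta> \<le> sz \<alpha> * sz \<beta> * u \<alpha> * u \<beta> * 4"
        unfolding g_def using that uL Lnz by (intro mult_left_mono norm_direction_diff_le) auto
      thus ?thesis by (simp add: f_def mult_ac)
    qed
    have dbl: "(\<Sum>\<alpha>\<in>A. \<Sum>\<beta>\<in>B. f \<alpha> \<beta>) \<le> 4 * ((\<Sum>\<alpha>\<in>A. sz \<alpha> * u \<alpha>) * (\<Sum>\<beta>\<in>B. sz \<beta> * u \<beta>))"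
      if "A \<subseteq> L" "B \<subseteq> L" for A B
    proof -
      have "(\<Sum>\<alpha>\<in>A. \<Sum>\<beta>\<in>B. f \<alpha> \<beta>) \<le> (\<Sum>\<alpha>\<in>A. \<Sum>\<beta>\<in>B. 4 * ((sz \<alpha> * u \<alpha>) * (sz \<beta> * u \<beta>)))"
        using that by (intro sum_mono f4) auto
      thus ?thesis by (simp only: sum_product) (simp only: sum_distrib_left)
    qed
    have split: "(\<Sum>\<alpha>\<in>L. h \<alpha>) = (\<Sum>\<alpha>\<in>G. h \<alpha>) + (\<Sum>\<alpha>\<in>L-G. h \<alpha>)" for h :: "nat ^ 'd \<Rightarrow> real"
      using sum.subset_diff[OF GL fin(1), of h] by simp
    have Gm: "(\<Sum>\<alpha>\<in>G. sz \<alpha> * u \<alpha>) \<le> m" unfolding m_def using GL fin uL by (intro sum_mono2) auto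
    have Bm: "0 \<le> (\<Sum>\<alpha>\<in>L-G. sz \<alpha> * u \<alpha>)" using uL by (intro sum_nonneg) auto
    have G0: "0 \<le> (\<Sum>\<alpha>\<in>G. sz \<alpha> * u \<alpha>)" using uL GL by (intro sum_nonneg) auto
    have "(\<Sum>\<alpha>\<in>L. \<Sum>\<beta>\<in>L. f \<alpha> \<beta>) = (\<Sum>\<alpha>\<in>G. \<Sum>\<beta>\<in>G. f \<alpha> \<beta>) + (\<Sum>\<alpha>\<in>G. \<Sum>\<beta>\<in>L-G. f \<alpha> \<beta>) + (\<Sum>\<alpha>\<in>L-G. \<Sum>\<beta>\<in>L. f \<alpha> \<beta>)"
      by (simp only: split[of "\<lambda>\<alpha>. \<Sum>\<beta>\<in>L. f \<alpha> \<beta>"]) (simp only: split[of "f _"] sum.distrib)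
    moreover have "(\<Sum>\<alpha>\<in>G. \<Sum>\<beta>\<in>L-G. f \<alpha> \<beta>) \<le> 4 * (m * \<eta>)"
      using dbl[of G "L - G"] GL mult_mono[OF Gm bad' m0 Bm] by auto
    moreover have "(\<Sum>\<alpha>\<in>L-G. \<Sum>\<beta>\<in>L. f \<alpha> \<beta>) \<le> 4 * (\<eta> * m)"
      using dbl[of "L - G" L] mult_right_mono[OF bad' m0] by (auto simp: m_def)
    ultimately show ?thesis by (simp add: algebra_simps)
  qed
  have t0: "0 \<le> cut N k \<alpha> \<beta> * u \<alpha> * u \<beta> * (sz \<alpha> * sz \<beta> / (sz \<alpha> + sz \<beta>) * g \<alpha> \<beta>)"
    if "\<alpha> \<in> L" "\<beta> \<in> L" for \<alpha> \<beta>
    using that uL Lnz by (intro mult_nonneg_nonneg cut_nonneg divide_nonneg_nonneg) (auto simp: g_def)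
  have low: "c * (\<Sum>\<alpha>\<in>G. \<Sum>\<beta>\<in>G. f \<alpha> \<beta>) \<le>
      (\<Sum>\<alpha>\<in>L. \<Sum>\<beta>\<in>L. cut N k \<alpha> \<beta> * u \<alpha> * u \<beta> * (sz \<alpha> * sz \<beta> / (sz \<alpha> + sz \<beta>) * g \<alpha> \<beta>))"
  proof -
    have "c * (\<Sum>\<alpha>\<in>G. \<Sum>\<beta>\<in>G. f \<alpha> \<beta>) = (\<Sum>\<alpha>\<in>G. \<Sum>\<beta>\<in>G. c * f \<alpha> \<beta>)" by (simp only: sum_distrib_left)
    also have "\<dots> \<le> (\<Sum>\<alpha>\<in>G. \<Sum>\<beta>\<in>G. cut N k \<alpha> \<beta> * u \<alpha> * u \<beta> * (sz \<alpha> * sz \<beta> / (sz \<alpha> + sz \<beta>) * g \<alpha> \<beta>))"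
    proof (intro sum_mono)
      fix \<alpha> \<beta> assume ab: "\<alpha> \<in> G" "\<beta> \<in> G"
      have "c \<le> k \<alpha> \<beta> / (sz \<alpha> + sz \<beta>)" unfolding c_def
        using ab \<epsilon> R Lnz by (intro k_lower_window) (auto simp: G_def)
      moreover have "sz \<alpha> + sz \<beta> \<le> N" using ab N by (auto simp: G_def)
      ultimately have "c \<le> cut N k \<alpha> \<beta> / (sz \<alpha> + sz \<beta>)" by (simp add: cut_def)
      hence "c * f \<alpha> \<beta> \<le> cut N k \<alpha> \<beta> / (sz \<alpha> + sz \<beta>) * f \<alpha> \<beta>"
        using ab GL f0 by (intro mult_right_mono) auto
      thus "c * f \<alpha> \<beta> \<le> cut N k \<alpha> \<beta> * u \<alpha> * u \<beta> * (sz \<alpha> * sz \<beta> / (sz \<alpha> + sz \<beta>) * g \<alpha> \<beta>)"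
        by (simp add: f_def mult_ac)
    qed
    also have "\<dots> \<le> (\<Sum>\<alpha>\<in>G. \<Sum>\<beta>\<in>L. cut N k \<alpha> \<beta> * u \<alpha> * u \<beta> * (sz \<alpha> * sz \<beta> / (sz \<alpha> + sz \<beta>) * g \<alpha> \<beta>))"
      using GL fin by (intro sum_mono sum_mono2) (auto intro!: t0 simp del: times_divide_eq_right times_divide_eq_left)
    also have "\<dots> \<le> (\<Sum>\<alpha>\<in>L. \<Sum>\<beta>\<in>L. cut N k \<alpha> \<beta> * u \<alpha> * u \<beta> * (sz \<alpha> * sz \<beta> / (sz \<alpha> + sz \<beta>) * g \<alpha> \<beta>))"
      using GL fin by (intro sum_mono2 sum_nonneg) (auto intro!: t0 simp del: times_divide_eq_right times_divide_eq_left)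
    finally show ?thesis .
  qed
  have "2 * m * E - 2 * (\<eta> * m) - 8 * \<eta> * m \<le> (\<Sum>\<alpha>\<in>G. \<Sum>\<beta>\<in>G. f \<alpha> \<beta>)"
    using all comp v unfolding L_def m_def by linarith
  hence "c * (2 * m * E - 2 * (\<eta> * m) - 8 * \<eta> * m) \<le> c * (\<Sum>\<alpha>\<in>G. \<Sum>\<beta>\<in>G. f \<alpha> \<beta>)"
    using c by (intro mult_left_mono) auto
  also note low
  finally have "- (1 / 2 * (\<Sum>\<alpha>\<in>L. \<Sum>\<beta>\<in>L. cut N k \<alpha> \<beta> * u \<alpha> * u \<beta> * (sz \<alpha> * sz \<beta> / (sz \<alpha> + sz \<beta>) * g \<alpha> \<beta>)))
      \<le> - (c * m * (E - 5 * \<eta>))" by (simp add: algebra_simps)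
  thus ?thesis unfolding spread_dissipation_identity g_def c_def m_def E_def L_def .
qed

end

context coag_kernel
begin

text \<open>Holds for every N. It takes over in \<open>moment_decay\<close> once the moment is too
  small for the condition on N in \<open>moment_dissipation\<close>.\<close>

lemma moment_rate_nonpos:
  assumes u: "\<And>\<alpha>. \<alpha> \<in> lat N \<Longrightarrow> 0 \<le> u \<alpha>" and s: "0 < s"
  shows "(\<Sum>\<alpha>\<in>lat N. sz \<alpha> powr (1 - s) * coag_rate N (cut N k) u \<alpha>) \<le> 0"
proof -
  have g: "(x + y) powr (1 - s) \<le> x powr (1 - s) + y powr (1 - s)" if "0 < x" "0 < y" for x y :: real
  proof -
    have o: "(x + y) powr (1 - s) \<le> x powr (1 - s) + y powr (1 - s)" if "0 < y" "y \<le> x" for x y :: real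
    proof -
      have "2 powr (- s) \<le> 2 powr (0::real)" using s by (intro powr_mono) auto
      hence "0 \<le> (1 - 2 powr (- s)) * y powr (1 - s)" by simp
      with subadditive_powr_gap[OF that s] show ?thesis by linarith
    qed
    show ?thesis using o[of x y] o[of y x] that by (cases "x \<le> y") (auto simp: add.commute)
  qed
  have "cut N k \<alpha> \<beta> * u \<alpha> * u \<beta> * (sz (\<alpha> + \<beta>) powr (1 - s) - sz \<alpha> powr (1 - s) - sz \<beta> powr (1 - s)) \<le> 0"
    if "\<alpha> \<in> lat N" "\<beta> \<in> lat N" for \<alpha> \<beta>
  proof (rule mult_nonneg_nonpos)
    show "0 \<le> cut N k \<alpha> \<beta> * u \<alpha> * u \<beta>"
      using that u by (intro mult_nonneg_nonneg cut_nonneg) (auto simp: lat_def)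
    show "sz (\<alpha> + \<beta>) powr (1 - s) - sz \<alpha> powr (1 - s) - sz \<beta> powr (1 - s) \<le> 0"
      using g[OF sz_pos[OF lat_nonzero[OF that(1)]] sz_pos[OF lat_nonzero[OF that(2)]]]
      by (simp add: sz_add)
  qed
  hence "(\<Sum>\<alpha>\<in>lat N. \<Sum>\<beta>\<in>lat N. cut N k \<alpha> \<beta> * u \<alpha> * u \<beta> *
      (sz (\<alpha> + \<beta>) powr (1 - s) - sz \<alpha> powr (1 - s) - sz \<beta> powr (1 - s))) \<le> 0"
    by (intro sum_nonpos) auto
  moreover have "(\<Sum>\<alpha>\<in>lat N. sz \<alpha> powr (1 - s) * coag_rate N (cut N k) u \<alpha>) = 1 / 2 *
      (\<Sum>\<alpha>\<in>lat N. \<Sum>\<beta>\<in>lat N. cut N k \<alpha> \<beta> * u \<alpha> * u \<beta> *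
        (sz (\<alpha> + \<beta>) powr (1 - s) - sz \<alpha> powr (1 - s) - sz \<beta> powr (1 - s)))"
    by (rule sum_coag_rate) (rule k_sym)
  ultimately show ?thesis by linarith
qed

end

text \<open>Euler version of the fact that M' \<le> - c * M powr (1 + q) makes M powr (- q) grow at
  least linearly. One step multiplies a by at most 1 - z, and (1 - z) powr (- q) \<ge> 1 / (1 - z)
  \<ge> 1 + z, where q \<ge> 1 gives the first inequality.\<close>

lemma bernoulli_step:
  fixes a b c h q :: real
  assumes "0 < b" "b \<le> a - h * (c * a powr (1 + q))" "0 < a" "0 \<le> h * c" "1 \<le> q"
  shows "a powr (- q) + h * c \<le> b powr (- q)"
proof -
  define z where "z = h * c * a powr q"
  have z0: "0 \<le> z" using assms by (simp add: z_def)
  have "a powr (1 + q) = a * a powr q" using assms powr_mult_base[of a q] by simp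
  hence "h * (c * a powr (1 + q)) = a * z" by (simp add: z_def)
  hence bz: "b \<le> a * (1 - z)" using assms(2) by (simp add: algebra_simps)
  hence "0 < a * (1 - z)" using assms(1) by linarith
  hence z1: "z < 1" using assms(3) by (simp add: zero_less_mult_iff)
  have "a powr (- q) * a powr q = 1" using assms by (simp flip: powr_add)
  hence "a powr (- q) + h * c = a powr (- q) * (1 + z)" by (simp add: z_def algebra_simps)
  also have "1 + z \<le> 1 / (1 - z)" using z0 z1 by (simp add: pos_le_divide_eq algebra_simps)
  also have "1 / (1 - z) = (1 - z) powr (- 1)" using z1 by (simp add: powr_minus_divide)
  also have "\<dots> \<le> (1 - z) powr (- q)" using z0 z1 assms by (intro powr_mono') auto
  also have "a powr (- q) * (1 - z) powr (- q) = (a * (1 - z)) powr (- q)" by (simp add: powr_mult)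
  also have "\<dots> \<le> b powr (- q)" using assms bz by (intro powr_mono2') auto
  finally show ?thesis by (simp add: mult_left_mono)
qed

section \<open>The Euler scheme\<close>

locale coag_data = coag_kernel k c1 c2 \<gamma> p
  for k :: "nat ^ 'd \<Rightarrow> nat ^ 'd \<Rightarrow> real" and c1 c2 \<gamma> p +
  fixes n0 :: "nat ^ 'd \<Rightarrow> real"
  assumes n0_nonneg: "\<alpha> \<noteq> 0 \<Longrightarrow> 0 \<le> n0 \<alpha>"
    and n0_mass: "(\<lambda>\<alpha>. sz \<alpha> * n0 \<alpha>) summable_on nonzero_indices"
    and n0_mass_pos: "0 < (\<Sum>\<^sub>\<infinity>\<alpha>\<in>nonzero_indices. sz \<alpha> * n0 \<alpha>)"
begin

definition m0 :: real where "m0 = (\<Sum>\<^sub>\<infinity>\<alpha>\<in>nonzero_indices. sz \<alpha> * n0 \<alpha>)"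

definition massN :: "nat \<Rightarrow> real" where "massN N = (\<Sum>\<alpha>\<in>lat N. sz \<alpha> * n0 \<alpha>)"

text \<open>The double sum bounds all loss rates, so that one Euler step preserves nonnegativity.\<close>

definition step :: "nat \<Rightarrow> real"
  where "step N = 1 / ((1 + m0 * (\<Sum>\<alpha>\<in>lat N. \<Sum>\<beta>\<in>lat N. k \<alpha> \<beta>)) * (1 + real N))"

primrec euler :: "nat \<Rightarrow> nat \<Rightarrow> nat ^ 'd \<Rightarrow> real"
  where "euler N 0 = (\<lambda>\<alpha>. if \<alpha> \<in> lat N then n0 \<alpha> else 0)"
  | "euler N (Suc j) = (\<lambda>\<alpha>. euler N j \<alpha> + step N * coag_rate N (cut N k) (euler N j) \<alpha>)"

definition mom :: "nat \<Rightarrow> (nat ^ 'd \<Rightarrow> real) \<Rightarrow> nat \<Rightarrow> real"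
  where "mom N \<phi> j = (\<Sum>\<alpha>\<in>lat N. \<phi> \<alpha> * euler N j \<alpha>)"

lemma m0_pos: "0 < m0" using n0_mass_pos by (simp add: m0_def)

lemma kmax_nonneg: "0 \<le> m0 * (\<Sum>\<alpha>\<in>lat N. \<Sum>\<beta>\<in>lat N. k \<alpha> \<beta>)"
  using m0_pos by (intro mult_nonneg_nonneg sum_nonneg k_nonneg) (auto simp: lat_def)

lemma step_pos: "0 < step N" and step_le: "step N \<le> 1 / (1 + real N)"
proof -
  let ?K = "m0 * (\<Sum>\<alpha>\<in>lat N. \<Sum>\<beta>\<in>lat N. k \<alpha> \<beta>)"
  have K: "0 \<le> ?K" by (rule kmax_nonneg)
  show "0 < step N" using K by (auto simp: step_def)
  show "step N \<le> 1 / (1 + real N)" unfolding step_def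
    using K by (intro divide_left_mono mult_pos_pos) auto
qed

lemma step_le_1: "step N \<le> 1"
  using step_le[of N] by (rule order_trans) simp

lemma step_tendsto: "step \<longlonglongrightarrow> 0"
proof (rule tendsto_sandwich[OF always_eventually always_eventually])
  show "\<forall>N. 0 \<le> step N" using step_pos less_imp_le by blast
  show "\<forall>N. step N \<le> 1 / (1 + real N)" using step_le by blast
  show "(\<lambda>N. 1 / (1 + real N)) \<longlonglongrightarrow> 0"
    using LIMSEQ_inverse_real_of_nat by (simp add: inverse_eq_divide add.commute)
qed simp

lemma finite_sum_le_infsum_lat:
  assumes "(\<lambda>\<alpha>. \<phi> \<alpha> * n0 \<alpha>) summable_on nonzero_indices" "\<And>\<alpha>. \<alpha> \<noteq> 0 \<Longrightarrow> 0 \<le> \<phi> \<alpha>"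
  shows "(\<Sum>\<alpha>\<in>lat N. \<phi> \<alpha> * n0 \<alpha>) \<le> (\<Sum>\<^sub>\<infinity>\<alpha>\<in>nonzero_indices. \<phi> \<alpha> * n0 \<alpha>)"
  using assms n0_nonneg by (intro finite_sum_le_infsum) (auto simp: lat_def)

lemma massN_le: "massN N \<le> m0"
  unfolding massN_def m0_def by (intro finite_sum_le_infsum_lat n0_mass) auto

lemma lat_exhausts: "filterlim (\<lambda>N. lat (real N) :: (nat ^ 'd) set) (finite_subsets_at_top nonzero_indices) sequentially"
  unfolding filterlim_finite_subsets_at_top
proof (intro allI impI)
  fix X :: "(nat ^ 'd) set" assume X: "finite X \<and> X \<subseteq> nonzero_indices"
  obtain N0 :: nat where N0: "(\<Sum>\<alpha>\<in>X. sz \<alpha>) \<le> real N0" using real_arch_simple by blast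
  have X_sub: "X \<subseteq> lat (real N)" if "N \<ge> N0" for N
  proof
    fix \<alpha> assume a: "\<alpha> \<in> X"
    have "sz \<alpha> \<le> (\<Sum>\<alpha>\<in>X. sz \<alpha>)" using X a by (intro member_le_sum) auto
    thus "\<alpha> \<in> lat (real N)" using X a N0 that by (auto simp: lat_def)
  qed
  show "\<forall>\<^sub>F N in sequentially. finite (lat (real N) :: (nat ^ 'd) set) \<and> X \<subseteq> lat (real N) \<and> lat (real N) \<subseteq> nonzero_indices"
    unfolding eventually_sequentially
    by (intro exI[of _ N0] allI impI conjI X_sub finite_lat) (auto simp: lat_def)
qed

lemma sum_lat_tendsto:
  fixes f :: "nat ^ 'd \<Rightarrow> 'b :: {topological_comm_monoid_add, t2_space}"
  assumes "f summable_on nonzero_indices"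
  shows "(\<lambda>N. \<Sum>\<alpha>\<in>lat (real N). f \<alpha>) \<longlonglongrightarrow> infsum f nonzero_indices"
proof -
  have "(sum f \<longlongrightarrow> infsum f nonzero_indices) (finite_subsets_at_top nonzero_indices)"
    by (rule infsum_tendsto[OF assms])
  from filterlim_compose[OF this lat_exhausts] show ?thesis .
qed

lemma massN_tendsto: "massN \<longlonglongrightarrow> m0"
  unfolding massN_def m0_def by (rule sum_lat_tendsto[OF n0_mass])

lemma mom_Suc: "mom N \<phi> (Suc j) = mom N \<phi> j + step N * (\<Sum>\<alpha>\<in>lat N. \<phi> \<alpha> * coag_rate N (cut N k) (euler N j) \<alpha>)"
  by (simp add: mom_def sum.distrib sum_distrib_left algebra_simps)

lemma mom_additive:
  assumes "\<And>\<alpha> \<beta>. \<phi> (\<alpha> + \<beta>) = \<phi> \<alpha> + \<phi> \<beta>"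
  shows "mom N \<phi> j = (\<Sum>\<alpha>\<in>lat N. \<phi> \<alpha> * n0 \<alpha>)"
proof (induction j)
  case (Suc j)
  have "(\<Sum>\<alpha>\<in>lat N. \<phi> \<alpha> * coag_rate N (cut N k) (euler N j) \<alpha>) = 0"
    by (rule sum_coag_rate_additive) (auto simp: assms intro: k_sym)
  with Suc show ?case by (simp add: mom_Suc)
qed (simp add: mom_def)

lemma mom_mass: "mom N sz j = massN N"
  unfolding massN_def by (rule mom_additive) (rule sz_add)

lemma sum_excess_euler:
  "(\<Sum>\<alpha>\<in>lat N. euler N j \<alpha> *\<^sub>R excess \<theta> \<alpha>) = (\<Sum>\<alpha>\<in>lat N. n0 \<alpha> *\<^sub>R excess \<theta> \<alpha>)"
proof (subst vec_eq_iff, intro allI)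
  fix i
  have "mom N (\<lambda>\<alpha>. excess \<theta> \<alpha> $ i) j = (\<Sum>\<alpha>\<in>lat N. excess \<theta> \<alpha> $ i * n0 \<alpha>)"
    by (rule mom_additive) (simp add: excess_add)
  thus "(\<Sum>\<alpha>\<in>lat N. euler N j \<alpha> *\<^sub>R excess \<theta> \<alpha>) $ i = (\<Sum>\<alpha>\<in>lat N. n0 \<alpha> *\<^sub>R excess \<theta> \<alpha>) $ i"
    by (simp add: mom_def mult.commute)
qed

lemma sum_vec_euler:
  "(\<Sum>\<alpha>\<in>lat N. euler N j \<alpha> *\<^sub>R vec_of_nat \<alpha>) = (\<Sum>\<alpha>\<in>lat N. n0 \<alpha> *\<^sub>R vec_of_nat \<alpha>)"
  using sum_excess_euler[of N j 0] by (simp add: excess_def)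

lemma euler_outside: "\<alpha> \<notin> lat N \<Longrightarrow> euler N j \<alpha> = 0"
proof (induction j)
  case (Suc j)
  have "(\<Sum>(\<beta>, \<beta>')\<in>splits \<alpha>. cut N k \<beta> \<beta>' * euler N j \<beta> * euler N j \<beta>') = 0"
    using Suc.prems by (intro sum.neutral) (auto simp: splits_def cut_def lat_def sz_add add_nonzero)
  with Suc show ?case by (simp add: coag_rate_def)
qed simp

text \<open>Mass is conserved and sizes are at least 1, so every component is at most
  \<open>m0\<close>; the loss rate is then below the double sum in \<open>step\<close>, and one step
  removes at most the whole of a component. The scheme conserves mass whatever the signs, so this
  may be used inside the induction.\<close>

lemma euler_nonneg: "0 \<le> euler N j \<alpha>"
proof -
  have "\<forall>\<alpha>\<in>lat N. 0 \<le> euler N j \<alpha>"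
  proof (induction j)
    case 0
    show ?case using n0_nonneg by (auto simp: lat_def)
  next
    case (Suc j)
    let ?u = "euler N j"
    show ?case
    proof
      fix \<alpha> :: "nat ^ 'd" assume a: "\<alpha> \<in> lat N"
      have um: "?u \<beta> \<le> m0" if "\<beta> \<in> lat N" for \<beta>
      proof -
        have "1 * ?u \<beta> \<le> sz \<beta> * ?u \<beta>"
          using Suc that sz_ge_1[of \<beta>] by (intro mult_right_mono) (auto simp: lat_def)
        also have "\<dots> \<le> mom N sz j" unfolding mom_def
          using that Suc by (intro member_le_sum) auto
        finally show ?thesis using massN_le[of N] by (simp add: mom_mass)
      qed
      have "(\<Sum>\<beta>\<in>lat N. cut N k \<alpha> \<beta> * ?u \<beta>) \<le> (\<Sum>\<beta>\<in>lat N. k \<alpha> \<beta> * m0)"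
        using a Suc um by (intro sum_mono mult_mono cut_le k_nonneg) (auto simp: lat_def)
      also have "\<dots> = m0 * (\<Sum>\<beta>\<in>lat N. k \<alpha> \<beta>)" by (simp add: sum_distrib_left mult.commute)
      also have "(\<Sum>\<beta>\<in>lat N. k \<alpha> \<beta>) \<le> (\<Sum>\<alpha>\<in>lat N. \<Sum>\<beta>\<in>lat N. k \<alpha> \<beta>)"
        using a by (intro member_le_sum[of _ _ "\<lambda>\<alpha>. \<Sum>\<beta>\<in>lat N. k \<alpha> \<beta>"] sum_nonneg k_nonneg) (auto simp: lat_def)
      finally have loss: "(\<Sum>\<beta>\<in>lat N. cut N k \<alpha> \<beta> * ?u \<beta>) \<le> m0 * (\<Sum>\<alpha>\<in>lat N. \<Sum>\<beta>\<in>lat N. k \<alpha> \<beta>)"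
        using m0_pos by (simp add: mult_left_mono)
      define Q where "Q = m0 * (\<Sum>\<alpha>\<in>lat N. \<Sum>\<beta>\<in>lat (real N). k \<alpha> \<beta>)"
      have Q: "0 \<le> Q" unfolding Q_def by (rule kmax_nonneg)
      have "step N * (\<Sum>\<beta>\<in>lat N. cut N k \<alpha> \<beta> * ?u \<beta>) \<le> step N * Q"
        using loss step_pos[of N] by (intro mult_left_mono) (auto simp: Q_def)
      also have "\<dots> = Q / ((1 + Q) * (1 + real N))" by (simp add: step_def Q_def)
      also have "\<dots> \<le> 1"
      proof -
        define X where "X = (1 + Q) * (1 + real N)"
        have "(1 + Q) * 1 \<le> X" unfolding X_def using Q by (intro mult_left_mono) auto
        hence "1 + Q \<le> X" by simp
        hence "Q \<le> X" "0 < X" using Q by auto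
        thus ?thesis by (simp add: X_def)
      qed
      finally have 1: "0 \<le> 1 - step N * (\<Sum>\<beta>\<in>lat N. cut N k \<alpha> \<beta> * ?u \<beta>)" by simp
      have gain: "0 \<le> (\<Sum>(\<beta>, \<beta>')\<in>splits \<alpha>. cut N k \<beta> \<beta>' * ?u \<beta> * ?u \<beta>')"
      proof (intro sum_nonneg)
        fix x assume "x \<in> splits \<alpha>"
        moreover obtain \<beta> \<beta>' where x: "x = (\<beta>, \<beta>')" by (cases x)
        ultimately have b: "\<beta> \<noteq> 0" "\<beta>' \<noteq> 0" "\<beta> \<in> lat N" "\<beta>' \<in> lat N"
          using a sz_nonneg[of \<beta>] sz_nonneg[of \<beta>'] by (auto simp: splits_def lat_def sz_add simp del: sz_nonneg)
        thus "0 \<le> (case x of (\<beta>, \<beta>') \<Rightarrow> cut N k \<beta> \<beta>' * ?u \<beta> * ?u \<beta>')"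
          using Suc by (simp add: x cut_nonneg)
      qed
      have "euler N (Suc j) \<alpha> = ?u \<alpha> * (1 - step N * (\<Sum>\<beta>\<in>lat N. cut N k \<alpha> \<beta> * ?u \<beta>))
          + step N * (1 / 2 * (\<Sum>(\<beta>, \<beta>')\<in>splits \<alpha>. cut N k \<beta> \<beta>' * ?u \<beta> * ?u \<beta>'))"
        by (simp add: coag_rate_def algebra_simps)
      moreover have "0 \<le> ?u \<alpha> * (1 - step N * (\<Sum>\<beta>\<in>lat N. cut N k \<alpha> \<beta> * ?u \<beta>))"
        using 1 a Suc by (intro mult_nonneg_nonneg) auto
      moreover have "0 \<le> step N * (1 / 2 * (\<Sum>(\<beta>, \<beta>')\<in>splits \<alpha>. cut N k \<beta> \<beta>' * ?u \<beta> * ?u \<beta>'))"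
        using gain step_pos[of N] by (intro mult_nonneg_nonneg) auto
      ultimately show "0 \<le> euler N (Suc j) \<alpha>" by linarith
    qed
  qed
  thus ?thesis using euler_outside[of \<alpha> N j] by (cases "\<alpha> \<in> lat N") auto
qed

lemma mom_mono:
  assumes "\<And>\<alpha>. \<alpha> \<noteq> 0 \<Longrightarrow> \<phi> \<alpha> \<le> \<psi> \<alpha>"
  shows "mom N \<phi> j \<le> mom N \<psi> j"
  unfolding mom_def using assms euler_nonneg
  by (intro sum_mono mult_right_mono) (auto simp: lat_def)

lemma mom_nonneg:
  assumes "\<And>\<alpha>. \<alpha> \<noteq> 0 \<Longrightarrow> 0 \<le> \<phi> \<alpha>"
  shows "0 \<le> mom N \<phi> j"
  unfolding mom_def using assms euler_nonneg
  by (intro sum_nonneg mult_nonneg_nonneg) (auto simp: lat_def)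

lemma mom_le_mass:
  assumes "\<And>\<alpha>. \<alpha> \<noteq> 0 \<Longrightarrow> \<phi> \<alpha> \<le> sz \<alpha>"
  shows "mom N \<phi> j \<le> m0"
  using mom_mono[of \<phi> sz N j] assms massN_le[of N] by (simp add: mom_mass)

text \<open>The constant is uniform in T while N0 is not, since at fixed N the moment stays above a
  multiple of N powr (- s). By \<open>bernoulli_step\<close> the inverse power M powr (- q) grows
  linearly until the truncation is felt, and N is taken so large that this happens only beyond the
  level claimed for time T.\<close>

lemma moment_decay:
  assumes s: "0 < s" "s < 1 - \<gamma>"
  obtains C where "0 < C"
    "\<And>T. \<exists>N0. \<forall>N\<ge>N0. \<forall>j. real j * step N \<le> T \<longrightarrow>
      mom N (\<lambda>\<alpha>. sz \<alpha> powr (1 - s)) j \<le> C * (1 + real j * step N) powr (- (s / (1 - \<gamma>)))"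
proof -
  define q where "q = (1 - \<gamma>) / s"
  have q: "1 \<le> q" using s by (simp add: q_def)
  obtain c where c: "0 < c" and diss:
    "\<And>N u. (\<And>\<alpha>. \<alpha> \<in> lat N \<Longrightarrow> 0 \<le> u \<alpha>) \<Longrightarrow> (\<Sum>\<alpha>\<in>lat N. sz \<alpha> * u \<alpha>) \<le> m0 \<Longrightarrow>
      0 < (\<Sum>\<alpha>\<in>lat N. sz \<alpha> powr (1 - s) * u \<alpha>) \<Longrightarrow>
      4 * (2 * m0 / (\<Sum>\<alpha>\<in>lat N. sz \<alpha> powr (1 - s) * u \<alpha>)) powr (1 / s) \<le> N \<Longrightarrow>
      (\<Sum>\<alpha>\<in>lat N. sz \<alpha> powr (1 - s) * coag_rate N (cut N k) u \<alpha>) \<le>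
        - c * (\<Sum>\<alpha>\<in>lat N. sz \<alpha> powr (1 - s) * u \<alpha>) powr (1 + (1 - \<gamma>) / s)"
    using moment_dissipation[OF s m0_pos] by blast
  \<comment> \<open>Serves both as slope, by a \<le> c, and as initial value, since the moment at
    time 0 is at most \<open>m0\<close>.\<close>
  define a where "a = min c (m0 powr (- q))"
  have a: "0 < a" "a \<le> c" "a \<le> m0 powr (- q)" using c m0_pos by (auto simp: a_def)
  show thesis
  proof
    show "0 < a powr (- (1 / q))" using a by simp
    fix T
    \<comment> \<open>For N \<ge> N1, a failure of the condition on N in \<open>diss\<close> forces
      M powr (- q) above the level a * (1 + T). The \<open>max\<close> with 0 keeps the base
      nonnegative when T is below - 1.\<close>
    define N1 where "N1 = 4 * (2 * m0) powr (1 / s) * (max 0 (a * (1 + T))) powr (1 / (1 - \<gamma>))"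
    obtain N2 where N2: "\<And>N. N \<ge> N2 \<Longrightarrow> m0 / 2 < massN N"
      using order_tendstoD(1)[OF massN_tendsto, of "m0 / 2"] m0_pos
      by (auto simp: eventually_sequentially)
    show "\<exists>N0. \<forall>N\<ge>N0. \<forall>j. real j * step N \<le> T \<longrightarrow>
      mom N (\<lambda>\<alpha>. sz \<alpha> powr (1 - s)) j \<le> a powr (- (1 / q)) * (1 + real j * step N) powr (- (s / (1 - \<gamma>)))"
    proof (intro exI allI impI)
      fix N j assume N: "N \<ge> max (nat \<lceil>N1\<rceil>) N2" and jT: "real j * step N \<le> T"
      define M where "M j = mom N (\<lambda>\<alpha>. sz \<alpha> powr (1 - s)) j" for j
      have NN: "N1 \<le> real N" "m0 / 2 < massN N" using N N2[of N] by linarith+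
      have Mpos: "0 < M j" for j
      proof -
        have "0 \<noteq> mom N sz j" using NN m0_pos by (simp add: mom_mass)
        then obtain \<alpha> where al: "\<alpha> \<in> lat N" "sz \<alpha> * euler N j \<alpha> \<noteq> 0"
          unfolding mom_def
          by (metis (no_types, lifting) sum.not_neutral_contains_not_neutral)
        have "0 < sz \<alpha>" using al sz_pos lat_nonzero by blast
        hence "0 < sz \<alpha> powr (1 - s) * euler N j \<alpha>" using al euler_nonneg[of N j \<alpha>] by simp
        also have "\<dots> \<le> M j" unfolding M_def mom_def
          by (rule member_le_sum[OF al(1)]) (simp_all add: euler_nonneg)
        finally show ?thesis .
      qed
      have M0: "M j \<le> m0" for j unfolding M_def
      proof (rule mom_le_mass)
        fix \<alpha> :: "nat ^ 'd" assume "\<alpha> \<noteq> 0"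
        hence "sz \<alpha> powr (1 - s) \<le> sz \<alpha> powr 1" using s sz_ge_1 by (intro powr_mono) auto
        thus "sz \<alpha> powr (1 - s) \<le> sz \<alpha>" by simp
      qed
      have key: "min (a * (1 + real j * step N)) (max 0 (a * (1 + T))) \<le> M j powr (- q)" for j
      proof (induction j)
        case 0
        have "a \<le> M 0 powr (- q)"
          using a(3) powr_mono2'[of "- q" "M 0" m0] Mpos[of 0] M0[of 0] q by simp
        thus ?case by simp
      next
        case (Suc j)
        show ?case
        proof (cases "4 * (2 * m0 / M j) powr (1 / s) \<le> real N")
          case True
          have "(\<Sum>\<alpha>\<in>lat N. sz \<alpha> * euler N j \<alpha>) \<le> m0"
            using mom_mass[of N j] massN_le[of N] by (simp add: mom_def)
          from diss[OF euler_nonneg this] Mpos[of j] True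
          have "(\<Sum>\<alpha>\<in>lat N. sz \<alpha> powr (1 - s) * coag_rate N (cut N k) (euler N j) \<alpha>) \<le> - c * M j powr (1 + (1 - \<gamma>) / s)"
            unfolding M_def mom_def by blast
          hence "step N * (\<Sum>\<alpha>\<in>lat N. sz \<alpha> powr (1 - s) * coag_rate N (cut N k) (euler N j) \<alpha>)
              \<le> step N * (- c * M j powr (1 + q))"
            using step_pos[of N] by (intro mult_left_mono) (auto simp: q_def)
          hence "M (Suc j) \<le> M j - step N * (c * M j powr (1 + q))"
            by (simp add: M_def mom_Suc)
          hence "M j powr (- q) + step N * c \<le> M (Suc j) powr (- q)"
            using Mpos step_pos[of N] c q by (intro bernoulli_step) auto
          moreover have "step N * a \<le> step N * c" using a step_pos[of N] by (intro mult_left_mono) auto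
          moreover have "a * (1 + real (Suc j) * step N) = a * (1 + real j * step N) + step N * a"
            by (simp add: algebra_simps)
          moreover have "0 < step N * a" using a step_pos[of N] by simp
          ultimately show ?thesis using Suc by linarith
        next
          case False
          have "(M j) powr (- 1 / s) = (1 / M j) powr (1 / s)"
            by (simp add: powr_divide powr_minus_divide)
          have "real N < 4 * (2 * m0) powr (1 / s) * (1 / M j) powr (1 / s)"
            using False powr_mult[of "2 * m0" "1 / M j" "1 / s"] by simp
          hence "4 * (2 * m0) powr (1 / s) * (max 0 (a * (1 + T))) powr (1 / (1 - \<gamma>)) <
              4 * (2 * m0) powr (1 / s) * (1 / M j) powr (1 / s)"
            using NN unfolding N1_def by linarith
          hence "(max 0 (a * (1 + T))) powr (1 / (1 - \<gamma>)) < (1 / M j) powr (1 / s)"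
            using m0_pos by (simp add: mult_less_cancel_left_pos)
          hence "((max 0 (a * (1 + T))) powr (1 / (1 - \<gamma>))) powr (1 - \<gamma>) < ((1 / M j) powr (1 / s)) powr (1 - \<gamma>)"
            using \<gamma> by (intro powr_less_mono2) auto
          hence "max 0 (a * (1 + T)) < (1 / M j) powr q"
            using \<gamma> by (simp add: powr_powr q_def)
          also have "(1 / M j) powr q = M j powr (- q)"
            by (simp add: powr_divide powr_minus_divide)
          also have "\<dots> \<le> M (Suc j) powr (- q)"
          proof (rule powr_mono2')
            have "step N * (\<Sum>\<alpha>\<in>lat N. sz \<alpha> powr (1 - s) * coag_rate N (cut N k) (euler N j) \<alpha>) \<le> 0"
              using step_pos[of N] euler_nonneg s by (intro mult_nonneg_nonpos moment_rate_nonpos) auto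
            thus "M (Suc j) \<le> M j" unfolding M_def mom_Suc by simp
          qed (use q Mpos in auto)
          finally show ?thesis by linarith
        qed
      qed
      have t0: "0 \<le> real j * step N" using step_pos[of N] by simp
      have "a * (1 + real j * step N) \<le> a * (1 + T)" using jT a by (intro mult_left_mono) auto
      hence "a * (1 + real j * step N) \<le> M j powr (- q)" using key[of j] by linarith
      hence "(M j powr (- q)) powr (- (1 / q)) \<le> (a * (1 + real j * step N)) powr (- (1 / q))"
        using a t0 q by (intro powr_mono2') auto
      hence "M j \<le> (a * (1 + real j * step N)) powr (- (1 / q))"
        using q Mpos[of j] by (simp add: powr_powr)
      also have "\<dots> = a powr (- (1 / q)) * (1 + real j * step N) powr (- (s / (1 - \<gamma>)))"
        by (simp add: powr_mult q_def)
      finally show "mom N (\<lambda>\<alpha>. sz \<alpha> powr (1 - s)) j \<le> a powr (- (1 / q)) * (1 + real j * step N) powr (- (s / (1 - \<gamma>)))"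
        by (simp add: M_def)
    qed
  qed
qed

end

text \<open>Comparable to the size above \<open>A\<close> and small relative to it far below \<open>A\<close>.\<close>

definition tail :: "real \<Rightarrow> nat ^ 'd \<Rightarrow> real"
  where "tail A \<alpha> = (sz \<alpha>)\<^sup>2 / (sz \<alpha> + A)"

lemma tail_nonneg: "0 < A \<Longrightarrow> 0 \<le> tail A \<alpha>"
  by (simp add: tail_def)

lemma tail_le: "0 < A \<Longrightarrow> tail A \<alpha> \<le> sz \<alpha>"
  using sz_nonneg[of \<alpha>] by (simp add: tail_def pos_divide_le_eq power2_eq_square distrib_left add_nonneg_pos)

lemma tail_le_ratio: "0 < A \<Longrightarrow> tail A \<alpha> \<le> sz \<alpha> / A * sz \<alpha>"
  using divide_left_mono[of A "sz \<alpha> + A" "(sz \<alpha>)\<^sup>2"] by (simp add: tail_def power2_eq_square add_nonneg_pos)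

lemma tail_antimono: "0 < A \<Longrightarrow> A \<le> B \<Longrightarrow> tail B \<alpha> \<le> tail A \<alpha>"
  unfolding tail_def by (intro divide_left_mono mult_pos_pos add_nonneg_pos) auto

lemma le_two_tail: "0 < A \<Longrightarrow> A \<le> sz \<alpha> \<Longrightarrow> sz \<alpha> \<le> 2 * tail A \<alpha>"
  using mult_left_mono[of A "sz \<alpha>" "sz \<alpha>"]
  by (simp add: tail_def pos_le_divide_eq power2_eq_square algebra_simps add_nonneg_pos)

text \<open>Converts mass outside the window into two test sums with known bounds: below a the
  factor \<open>sz \<alpha> powr s\<close> is at most \<open>a powr s\<close>, and above A the tail
  function is at least half the size.\<close>

lemma outside_window_le:
  assumes "0 < a" "0 < A" "\<not> (a \<le> sz \<alpha> \<and> sz \<alpha> \<le> A)" "0 < s"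
  shows "sz \<alpha> \<le> a powr s * sz \<alpha> powr (1 - s) + 2 * tail A \<alpha>"
proof (cases "sz \<alpha> < a")
  case True
  have "sz \<alpha> = sz \<alpha> powr s * sz \<alpha> powr (1 - s)"
    by (cases "sz \<alpha> = 0") (auto simp flip: powr_add)
  also have "\<dots> \<le> a powr s * sz \<alpha> powr (1 - s)"
    using True assms by (intro mult_right_mono powr_mono2) auto
  finally show ?thesis using tail_nonneg[OF assms(2), of \<alpha>] by linarith
next
  case False
  hence "sz \<alpha> \<le> 2 * tail A \<alpha>" using assms by (intro le_two_tail) auto
  moreover have "0 \<le> a powr s * sz \<alpha> powr (1 - s)" by simp
  ultimately show ?thesis by linarith
qed

section \<open>Mass at large sizes along the Euler scheme\<close>

context coag_data
begin

definition init_tail :: "real \<Rightarrow> real"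
  where "init_tail A = (\<Sum>\<^sub>\<infinity>\<alpha>\<in>nonzero_indices. tail A \<alpha> * n0 \<alpha>)"

lemma tail_summable: "0 < A \<Longrightarrow> (\<lambda>\<alpha>. tail A \<alpha> * n0 \<alpha>) summable_on nonzero_indices"
  using n0_nonneg
  by (intro summable_on_comparison_test[OF n0_mass] mult_right_mono mult_nonneg_nonneg tail_nonneg tail_le) auto

lemma init_tail_antimono: "0 < A \<Longrightarrow> A \<le> B \<Longrightarrow> init_tail B \<le> init_tail A"
  unfolding init_tail_def using n0_nonneg
  by (intro infsum_mono tail_summable mult_right_mono tail_antimono) auto

text \<open>Dominated convergence by hand: up to a fixed size N the tail function is at most N / A
  times the size, and the initial mass above N is small.\<close>

lemma init_tail_small:
  assumes "0 < \<eta>"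
  obtains A0 where "0 < A0" "\<And>A. A0 \<le> A \<Longrightarrow> init_tail A \<le> \<eta>"
proof -
  obtain N where N: "m0 - \<eta> / 2 < massN N"
    using order_tendstoD(1)[OF massN_tendsto, of "m0 - \<eta> / 2"] assms
    by (auto simp: eventually_sequentially)
  \<comment> \<open>Shifted by 1 so that \<open>A0\<close> is positive even for N = 0.\<close>
  define n1 where "n1 = real N + 1"
  define A0 where "A0 = 2 * n1 * m0 / \<eta>"
  have n1: "0 < n1" "real N \<le> n1" by (auto simp: n1_def)
  have A0: "0 < A0" using assms m0_pos n1 by (simp add: A0_def)
  have "init_tail A \<le> \<eta>" if A: "A0 \<le> A" for A unfolding init_tail_def
  proof (rule infsum_le_finite_sums)
    show "(\<lambda>\<alpha>. tail A \<alpha> * n0 \<alpha>) summable_on nonzero_indices" using A A0 by (intro tail_summable) auto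
    fix F :: "(nat ^ 'd) set" assume F: "finite F" "F \<subseteq> nonzero_indices"
    have A': "0 < A" using A A0 by linarith
    have nn: "0 \<le> sz \<alpha> * n0 \<alpha>" if "\<alpha> \<noteq> 0" for \<alpha> using that n0_nonneg by simp
    have "(\<Sum>\<alpha>\<in>F. tail A \<alpha> * n0 \<alpha>) = (\<Sum>\<alpha>\<in>F \<inter> lat N. tail A \<alpha> * n0 \<alpha>) + (\<Sum>\<alpha>\<in>F - lat N. tail A \<alpha> * n0 \<alpha>)"
      using F by (rule_tac sum.Int_Diff)
    moreover have "(\<Sum>\<alpha>\<in>F \<inter> lat N. tail A \<alpha> * n0 \<alpha>) \<le> (\<Sum>\<alpha>\<in>F \<inter> lat N. real N / A * (sz \<alpha> * n0 \<alpha>))"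
    proof (intro sum_mono)
      fix \<alpha> assume "\<alpha> \<in> F \<inter> lat N"
      hence a: "\<alpha> \<noteq> 0" "sz \<alpha> \<le> real N" by (auto simp: lat_def)
      have "tail A \<alpha> \<le> sz \<alpha> / A * sz \<alpha>" by (rule tail_le_ratio[OF A'])
      also have "\<dots> \<le> real N / A * sz \<alpha>" using a A' by (intro mult_right_mono divide_right_mono) auto
      finally have "tail A \<alpha> * n0 \<alpha> \<le> real N / A * sz \<alpha> * n0 \<alpha>" using n0_nonneg[OF a(1)] by (rule mult_right_mono)
      thus "tail A \<alpha> * n0 \<alpha> \<le> real N / A * (sz \<alpha> * n0 \<alpha>)" by (simp only: mult.assoc)
    qed
    moreover have "(\<Sum>\<alpha>\<in>F \<inter> lat N. real N / A * (sz \<alpha> * n0 \<alpha>)) \<le> \<eta> / 2"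
    proof -
      have "(\<Sum>\<alpha>\<in>F \<inter> lat N. sz \<alpha> * n0 \<alpha>) \<le> m0"
        unfolding m0_def using F nn by (intro finite_sum_le_infsum n0_mass) auto
      moreover have "0 \<le> (\<Sum>\<alpha>\<in>F \<inter> lat N. sz \<alpha> * n0 \<alpha>)" using F nn by (intro sum_nonneg) auto
      ultimately have "real N / A * (\<Sum>\<alpha>\<in>F \<inter> lat N. sz \<alpha> * n0 \<alpha>) \<le> n1 / A0 * m0"
        using A A0 n1 by (intro mult_mono frac_le) auto
      also have "\<dots> = \<eta> / 2" using assms m0_pos n1 by (simp add: A0_def)
      finally show ?thesis by (simp only: sum_distrib_left)
    qed
    moreover have "(\<Sum>\<alpha>\<in>F - lat N. tail A \<alpha> * n0 \<alpha>) \<le> (\<Sum>\<alpha>\<in>F - lat N. sz \<alpha> * n0 \<alpha>)"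
      using F n0_nonneg by (intro sum_mono mult_right_mono tail_le[OF A']) auto
    moreover have "massN N + (\<Sum>\<alpha>\<in>F - lat N. sz \<alpha> * n0 \<alpha>) \<le> m0"
    proof -
      have "massN N + (\<Sum>\<alpha>\<in>F - lat N. sz \<alpha> * n0 \<alpha>) = (\<Sum>\<alpha>\<in>lat N \<union> (F - lat N). sz \<alpha> * n0 \<alpha>)"
        unfolding massN_def using F by (intro sum.union_disjoint[symmetric]) auto
      also have "\<dots> \<le> m0" unfolding m0_def using F nn
        by (intro finite_sum_le_infsum n0_mass) (auto simp: lat_def)
      finally show ?thesis .
    qed
    ultimately show "(\<Sum>\<alpha>\<in>F. tail A \<alpha> * n0 \<alpha>) \<le> \<eta>" using N by linarith
  qed
  thus thesis using that A0 by blast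
qed

lemma tail_step:
  assumes A: "0 < A" and D: "mom N (\<lambda>\<alpha>. sz \<alpha> powr (1 - pp)) j \<le> D"
  shows "mom N (tail A) (Suc j) \<le> mom N (tail A) j + step N * (2 * C2 * A powr (- gap) * m0 * D)"
proof -
  have D0: "0 \<le> D" using D mom_nonneg[of "\<lambda>\<alpha>. sz \<alpha> powr (1 - pp)" N j] by auto
  have "(\<Sum>\<alpha>\<in>lat N. tail A \<alpha> * coag_rate N (cut N k) (euler N j) \<alpha>) \<le>
      2 * C2 * A powr (- gap) * mom N sz j * mom N (\<lambda>\<alpha>. sz \<alpha> powr (1 - pp)) j"
    unfolding tail_def mom_def by (rule convex_test_rate[OF euler_nonneg A])
  also have "\<dots> \<le> 2 * C2 * A powr (- gap) * m0 * D"
  proof (rule mult_mono[OF mult_left_mono D])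
    show "mom N sz j \<le> m0" by (simp add: mom_mass massN_le)
    show "0 \<le> mom N (\<lambda>\<alpha>. sz \<alpha> powr (1 - pp)) j" by (rule mom_nonneg) simp
  qed (use C2_pos m0_pos in auto)
  finally show ?thesis using step_pos[of N] by (simp add: mom_Suc)
qed

lemma mom_tail_0: "0 < A \<Longrightarrow> mom N (tail A) 0 \<le> init_tail A"
proof -
  assume A: "0 < A"
  have "mom N (tail A) 0 = (\<Sum>\<alpha>\<in>lat N. tail A \<alpha> * n0 \<alpha>)"
    unfolding mom_def by (intro sum.cong) auto
  also have "\<dots> \<le> init_tail A" unfolding init_tail_def
    using A by (intro finite_sum_le_infsum_lat tail_summable tail_nonneg)
  finally show ?thesis .
qed

lemma mom_powr_le: "0 \<le> s \<Longrightarrow> mom N (\<lambda>\<alpha>. sz \<alpha> powr (1 - s)) j \<le> m0"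
proof (rule mom_le_mass)
  fix \<alpha> :: "nat ^ 'd" assume "\<alpha> \<noteq> 0" "0 \<le> s"
  hence "sz \<alpha> powr (1 - s) \<le> sz \<alpha> powr 1" using sz_ge_1 by (intro powr_mono) auto
  thus "sz \<alpha> powr (1 - s) \<le> sz \<alpha>" by simp
qed

text \<open>The moment of order 1 - pp is bounded by the mass alone, so the bound grows linearly in
  time. In return it holds for every N without a threshold, which is what uniform integrability on
  bounded time intervals asks for.\<close>

lemma tail_crude:
  assumes A: "0 < A"
  shows "mom N (tail A) j \<le> init_tail A + 2 * C2 * m0\<^sup>2 * A powr (- gap) * (real j * step N)"
proof (induction j)
  case (Suc j)
  have "mom N (tail A) (Suc j) \<le> mom N (tail A) j + step N * (2 * C2 * A powr (- gap) * m0 * m0)"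
    by (rule tail_step[OF A mom_powr_le[OF pp_nonneg]])
  with Suc show ?case by (simp add: power2_eq_square algebra_simps)
qed (use mom_tail_0[OF A] in simp)

text \<open>\<open>moment_decay\<close> asks for a positive order s. For pp = 0 the moment is the
  mass and the claimed bound does not decay.\<close>

lemma low_moment_decay:
  obtains D where "0 < D"
    "\<And>T. \<exists>N0. \<forall>N\<ge>N0. \<forall>j. real j * step N \<le> T \<longrightarrow>
      mom N (\<lambda>\<alpha>. sz \<alpha> powr (1 - pp)) j \<le> D * (1 + real j * step N) powr (- (pp / (1 - \<gamma>)))"
proof (cases "pp = 0")
  case True
  have "1 + real j * step N \<noteq> 0" for j N using step_pos[of N] by (smt (verit) of_nat_0_le_iff mult_nonneg_nonneg)
  hence "mom N (\<lambda>\<alpha>. sz \<alpha> powr (1 - pp)) j \<le> m0 * (1 + real j * step N) powr (- (pp / (1 - \<gamma>)))" for N j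
    using mom_powr_le[of pp N j] True by simp
  thus thesis using that[OF m0_pos] by blast
next
  case False
  hence "0 < pp" using pp_nonneg by simp
  from moment_decay[OF this pp_less] that show thesis by blast
qed

text \<open>The decay of the moment of order 1 - pp in the rate improves linear growth in time to
  the power 1 - pp / (1 - \<gamma>) = gap / (1 - \<gamma>). For A = t powr (1 / (1 - \<gamma>)) /
  \<epsilon> the powers of t then cancel and \<epsilon> powr gap remains.\<close>

lemma tail_sharp:
  obtains C where "0 < C"
    "\<And>T. \<exists>N0. \<forall>N\<ge>N0. \<forall>j. real j * step N \<le> T \<longrightarrow> (\<forall>A>0.
      mom N (tail A) j \<le> init_tail A + C * A powr (- gap) * (real j * step N) powr (gap / (1 - \<gamma>)))"
proof -
  define \<kappa> where "\<kappa> = pp / (1 - \<gamma>)"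
  have \<kappa>: "0 \<le> \<kappa>" "\<kappa> < 1" using pp_nonneg pp_less \<gamma> by (auto simp: \<kappa>_def)
  have \<kappa>1: "1 - \<kappa> = gap / (1 - \<gamma>)" using \<gamma> by (simp add: \<kappa>_def gap_def field_simps)
  obtain D where D: "0 < D" and decay:
    "\<And>T. \<exists>N0. \<forall>N\<ge>N0. \<forall>j. real j * step N \<le> T \<longrightarrow>
      mom N (\<lambda>\<alpha>. sz \<alpha> powr (1 - pp)) j \<le> D * (1 + real j * step N) powr (- \<kappa>)"
    using low_moment_decay unfolding \<kappa>_def by blast
  define C where "C = 2 * C2 * m0 * D / (1 - \<kappa>)"
  show thesis
  proof
    show "0 < C" using C2_pos m0_pos D \<kappa> by (simp add: C_def)
    fix T
    obtain N0 where N0: "\<And>N j. N \<ge> N0 \<Longrightarrow> real j * step N \<le> T \<Longrightarrow>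
      mom N (\<lambda>\<alpha>. sz \<alpha> powr (1 - pp)) j \<le> D * (1 + real j * step N) powr (- \<kappa>)"
      using decay[of T] by blast
    have "mom N (tail A) j \<le> init_tail A + C * A powr (- gap) * (real j * step N) powr (1 - \<kappa>)"
      if "N \<ge> N0" "real j * step N \<le> T" "0 < A" for N j A
      using that(2)
    proof (induction j)
      case 0
      show ?case using mom_tail_0[OF that(3), of N] \<kappa> by simp
    next
      case (Suc j)
      have h: "0 < step N" "step N \<le> 1" by (auto simp: step_pos step_le_1)
      have jT: "real j * step N \<le> T" using Suc.prems h by (simp add: algebra_simps)
      define a b where "a = real j * step N" and "b = real (Suc j) * step N"
      have ab: "0 \<le> a" "b = a + step N" "b \<le> 1 + a" "0 < b"
        using h by (auto simp: a_def b_def algebra_simps add_pos_nonneg)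
      \<comment> \<open>The offset 1 in the decay estimate dominates one step, so the rate may be
        evaluated at the right end b, as \<open>powr_increment_ge\<close> requires.\<close>
      have "(1 + a) powr (- \<kappa>) \<le> b powr (- \<kappa>)" using ab \<kappa> by (intro powr_mono2') auto
      hence "step N * (1 + a) powr (- \<kappa>) \<le> step N * b powr (- \<kappa>)" using h by (intro mult_left_mono) auto
      also have "\<dots> \<le> (b powr (1 - \<kappa>) - a powr (1 - \<kappa>)) / (1 - \<kappa>)"
        using powr_increment_ge[of a b \<kappa>] ab h \<kappa> by (simp add: pos_le_divide_eq mult_ac)
      finally have inc: "step N * (1 + a) powr (- \<kappa>) \<le> (b powr (1 - \<kappa>) - a powr (1 - \<kappa>)) / (1 - \<kappa>)" .
      define B where "B = 2 * C2 * A powr (- gap) * m0 * D"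
      have B: "0 \<le> B" using C2_pos m0_pos D by (simp add: B_def)
      have CB: "C * A powr (- gap) = B / (1 - \<kappa>)" by (simp add: C_def B_def)
      have "mom N (tail A) (Suc j) \<le> mom N (tail A) j + step N * (2 * C2 * A powr (- gap) * m0 * (D * (1 + a) powr (- \<kappa>)))"
        unfolding a_def by (rule tail_step[OF that(3) N0[OF that(1) jT]])
      also have "\<dots> = mom N (tail A) j + B * (step N * (1 + a) powr (- \<kappa>))"
        by (simp add: B_def mult_ac)
      also have "\<dots> \<le> (init_tail A + B / (1 - \<kappa>) * a powr (1 - \<kappa>)) + B * ((b powr (1 - \<kappa>) - a powr (1 - \<kappa>)) / (1 - \<kappa>))"
        using Suc.IH[OF jT] mult_left_mono[OF inc B] unfolding CB a_def by linarith
      also have "\<dots> = init_tail A + C * A powr (- gap) * b powr (1 - \<kappa>)"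
        unfolding CB by (simp add: algebra_simps diff_divide_distrib)
      finally show ?case by (simp add: b_def)
    qed
    thus "\<exists>N0. \<forall>N\<ge>N0. \<forall>j. real j * step N \<le> T \<longrightarrow> (\<forall>A>0.
      mom N (tail A) j \<le> init_tail A + C * A powr (- gap) * (real j * step N) powr (gap / (1 - \<gamma>)))"
      unfolding \<kappa>1 by blast
  qed
qed

section \<open>Localization for the Euler scheme\<close>

text \<open>Stated for an arbitrary finite population, because both the Euler scheme and the limit
  satisfy the two moment hypotheses. At this R all powers of t cancel, which singles out the
  exponent 1 / (1 - \<gamma>).\<close>

lemma window_from_moments:
  assumes F: "finite F" "\<And>\<alpha>. \<alpha> \<in> F \<Longrightarrow> 0 \<le> u \<alpha>" and t: "1 \<le> t" and \<epsilon>: "0 < \<epsilon>" "\<epsilon> \<le> 1" and s: "0 < s"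
    and low: "(\<Sum>\<alpha>\<in>F. sz \<alpha> powr (1 - s) * u \<alpha>) \<le> C1 * t powr (- (s / (1 - \<gamma>)))"
    and up: "\<And>A. 0 < A \<Longrightarrow> (\<Sum>\<alpha>\<in>F. tail A \<alpha> * u \<alpha>) \<le> init_tail A + C' * A powr (- gap) * t powr (gap / (1 - \<gamma>))"
  defines "R \<equiv> t powr (1 / (1 - \<gamma>))"
  shows "(\<Sum>\<alpha>\<in>{\<alpha>\<in>F. \<not> (\<epsilon> * R \<le> sz \<alpha> \<and> sz \<alpha> \<le> R / \<epsilon>)}. sz \<alpha> * u \<alpha>) \<le> C1 * \<epsilon> powr s + 2 * (init_tail R + C' * \<epsilon> powr gap)"
proof -
  define W where "W = {\<alpha>\<in>F. \<not> (\<epsilon> * R \<le> sz \<alpha> \<and> sz \<alpha> \<le> R / \<epsilon>)}"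
  have R: "0 < R" using t by (simp add: R_def)
  have low': "(\<epsilon> * R) powr s * (\<Sum>\<alpha>\<in>F. sz \<alpha> powr (1 - s) * u \<alpha>) \<le> C1 * \<epsilon> powr s"
  proof -
    have "(\<epsilon> * R) powr s * (\<Sum>\<alpha>\<in>F. sz \<alpha> powr (1 - s) * u \<alpha>) \<le> (\<epsilon> * R) powr s * (C1 * t powr (- (s / (1 - \<gamma>))))"
      using low by (intro mult_left_mono) auto
    also have "\<dots> = C1 * \<epsilon> powr s * (t powr (s / (1 - \<gamma>)) * t powr (- (s / (1 - \<gamma>))))"
      by (simp add: R_def powr_mult powr_powr)
    also have "t powr (s / (1 - \<gamma>)) * t powr (- (s / (1 - \<gamma>))) = 1" using t by (simp flip: powr_add)
    finally show ?thesis by simp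
  qed
  have up': "(\<Sum>\<alpha>\<in>F. tail (R / \<epsilon>) \<alpha> * u \<alpha>) \<le> init_tail R + C' * \<epsilon> powr gap"
  proof -
    have "(\<Sum>\<alpha>\<in>F. tail (R / \<epsilon>) \<alpha> * u \<alpha>) \<le> init_tail (R / \<epsilon>) + C' * (R / \<epsilon>) powr (- gap) * t powr (gap / (1 - \<gamma>))"
      using R \<epsilon> by (intro up) auto
    also have "(R / \<epsilon>) powr (- gap) * t powr (gap / (1 - \<gamma>)) = \<epsilon> powr gap"
      using t by (simp add: R_def powr_divide powr_powr powr_minus_divide)
    hence "C' * (R / \<epsilon>) powr (- gap) * t powr (gap / (1 - \<gamma>)) = C' * \<epsilon> powr gap"
      by (simp only: mult.assoc)
    also have "init_tail (R / \<epsilon>) \<le> init_tail R" using R \<epsilon> by (intro init_tail_antimono) (auto simp: pos_le_divide_eq)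
    finally show ?thesis by linarith
  qed
  have "(\<Sum>\<alpha>\<in>W. sz \<alpha> * u \<alpha>) \<le>
      (\<Sum>\<alpha>\<in>W. (\<epsilon> * R) powr s * (sz \<alpha> powr (1 - s) * u \<alpha>) + 2 * (tail (R / \<epsilon>) \<alpha> * u \<alpha>))"
  proof (intro sum_mono)
    fix \<alpha> assume a: "\<alpha> \<in> W"
    hence "sz \<alpha> \<le> (\<epsilon> * R) powr s * sz \<alpha> powr (1 - s) + 2 * tail (R / \<epsilon>) \<alpha>"
      using R \<epsilon> s by (intro outside_window_le) (auto simp: W_def)
    from mult_right_mono[OF this, of "u \<alpha>"] a F(2)
    show "sz \<alpha> * u \<alpha> \<le> (\<epsilon> * R) powr s * (sz \<alpha> powr (1 - s) * u \<alpha>) + 2 * (tail (R / \<epsilon>) \<alpha> * u \<alpha>)"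
      by (simp add: algebra_simps W_def)
  qed
  also have "\<dots> \<le> (\<Sum>\<alpha>\<in>F. (\<epsilon> * R) powr s * (sz \<alpha> powr (1 - s) * u \<alpha>) + 2 * (tail (R / \<epsilon>) \<alpha> * u \<alpha>))"
    using R \<epsilon> F by (intro sum_mono2 add_nonneg_nonneg mult_nonneg_nonneg tail_nonneg) (auto simp: W_def)
  also have "\<dots> = (\<epsilon> * R) powr s * (\<Sum>\<alpha>\<in>F. sz \<alpha> powr (1 - s) * u \<alpha>) + 2 * (\<Sum>\<alpha>\<in>F. tail (R / \<epsilon>) \<alpha> * u \<alpha>)"
    by (simp only: sum.distrib sum_distrib_left)
  also have "\<dots> \<le> C1 * \<epsilon> powr s + 2 * (init_tail R + C' * \<epsilon> powr gap)"
    by (intro add_mono low' mult_left_mono up') auto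
  finally show ?thesis by (simp only: W_def)
qed

lemma window_bound:
  obtains C where "0 < C"
    "\<And>T. \<exists>N0. \<forall>N\<ge>N0. \<forall>j \<epsilon>. 1 \<le> real j * step N \<longrightarrow> real j * step N \<le> T \<longrightarrow> 0 < \<epsilon> \<longrightarrow> \<epsilon> \<le> 1 \<longrightarrow>
      (\<Sum>\<alpha>\<in>{\<alpha>\<in>lat N. \<not> (\<epsilon> * (real j * step N) powr (1 / (1 - \<gamma>)) \<le> sz \<alpha> \<and>
          sz \<alpha> \<le> (real j * step N) powr (1 / (1 - \<gamma>)) / \<epsilon>)}. sz \<alpha> * euler N j \<alpha>)
      \<le> C * (\<epsilon> powr ((1 - \<gamma>) / 2) + \<epsilon> powr gap) + 2 * init_tail ((real j * step N) powr (1 / (1 - \<gamma>)))"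
proof -
  define s where "s = (1 - \<gamma>) / 2"
  have s: "0 < s" "s < 1 - \<gamma>" using \<gamma> by (auto simp: s_def)
  obtain C1 where C1: "0 < C1" "\<And>T. \<exists>N0. \<forall>N\<ge>N0. \<forall>j. real j * step N \<le> T \<longrightarrow>
      mom N (\<lambda>\<alpha>. sz \<alpha> powr (1 - s)) j \<le> C1 * (1 + real j * step N) powr (- (s / (1 - \<gamma>)))"
    using moment_decay[OF s] by blast
  obtain C' where C': "0 < C'" "\<And>T. \<exists>N0. \<forall>N\<ge>N0. \<forall>j. real j * step N \<le> T \<longrightarrow> (\<forall>A>0.
      mom N (tail A) j \<le> init_tail A + C' * A powr (- gap) * (real j * step N) powr (gap / (1 - \<gamma>)))"
    using tail_sharp by blast
  define C where "C = max C1 (2 * C')"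
  show thesis
  proof
    show "0 < C" using C1 by (simp add: C_def)
    fix T
    obtain N1 where N1: "\<And>N j. N \<ge> N1 \<Longrightarrow> real j * step N \<le> T \<Longrightarrow>
      mom N (\<lambda>\<alpha>. sz \<alpha> powr (1 - s)) j \<le> C1 * (1 + real j * step N) powr (- (s / (1 - \<gamma>)))"
      using C1(2)[of T] by blast
    obtain N2 where N2: "\<And>N j A. N \<ge> N2 \<Longrightarrow> real j * step N \<le> T \<Longrightarrow> 0 < A \<Longrightarrow>
      mom N (tail A) j \<le> init_tail A + C' * A powr (- gap) * (real j * step N) powr (gap / (1 - \<gamma>))"
      using C'(2)[of T] by blast
    show "\<exists>N0. \<forall>N\<ge>N0. \<forall>j \<epsilon>. 1 \<le> real j * step N \<longrightarrow> real j * step N \<le> T \<longrightarrow> 0 < \<epsilon> \<longrightarrow> \<epsilon> \<le> 1 \<longrightarrow>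
      (\<Sum>\<alpha>\<in>{\<alpha>\<in>lat N. \<not> (\<epsilon> * (real j * step N) powr (1 / (1 - \<gamma>)) \<le> sz \<alpha> \<and>
          sz \<alpha> \<le> (real j * step N) powr (1 / (1 - \<gamma>)) / \<epsilon>)}. sz \<alpha> * euler N j \<alpha>)
      \<le> C * (\<epsilon> powr ((1 - \<gamma>) / 2) + \<epsilon> powr gap) + 2 * init_tail ((real j * step N) powr (1 / (1 - \<gamma>)))"
    proof (intro exI allI impI)
      fix N j and \<epsilon> :: real
      assume N: "N \<ge> max N1 N2" and t: "1 \<le> real j * step N" and tT: "real j * step N \<le> T"
        and \<epsilon>: "0 < \<epsilon>" "\<epsilon> \<le> 1"
      have "mom N (\<lambda>\<alpha>. sz \<alpha> powr (1 - s)) j \<le> C1 * (1 + real j * step N) powr (- (s / (1 - \<gamma>)))"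
        using N tT by (intro N1) auto
      also have "\<dots> \<le> C1 * (real j * step N) powr (- (s / (1 - \<gamma>)))"
        using C1 t s \<gamma> by (intro mult_left_mono powr_mono2') auto
      finally have low: "(\<Sum>\<alpha>\<in>lat N. sz \<alpha> powr (1 - s) * euler N j \<alpha>) \<le> C1 * (real j * step N) powr (- (s / (1 - \<gamma>)))"
        by (simp add: mom_def)
      have up: "(\<Sum>\<alpha>\<in>lat N. tail A \<alpha> * euler N j \<alpha>) \<le> init_tail A + C' * A powr (- gap) * (real j * step N) powr (gap / (1 - \<gamma>))"
        if "0 < A" for A
        using N2[OF _ tT that] N by (simp add: mom_def)
      have "(\<Sum>\<alpha>\<in>{\<alpha>\<in>lat N. \<not> (\<epsilon> * (real j * step N) powr (1 / (1 - \<gamma>)) \<le> sz \<alpha> \<and>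
          sz \<alpha> \<le> (real j * step N) powr (1 / (1 - \<gamma>)) / \<epsilon>)}. sz \<alpha> * euler N j \<alpha>)
        \<le> C1 * \<epsilon> powr s + 2 * (init_tail ((real j * step N) powr (1 / (1 - \<gamma>))) + C' * \<epsilon> powr gap)"
        by (rule window_from_moments[OF finite_lat euler_nonneg t \<epsilon> s(1) low up])
      moreover have "C1 * \<epsilon> powr s + 2 * C' * \<epsilon> powr gap \<le> C * \<epsilon> powr s + C * \<epsilon> powr gap"
        by (intro add_mono mult_right_mono) (auto simp: C_def)
      ultimately show "(\<Sum>\<alpha>\<in>{\<alpha>\<in>lat N. \<not> (\<epsilon> * (real j * step N) powr (1 / (1 - \<gamma>)) \<le> sz \<alpha> \<and>
          sz \<alpha> \<le> (real j * step N) powr (1 / (1 - \<gamma>)) / \<epsilon>)}. sz \<alpha> * euler N j \<alpha>)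
        \<le> C * (\<epsilon> powr ((1 - \<gamma>) / 2) + \<epsilon> powr gap) + 2 * init_tail ((real j * step N) powr (1 / (1 - \<gamma>)))"
        unfolding s_def[symmetric] by (simp only: distrib_left mult.assoc)
    qed
  qed
qed

end

section \<open>The mean direction and the decay of the spread\<close>

context coag_data
begin

lemma vec_abs_summable: "(\<lambda>\<alpha>. norm (n0 \<alpha> *\<^sub>R vec_of_nat \<alpha>)) summable_on nonzero_indices"
proof (rule summable_on_comparison_test[OF n0_mass])
  fix \<alpha> :: "nat ^ 'd" assume "\<alpha> \<in> nonzero_indices"
  hence "0 \<le> n0 \<alpha>" by (simp add: n0_nonneg)
  thus "norm (n0 \<alpha> *\<^sub>R vec_of_nat \<alpha>) \<le> sz \<alpha> * n0 \<alpha>"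
    using mult_right_mono[OF norm_vec_of_nat_le[of \<alpha>], of "n0 \<alpha>"] by (simp add: mult.commute)
qed simp

lemma vec_summable: "(\<lambda>\<alpha>. n0 \<alpha> *\<^sub>R vec_of_nat \<alpha>) summable_on nonzero_indices"
  by (rule abs_summable_summable[OF vec_abs_summable])

definition theta0 :: "real ^ 'd"
  where "theta0 = (1 / m0) *\<^sub>R (\<Sum>\<^sub>\<infinity>\<alpha>\<in>nonzero_indices. n0 \<alpha> *\<^sub>R vec_of_nat \<alpha>)"

lemma norm_theta0_le: "norm theta0 \<le> 1"
proof -
  have "norm (\<Sum>\<^sub>\<infinity>\<alpha>\<in>nonzero_indices. n0 \<alpha> *\<^sub>R vec_of_nat \<alpha>) \<le> (\<Sum>\<^sub>\<infinity>\<alpha>\<in>nonzero_indices. norm (n0 \<alpha> *\<^sub>R vec_of_nat \<alpha>))"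
    by (rule norm_infsum_bound[OF vec_abs_summable])
  also have "\<dots> \<le> m0" unfolding m0_def
  proof (rule infsum_mono[OF vec_abs_summable n0_mass])
    fix \<alpha> :: "nat ^ 'd" assume "\<alpha> \<in> nonzero_indices"
    hence "0 \<le> n0 \<alpha>" by (simp add: n0_nonneg)
    thus "norm (n0 \<alpha> *\<^sub>R vec_of_nat \<alpha>) \<le> sz \<alpha> * n0 \<alpha>"
      using mult_right_mono[OF norm_vec_of_nat_le[of \<alpha>], of "n0 \<alpha>"] by (simp add: mult.commute)
  qed
  finally show ?thesis using m0_pos by (simp add: theta0_def)
qed

text \<open>\<open>theta0\<close> is the velocity of the centre of mass, so the total excess of the
  initial data vanishes. The truncated sums only tend to zero, which is why
  \<open>spread_rate\<close> tolerates a small total excess.\<close>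

lemma sum_excess_tendsto: "(\<lambda>N. \<Sum>\<alpha>\<in>lat (real N). n0 \<alpha> *\<^sub>R excess theta0 \<alpha>) \<longlonglongrightarrow> 0"
proof -
  have "(\<Sum>\<alpha>\<in>lat (real N). n0 \<alpha> *\<^sub>R excess theta0 \<alpha>) =
      (\<Sum>\<alpha>\<in>lat (real N). n0 \<alpha> *\<^sub>R vec_of_nat \<alpha>) - massN N *\<^sub>R theta0" for N
    by (simp add: excess_def massN_def scaleR_diff_right sum_subtractf scaleR_sum_left mult.commute)
  moreover have "(\<lambda>N. (\<Sum>\<alpha>\<in>lat (real N). n0 \<alpha> *\<^sub>R vec_of_nat \<alpha>) - massN N *\<^sub>R theta0) \<longlonglongrightarrow>
      (\<Sum>\<^sub>\<infinity>\<alpha>\<in>nonzero_indices. n0 \<alpha> *\<^sub>R vec_of_nat \<alpha>) - m0 *\<^sub>R theta0"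
    by (intro tendsto_intros sum_lat_tendsto vec_summable massN_tendsto)
  ultimately show ?thesis using m0_pos by (simp add: theta0_def)
qed

lemma small_scale:
  fixes C \<eta> a b :: real
  assumes "0 < C" "0 < \<eta>" "0 < a" "0 < b"
  obtains \<epsilon> where "0 < \<epsilon>" "\<epsilon> \<le> 1" "C * (\<epsilon> powr a + \<epsilon> powr b) \<le> \<eta>"
proof
  define e where "e = \<eta> / (2 * C)"
  define \<epsilon> where "\<epsilon> = min 1 (min (e powr (1 / a)) (e powr (1 / b)))"
  have e: "0 < e" using assms by (simp add: e_def)
  show \<epsilon>: "0 < \<epsilon>" "\<epsilon> \<le> 1" using e by (auto simp: \<epsilon>_def)
  have "\<epsilon> powr a \<le> (e powr (1 / a)) powr a" using \<epsilon> assms by (intro powr_mono2) (auto simp: \<epsilon>_def)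
  hence 1: "\<epsilon> powr a \<le> e" using e assms by (simp add: powr_powr)
  have "\<epsilon> powr b \<le> (e powr (1 / b)) powr b" using \<epsilon> assms by (intro powr_mono2) (auto simp: \<epsilon>_def)
  hence 2: "\<epsilon> powr b \<le> e" using e assms by (simp add: powr_powr)
  have "C * (\<epsilon> powr a + \<epsilon> powr b) \<le> C * (e + e)" using 1 2 assms by (intro mult_left_mono add_mono) auto
  also have "\<dots> = \<eta>" using assms by (simp add: e_def)
  finally show "C * (\<epsilon> powr a + \<epsilon> powr b) \<le> \<eta>" .
qed

lemma mom_spread_le: "mom N (spread theta0) j \<le> 4 * m0"
proof -
  have "mom N (spread theta0) j \<le> mom N (\<lambda>\<alpha>. 4 * sz \<alpha>) j"
    by (intro mom_mono spread_le norm_theta0_le)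
  also have "\<dots> = 4 * mom N sz j" by (simp only: mom_def sum_distrib_left mult.assoc)
  finally show ?thesis using massN_le[of N] by (simp add: mom_mass)
qed

lemma mom_spread_Suc_le: "mom N (spread theta0) (Suc j) \<le> mom N (spread theta0) j"
proof -
  have "step N * (\<Sum>\<alpha>\<in>lat N. spread theta0 \<alpha> * coag_rate N (cut N k) (euler N j) \<alpha>) \<le> 0"
    using step_pos[of N] by (intro mult_nonneg_nonpos spread_rate_nonpos euler_nonneg) auto
  thus ?thesis by (simp only: mom_Suc)
qed

text \<open>
  While the spread exceeds a multiple of the mass outside the window \<open>R \<sim> t powr (1 / (1 - \<gamma>))\<close>,
  it decreases at least like \<open>- b / t\<close>; since \<open>1 / t\<close> is not integrable at infinity,
  this cannot last.
\<close>

lemma spread_decay: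
  assumes \<eta>: "0 < \<eta>"
  obtains T1 where
    "\<And>T. \<exists>N0. \<forall>N\<ge>N0. \<forall>j. T1 \<le> real j * step N \<longrightarrow> real j * step N \<le> T \<longrightarrow> mom N (spread theta0) j \<le> 6 * \<eta>"
proof -
  obtain C where C: "0 < C"
    "\<And>T. \<exists>N0. \<forall>N\<ge>N0. \<forall>j \<epsilon>. 1 \<le> real j * step N \<longrightarrow> real j * step N \<le> T \<longrightarrow> 0 < \<epsilon> \<longrightarrow> \<epsilon> \<le> 1 \<longrightarrow>
      (\<Sum>\<alpha>\<in>{\<alpha>\<in>lat N. \<not> (\<epsilon> * (real j * step N) powr (1 / (1 - \<gamma>)) \<le> sz \<alpha> \<and>
          sz \<alpha> \<le> (real j * step N) powr (1 / (1 - \<gamma>)) / \<epsilon>)}. sz \<alpha> * euler N j \<alpha>)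
      \<le> C * (\<epsilon> powr ((1 - \<gamma>) / 2) + \<epsilon> powr gap) + 2 * init_tail ((real j * step N) powr (1 / (1 - \<gamma>)))"
    using window_bound by blast
  obtain \<epsilon> where \<epsilon>: "0 < \<epsilon>" "\<epsilon> \<le> 1" "C * (\<epsilon> powr ((1 - \<gamma>) / 2) + \<epsilon> powr gap) \<le> \<eta> / 2"
    using small_scale[of C "\<eta> / 2" "(1 - \<gamma>) / 2" gap] C(1) \<eta> \<gamma> gap_pos by auto
  obtain A0 where A0: "0 < A0" "\<And>A. A0 \<le> A \<Longrightarrow> init_tail A \<le> \<eta> / 4"
    using init_tail_small[of "\<eta> / 4"] \<eta> by auto
  define T0 where "T0 = max 1 (A0 powr (1 - \<gamma>))"
  have T0: "1 \<le> T0" by (simp add: T0_def)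
  have init_tail_R: "init_tail (t powr (1 / (1 - \<gamma>))) \<le> \<eta> / 4" if "T0 \<le> t" for t
  proof (rule A0(2))
    have "(A0 powr (1 - \<gamma>)) powr (1 / (1 - \<gamma>)) \<le> t powr (1 / (1 - \<gamma>))"
      using that \<gamma> by (intro powr_mono2) (auto simp: T0_def)
    thus "A0 \<le> t powr (1 / (1 - \<gamma>))" using A0(1) \<gamma> by (simp add: powr_powr)
  qed
  \<comment> \<open>Coefficient of 1 / t in the drop: the truncated mass is at least m0 / 2, and E -
    5 * \<eta> exceeds \<eta> as long as E exceeds 6 * \<eta>.\<close>
  define b where "b = low_const \<epsilon> * (m0 / 2) * \<eta>"
  have b: "0 < b" using low_const_pos[OF \<epsilon>(1)] m0_pos \<eta> by (simp add: b_def)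
  \<comment> \<open>From T0 + 1 to T1 the logarithm of time increases by 4 * m0 / b, so the
    accumulated drop reaches 4 * m0, the largest possible spread.\<close>
  define T1 where "T1 = (T0 + 1) * exp (4 * m0 / b)"
  have T01: "T0 + 1 \<le> T1"
  proof -
    have "(T0 + 1) * 1 \<le> (T0 + 1) * exp (4 * m0 / b)" using T0 m0_pos b by (intro mult_left_mono) auto
    thus ?thesis by (simp add: T1_def)
  qed
  show thesis
  proof
    fix T
    obtain N1 where N1: "\<And>N j. N \<ge> N1 \<Longrightarrow> 1 \<le> real j * step N \<Longrightarrow> real j * step N \<le> T \<Longrightarrow>
      (\<Sum>\<alpha>\<in>{\<alpha>\<in>lat N. \<not> (\<epsilon> * (real j * step N) powr (1 / (1 - \<gamma>)) \<le> sz \<alpha> \<and>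
          sz \<alpha> \<le> (real j * step N) powr (1 / (1 - \<gamma>)) / \<epsilon>)}. sz \<alpha> * euler N j \<alpha>)
      \<le> C * (\<epsilon> powr ((1 - \<gamma>) / 2) + \<epsilon> powr gap) + 2 * init_tail ((real j * step N) powr (1 / (1 - \<gamma>)))"
      using C(2)[of T] \<epsilon> by blast
    obtain N2 where N2: "\<And>N. N \<ge> N2 \<Longrightarrow> m0 / 2 < massN N"
      using order_tendstoD(1)[OF massN_tendsto, of "m0 / 2"] m0_pos
      by (auto simp: eventually_sequentially)
    have "(\<lambda>N. (norm (\<Sum>\<alpha>\<in>lat (real N). n0 \<alpha> *\<^sub>R excess theta0 \<alpha>))\<^sup>2) \<longlonglongrightarrow> (norm (0 :: real ^ 'd))\<^sup>2"
      by (intro tendsto_intros sum_excess_tendsto)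
    hence "(\<lambda>N. (norm (\<Sum>\<alpha>\<in>lat (real N). n0 \<alpha> *\<^sub>R excess theta0 \<alpha>))\<^sup>2) \<longlonglongrightarrow> 0" by simp
    from order_tendstoD(2)[OF this, of "\<eta> * (m0 / 2)"] obtain N3 where
      N3: "\<And>N. N \<ge> N3 \<Longrightarrow> (norm (\<Sum>\<alpha>\<in>lat (real N). n0 \<alpha> *\<^sub>R excess theta0 \<alpha>))\<^sup>2 < \<eta> * (m0 / 2)"
      using \<eta> m0_pos by (auto simp: eventually_sequentially)
    obtain N4 :: nat where N4: "2 * (T powr (1 / (1 - \<gamma>)) / \<epsilon>) \<le> real N4" using real_arch_simple by blast
    show "\<exists>N0. \<forall>N\<ge>N0. \<forall>j. T1 \<le> real j * step N \<longrightarrow> real j * step N \<le> T \<longrightarrow> mom N (spread theta0) j \<le> 6 * \<eta>"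
    proof (intro exI allI impI)
      fix N J assume N: "N \<ge> Max {N1, N2, N3, N4}" and J: "T1 \<le> real J * step N" "real J * step N \<le> T"
      have NN: "N \<ge> N1" "N \<ge> N2" "N \<ge> N3" "N \<ge> N4" using N by auto
      define h where "h = step N"
      have h: "0 < h" "h \<le> 1" by (auto simp: h_def step_pos step_le_1)
      define E where "E j = mom N (spread theta0) j" for j
      have anti: "E j' \<le> E j" if "j \<le> j'" for j j'
      proof (rule lift_Suc_antimono_le[of E, OF _ that])
        show "E (Suc n) \<le> E n" for n unfolding E_def by (rule mom_spread_Suc_le)
      qed
      have drop: "E (Suc j) \<le> E j - b / real j"
        if j: "T0 \<le> real j * h" "real j * h \<le> T" and big: "6 * \<eta> < E j" for j
      proof -
        define t where "t = real j * h"
        define R where "R = t powr (1 / (1 - \<gamma>))"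
        have t: "1 \<le> t" "T0 \<le> t" "t \<le> T" using j T0 by (auto simp: t_def)
        have R: "0 < R" using t by (simp add: R_def)
        have "(\<Sum>\<alpha>\<in>lat N. spread theta0 \<alpha> * coag_rate N (cut N k) (euler N j) \<alpha>) \<le>
          - (low_const \<epsilon> * R powr (\<gamma> - 1) * (\<Sum>\<alpha>\<in>lat N. sz \<alpha> * euler N j \<alpha>) *
             ((\<Sum>\<alpha>\<in>lat N. spread theta0 \<alpha> * euler N j \<alpha>) - 5 * \<eta>))"
        proof (rule spread_rate[OF euler_nonneg \<epsilon>(1,2) R])
          have "R / \<epsilon> \<le> T powr (1 / (1 - \<gamma>)) / \<epsilon>" unfolding R_def
            using t \<gamma> \<epsilon> by (intro divide_right_mono powr_mono2) auto
          thus "2 * (R / \<epsilon>) \<le> real N" using N4 NN by linarith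
          have "(\<Sum>\<alpha>\<in>{\<alpha>\<in>lat N. \<not> (\<epsilon> * R \<le> sz \<alpha> \<and> sz \<alpha> \<le> R / \<epsilon>)}. sz \<alpha> * euler N j \<alpha>)
              \<le> C * (\<epsilon> powr ((1 - \<gamma>) / 2) + \<epsilon> powr gap) + 2 * init_tail R"
            unfolding R_def t_def h_def using t NN by (intro N1) (auto simp: t_def h_def)
          also have "\<dots> \<le> \<eta>" using \<epsilon>(3) init_tail_R[OF t(2)] unfolding R_def by linarith
          finally show "(\<Sum>\<alpha>\<in>{\<alpha>\<in>lat N. \<not> (\<epsilon> * R \<le> sz \<alpha> \<and> sz \<alpha> \<le> R / \<epsilon>)}. sz \<alpha> * euler N j \<alpha>) \<le> \<eta>" .
          have "(norm (\<Sum>\<alpha>\<in>lat N. n0 \<alpha> *\<^sub>R excess theta0 \<alpha>))\<^sup>2 \<le> \<eta> * (m0 / 2)" using N3[OF NN(3)] by simp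
          also have "\<dots> \<le> \<eta> * massN N" using N2[OF NN(2)] \<eta> by (intro mult_left_mono) auto
          finally show "(norm (\<Sum>\<alpha>\<in>lat N. euler N j \<alpha> *\<^sub>R excess theta0 \<alpha>))\<^sup>2 \<le> \<eta> * (\<Sum>\<alpha>\<in>lat N. sz \<alpha> * euler N j \<alpha>)"
            using mom_mass[of N j] by (simp add: sum_excess_euler mom_def)
        qed
        also have "\<dots> = - (low_const \<epsilon> * (1 / t) * massN N * (E j - 5 * \<eta>))"
        proof -
          have "1 / (1 - \<gamma>) * (\<gamma> - 1) = - 1" using \<gamma> by (simp add: divide_simps)
          hence "R powr (\<gamma> - 1) = 1 / t" using t by (simp add: R_def powr_powr powr_minus_divide)
          thus ?thesis using mom_mass[of N j] by (simp add: mom_def E_def)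
        qed
        also have "\<dots> \<le> - (low_const \<epsilon> * (1 / t) * (m0 / 2) * \<eta>)"
          using low_const_pos[OF \<epsilon>(1)] t N2[OF NN(2)] big m0_pos \<eta>
          by (intro le_imp_neg_le mult_mono) auto
        also have "\<dots> = - (b / t)" by (simp add: b_def)
        finally have "h * (\<Sum>\<alpha>\<in>lat N. spread theta0 \<alpha> * coag_rate N (cut N k) (euler N j) \<alpha>) \<le> h * - (b / t)"
          using h by (intro mult_left_mono) auto
        also have "h * - (b / t) = - (b / real j)" using h by (simp add: t_def)
        finally show ?thesis by (simp add: E_def mom_Suc h_def)
      qed
      show "mom N (spread theta0) J \<le> 6 * \<eta>"
      proof (rule ccontr)
        assume "\<not> mom N (spread theta0) J \<le> 6 * \<eta>"
        hence EJ: "6 * \<eta> < E J" by (simp add: E_def)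
        \<comment> \<open>The first step at or after T0. Since h \<le> 1 it is not later than T0 +
          1, whence the shift in \<open>T1\<close>.\<close>
        define j0 where "j0 = nat \<lceil>T0 / h\<rceil>"
        have "0 \<le> T0 / h" using T0 h by simp
        hence "T0 / h \<le> real j0" "real j0 \<le> T0 / h + 1" unfolding j0_def by linarith+
        hence "T0 / h * h \<le> real j0 * h" "real j0 * h \<le> (T0 / h + 1) * h"
          using h by (auto intro!: mult_right_mono simp del: divide_le_eq times_divide_eq_left)
        moreover have "T0 / h * h = T0" "(T0 / h + 1) * h = T0 + h" using h by (auto simp: distrib_right)
        ultimately have j0: "T0 \<le> real j0 * h" "real j0 * h \<le> T0 + 1" using h by auto
        hence j0pos: "0 < real j0" using T0 h by (cases "j0 = 0") auto
        have "real j0 * h \<le> real J * h" using j0 J T01 unfolding h_def by linarith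
        hence j0J: "j0 \<le> J" using h by simp
        \<comment> \<open>The spread is nonincreasing, so all earlier values exceed 6 * \<eta> too
          and each step drops by b / j. The harmonic sum dominates the logarithm through ln (1 + 1 /
          j) \<le> 1 / j.\<close>
        have "E j \<le> 4 * m0 - b * ln (real j / real j0)" if "j0 \<le> j" "j \<le> J" for j
          using that
        proof (induction j rule: dec_induct)
          case base
          show ?case using mom_spread_le[of N j0] j0pos by (simp add: E_def)
        next
          case (step j)
          have jp: "0 < real j" using step j0pos by linarith
          have "real j0 * h \<le> real j * h" "real j * h \<le> real J * h" using step h by (auto intro!: mult_right_mono)
          hence "T0 \<le> real j * h" "real j * h \<le> T" using j0 J by (auto simp: h_def)
          moreover have "6 * \<eta> < E j" using anti[of j J] step EJ by simp
          ultimately have 1: "E (Suc j) \<le> E j - b / real j" by (rule drop)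
          have "real (Suc j) / real j0 = real j / real j0 * (1 + 1 / real j)"
            using jp by (simp add: distrib_left add_divide_distrib)
          moreover have "ln (real j / real j0 * (1 + 1 / real j)) = ln (real j / real j0) + ln (1 + 1 / real j)"
            using jp j0pos by (intro ln_mult_pos divide_pos_pos add_pos_pos) auto
          ultimately have "ln (real (Suc j) / real j0) = ln (real j / real j0) + ln (1 + 1 / real j)"
            by (simp only:)
          moreover have "ln (1 + 1 / real j) \<le> 1 / real j" using jp by (intro ln_add_one_self_le_self) auto
          ultimately have "b * ln (real (Suc j) / real j0) \<le> b * (ln (real j / real j0) + 1 / real j)"
            using b by (intro mult_left_mono) auto
          with 1 step show ?case by (simp add: algebra_simps del: of_nat_Suc)
        qed
        from this[OF j0J order.refl] have fin: "E J \<le> 4 * m0 - b * ln (real J / real j0)" .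
        have "exp (4 * m0 / b) * (real j0 * h) \<le> exp (4 * m0 / b) * (T0 + 1)"
          using j0 by (intro mult_left_mono) auto
        also have "\<dots> \<le> real J * h" using J by (simp add: T1_def h_def mult.commute)
        finally have "exp (4 * m0 / b) * real j0 \<le> real J" using h by simp
        hence "exp (4 * m0 / b) \<le> real J / real j0" using j0pos by (simp add: pos_le_divide_eq)
        hence "4 * m0 / b \<le> ln (real J / real j0)"
          by (smt (verit, best) exp_gt_zero ln_exp ln_le_cancel_iff)
        hence "4 * m0 \<le> b * ln (real J / real j0)" using b by (simp add: pos_divide_le_eq mult.commute)
        with fin EJ \<eta> show False by linarith
      qed
    qed
  qed
qed

end

section \<open>Passage to the limit\<close>

text \<open>Turns the telescoped sum of Euler increments into an integral in time, to which
  dominated convergence applies.\<close>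

lemma step_function_integral:
  fixes q :: "nat \<Rightarrow> real"
  assumes h: "0 < h"
  shows "((\<lambda>s. q (nat \<lfloor>s / h\<rfloor>)) has_integral (\<Sum>i<j. h * q i)) {0..real j * h}"
proof (induction j)
  case (Suc j)
  have "((\<lambda>s. q (nat \<lfloor>s / h\<rfloor>)) has_integral (real (Suc j) * h - real j * h) *\<^sub>R q j) {real j * h..real (Suc j) * h}"
  proof (rule has_integral_spike_finite[of "{real (Suc j) * h}" _ _ "\<lambda>_. q j"])
    show "((\<lambda>_. q j) has_integral (real (Suc j) * h - real j * h) *\<^sub>R q j) {real j * h..real (Suc j) * h}"
      using has_integral_const_real[of "q j" "real j * h" "real (Suc j) * h"] h
      by (simp add: mult_right_mono)
    fix s assume s: "s \<in> {real j * h..real (Suc j) * h} - {real (Suc j) * h}"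
    hence "real j \<le> s / h" "s / h < real (Suc j)" using h by (auto simp: pos_le_divide_eq pos_divide_less_eq)
    hence "\<lfloor>s / h\<rfloor> = int j" by (intro floor_unique) auto
    thus "q (nat \<lfloor>s / h\<rfloor>) = q j" by simp
  qed simp
  from has_integral_combine[OF _ _ Suc.IH this] h
  have "((\<lambda>s. q (nat \<lfloor>s / h\<rfloor>)) has_integral (\<Sum>i<j. h * q i) + (real (Suc j) * h - real j * h) *\<^sub>R q j) {0..real (Suc j) * h}"
    by simp
  thus ?case by (simp add: algebra_simps)
qed (use has_integral_null_real[of 0 0] in simp)

text \<open>Linear in the second size, so that the tail of a loss sum is controlled by the tail of
  the mass.\<close>

lemma (in coag_kernel) k_le_linear:
  assumes "\<alpha> \<noteq> 0" "\<beta> \<noteq> 0"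
  shows "k \<alpha> \<beta> \<le> C2 * sz \<alpha> powr (\<gamma> + pp) * sz \<beta>"
proof -
  have "sz \<beta> powr (\<gamma> + pp) \<le> sz \<beta> powr 1"
    using sz_ge_1[OF assms(2)] pp_less by (intro powr_mono) auto
  hence "C2 * sz \<alpha> powr (\<gamma> + pp) * sz \<beta> powr (\<gamma> + pp) \<le> C2 * sz \<alpha> powr (\<gamma> + pp) * sz \<beta>"
    using C2_pos by (intro mult_left_mono) auto
  with k_upper_product[OF assms] show ?thesis by (simp add: mult.assoc)
qed

section \<open>Interpolation in time and a convergent subsequence\<close>

context coag_data
begin

definition tidx :: "nat \<Rightarrow> real \<Rightarrow> nat"
  where "tidx N t = nat \<lfloor>t / step N\<rfloor>"

definition approx :: "nat \<Rightarrow> real \<Rightarrow> nat ^ 'd \<Rightarrow> real"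
  where "approx N t = euler N (tidx N t)"

lemma tidx_le: "0 \<le> t \<Longrightarrow> real (tidx N t) * step N \<le> t"
  and tidx_gt: "t - step N < real (tidx N t) * step N"
proof -
  have h: "0 < step N" by (rule step_pos)
  show "real (tidx N t) * step N \<le> t" if "0 \<le> t"
  proof -
    have "real (tidx N t) \<le> t / step N" using that h by (simp add: tidx_def)
    thus ?thesis using h by (simp add: pos_le_divide_eq)
  qed
  have "t / step N - 1 < real (tidx N t)" unfolding tidx_def by linarith
  hence "(t / step N - 1) * step N < real (tidx N t) * step N" using h by (intro mult_strict_right_mono)
  thus "t - step N < real (tidx N t) * step N" using h by (simp add: algebra_simps)
qed

lemma approx_nonneg: "0 \<le> approx N t \<alpha>"
  by (simp add: approx_def euler_nonneg)

lemma mom_approx: "mom N \<phi> (tidx N t) = (\<Sum>\<alpha>\<in>lat N. \<phi> \<alpha> * approx N t \<alpha>)"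
  by (simp add: mom_def approx_def)

lemma euler_le_m0: "euler N j \<alpha> \<le> m0"
proof (cases "\<alpha> \<in> lat N")
  case True
  have "1 * euler N j \<alpha> \<le> sz \<alpha> * euler N j \<alpha>"
    using True sz_ge_1[of \<alpha>] by (intro mult_right_mono euler_nonneg) (auto simp: lat_def)
  also have "\<dots> \<le> mom N sz j" unfolding mom_def
    using True by (intro member_le_sum[of \<alpha>]) (auto simp: euler_nonneg)
  finally show ?thesis using massN_le[of N] by (simp add: mom_mass)
qed (use euler_outside m0_pos in auto)

text \<open>Independent of N and of the time, hence a common Lipschitz constant for the component
  \<alpha>: the gain involves finitely many components, each at most \<open>m0\<close>, and the loss
  is controlled by the mass.\<close>

definition rate_bound :: "nat ^ 'd \<Rightarrow> real"
  where "rate_bound \<alpha> = 1 / 2 * (\<Sum>(\<beta>, \<beta>')\<in>splits \<alpha>. k \<beta> \<beta>' * m0 * m0) + m0 * (C2 * sz \<alpha> powr (\<gamma> + pp) * m0)"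

lemma rate_bound:
  assumes "\<alpha> \<noteq> 0"
  shows "\<bar>coag_rate N (cut N k) (euler N j) \<alpha>\<bar> \<le> rate_bound \<alpha>"
proof -
  let ?u = "euler N j"
  have g0: "0 \<le> (\<Sum>(\<beta>, \<beta>')\<in>splits \<alpha>. cut N k \<beta> \<beta>' * ?u \<beta> * ?u \<beta>')"
    by (intro sum_nonneg) (auto simp: splits_def cut_nonneg euler_nonneg)
  have g1: "(\<Sum>(\<beta>, \<beta>')\<in>splits \<alpha>. cut N k \<beta> \<beta>' * ?u \<beta> * ?u \<beta>') \<le> (\<Sum>(\<beta>, \<beta>')\<in>splits \<alpha>. k \<beta> \<beta>' * m0 * m0)"
    using m0_pos
    by (intro sum_mono) (auto simp: splits_def intro!: mult_mono mult_nonneg_nonneg cut_le k_nonneg euler_le_m0 euler_nonneg cut_nonneg)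
  have l0: "0 \<le> (\<Sum>\<beta>\<in>lat N. cut N k \<alpha> \<beta> * ?u \<beta>)"
    using assms by (intro sum_nonneg mult_nonneg_nonneg cut_nonneg euler_nonneg) (auto simp: lat_def)
  have "(\<Sum>\<beta>\<in>lat N. cut N k \<alpha> \<beta> * ?u \<beta>) \<le> (\<Sum>\<beta>\<in>lat N. C2 * sz \<alpha> powr (\<gamma> + pp) * sz \<beta> * ?u \<beta>)"
    using assms by (intro sum_mono mult_right_mono euler_nonneg order_trans[OF cut_le k_le_linear]) (auto simp: lat_def)
  also have "\<dots> = C2 * sz \<alpha> powr (\<gamma> + pp) * mom N sz j" by (simp only: mom_def sum_distrib_left mult.assoc)
  also have "\<dots> \<le> C2 * sz \<alpha> powr (\<gamma> + pp) * m0" using massN_le C2_pos by (intro mult_left_mono) (auto simp: mom_mass)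
  finally have l1: "(\<Sum>\<beta>\<in>lat N. cut N k \<alpha> \<beta> * ?u \<beta>) \<le> C2 * sz \<alpha> powr (\<gamma> + pp) * m0" .
  have "?u \<alpha> * (\<Sum>\<beta>\<in>lat N. cut N k \<alpha> \<beta> * ?u \<beta>) \<le> m0 * (C2 * sz \<alpha> powr (\<gamma> + pp) * m0)"
    using l0 m0_pos by (intro mult_mono euler_le_m0 l1) auto
  moreover have "0 \<le> ?u \<alpha> * (\<Sum>\<beta>\<in>lat N. cut N k \<alpha> \<beta> * ?u \<beta>)" by (intro mult_nonneg_nonneg euler_nonneg l0)
  moreover have "0 \<le> m0 * (C2 * sz \<alpha> powr (\<gamma> + pp) * m0)" using m0_pos C2_pos by simp
  ultimately show ?thesis using g0 g1 unfolding coag_rate_def rate_bound_def by linarith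
qed

lemma rate_bound_nonneg: "\<alpha> \<noteq> 0 \<Longrightarrow> 0 \<le> rate_bound \<alpha>"
  using rate_bound[of \<alpha> 0 0] by linarith

lemma euler_increment:
  assumes "\<alpha> \<noteq> 0"
  shows "\<bar>euler N (j + i) \<alpha> - euler N j \<alpha>\<bar> \<le> real i * step N * rate_bound \<alpha>"
proof (induction i)
  case (Suc i)
  have "\<bar>euler N (j + Suc i) \<alpha> - euler N (j + i) \<alpha>\<bar> \<le> step N * rate_bound \<alpha>"
    using rate_bound[OF assms, of N "j + i"] step_pos[of N] by (simp add: abs_mult)
  with Suc show ?case by (simp add: algebra_simps)
qed simp

text \<open>Equicontinuity in time up to one step, which accounts for the jumps of the piecewise
  constant interpolation.\<close>

lemma approx_increment:
  assumes "\<alpha> \<noteq> 0" "0 \<le> s" "0 \<le> t"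
  shows "\<bar>approx N t \<alpha> - approx N s \<alpha>\<bar> \<le> rate_bound \<alpha> * (\<bar>t - s\<bar> + step N)"
proof -
  have *: "\<bar>approx N t \<alpha> - approx N s \<alpha>\<bar> \<le> rate_bound \<alpha> * (\<bar>t - s\<bar> + step N)" if "0 \<le> s" "s \<le> t" for s t
  proof -
    have "tidx N s \<le> tidx N t" unfolding tidx_def
      using that step_pos[of N] by (intro nat_mono floor_mono divide_right_mono) auto
    then obtain i where i: "tidx N t = tidx N s + i" using le_Suc_ex by blast
    have "\<bar>approx N t \<alpha> - approx N s \<alpha>\<bar> \<le> real i * step N * rate_bound \<alpha>"
      unfolding approx_def i by (rule euler_increment[OF assms(1)])
    also have "real i * step N \<le> \<bar>t - s\<bar> + step N"
    proof -
      have "real i * step N = real (tidx N t) * step N - real (tidx N s) * step N" using i by (simp add: algebra_simps)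
      thus ?thesis using tidx_le[of t N] tidx_gt[of s N] that by linarith
    qed
    finally show ?thesis using rate_bound_nonneg[OF assms(1)] by (simp add: mult.commute mult_right_mono)
  qed
  show ?thesis using *[of s t] *[of t s] assms by (cases "s \<le> t") (auto simp: abs_minus_commute)
qed

text \<open>Arzela-Ascoli by components: a diagonal subsequence converges at all indices and all
  rational times, and \<open>approx_increment\<close> with vanishing steps extends the convergence
  to every time.\<close>

lemma approx_limit:
  obtains \<sigma> :: "nat \<Rightarrow> nat" and sol :: "nat ^ 'd \<Rightarrow> real \<Rightarrow> real" where "strict_mono \<sigma>"
    "\<And>\<alpha> t. \<alpha> \<noteq> 0 \<Longrightarrow> 0 \<le> t \<Longrightarrow> (\<lambda>i. approx (\<sigma> i) t \<alpha>) \<longlonglongrightarrow> sol \<alpha> t" "\<And>t. sol 0 t = n0 0"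
proof -
  define f where "f N x = approx N (of_rat (snd x)) (fst x)" for N :: nat and x :: "(nat ^ 'd) \<times> rat"
  have bound: "norm (f N x) \<le> m0" for N x
    by (simp add: f_def approx_def euler_le_m0 euler_nonneg)
  obtain \<sigma> where \<sigma>: "strict_mono (\<sigma> :: nat \<Rightarrow> nat)" "\<And>x. \<exists>l. (\<lambda>n. f (\<sigma> n) x) \<longlonglongrightarrow> l"
  proof (rule function_convergent_subsequence[of "UNIV :: ((nat ^ 'd) \<times> rat) set" f m0])
    show "countable (UNIV :: ((nat ^ 'd) \<times> rat) set)" by (rule countableI_type)
  qed (use bound in auto)
  have h0: "(\<lambda>i. step (\<sigma> i)) \<longlonglongrightarrow> 0"
    using LIMSEQ_subseq_LIMSEQ[OF step_tendsto \<sigma>(1)] by (simp add: o_def)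
  have conv: "convergent (\<lambda>i. approx (\<sigma> i) t \<alpha>)" if a: "\<alpha> \<noteq> 0" and t: "0 \<le> t" for \<alpha> t
  proof (rule Cauchy_convergent[OF metric_CauchyI])
    fix e :: real assume e: "0 < e"
    define L where "L = rate_bound \<alpha> + 1"
    have L: "0 < L" "rate_bound \<alpha> \<le> L" using rate_bound_nonneg[OF a] by (auto simp: L_def)
    obtain q where q: "t < of_rat q" "of_rat q < t + e / (6 * L)"
      using of_rat_dense[of t "t + e / (6 * L)"] e L by auto
    have "Cauchy (\<lambda>i. approx (\<sigma> i) (of_rat q) \<alpha>)"
      using \<sigma>(2)[of "(\<alpha>, q)"] by (auto simp: f_def intro: LIMSEQ_imp_Cauchy)
    then obtain M1 where M1: "\<And>m n. m \<ge> M1 \<Longrightarrow> n \<ge> M1 \<Longrightarrow>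
        dist (approx (\<sigma> m) (of_rat q) \<alpha>) (approx (\<sigma> n) (of_rat q) \<alpha>) < e / 3"
      using e unfolding Cauchy_def by (metis divide_pos_pos zero_less_numeral)
    have "0 < e / (6 * L)" using e L by simp
    from order_tendstoD(2)[OF h0 this] obtain M2 where M2: "\<And>m. m \<ge> M2 \<Longrightarrow> step (\<sigma> m) < e / (6 * L)"
      by (auto simp: eventually_sequentially)
    have near: "\<bar>approx (\<sigma> m) (of_rat q) \<alpha> - approx (\<sigma> m) t \<alpha>\<bar> < e / 3" if "m \<ge> M2" for m
    proof -
      have "\<bar>approx (\<sigma> m) (of_rat q) \<alpha> - approx (\<sigma> m) t \<alpha>\<bar> \<le> rate_bound \<alpha> * (\<bar>of_rat q - t\<bar> + step (\<sigma> m))"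
        using q t by (intro approx_increment a) linarith+
      also have "\<dots> \<le> L * (\<bar>of_rat q - t\<bar> + step (\<sigma> m))"
        using L step_pos[of "\<sigma> m"] by (intro mult_right_mono) auto
      also have "\<dots> < L * (e / (6 * L) + e / (6 * L))"
        using q M2[OF that] L by (intro mult_strict_left_mono) auto
      also have "\<dots> = e / 3" using L by (simp add: field_simps)
      finally show ?thesis .
    qed
    have "dist (approx (\<sigma> m) t \<alpha>) (approx (\<sigma> n) t \<alpha>) < e" if "m \<ge> max M1 M2" "n \<ge> max M1 M2" for m n
      using M1[of m n] near[of m] near[of n] that unfolding dist_real_def by linarith
    thus "\<exists>M. \<forall>m\<ge>M. \<forall>n\<ge>M. dist (approx (\<sigma> m) t \<alpha>) (approx (\<sigma> n) t \<alpha>) < e" by blast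
  qed
  define sol where "sol \<alpha> t = (if \<alpha> = 0 then n0 0 else lim (\<lambda>i. approx (\<sigma> i) t \<alpha>))" for \<alpha> t
  show thesis
  proof (rule that[OF \<sigma>(1)])
    show "(\<lambda>i. approx (\<sigma> i) t \<alpha>) \<longlonglongrightarrow> sol \<alpha> t" if "\<alpha> \<noteq> 0" "0 \<le> t" for \<alpha> t
      using convergent_LIMSEQ_iff[THEN iffD1, OF conv[OF that]] that by (simp add: sol_def)
  qed (simp add: sol_def)
qed

end

text \<open>The value at the index \<open>0\<close> is irrelevant; this choice makes \<open>sol\<close> start exactly at \<open>n0\<close>.\<close>

locale coag_limit = coag_data k c1 c2 \<gamma> p n0
  for k :: "nat ^ 'd \<Rightarrow> nat ^ 'd \<Rightarrow> real" and c1 c2 \<gamma> p n0 +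
  fixes \<sigma> :: "nat \<Rightarrow> nat" and sol :: "nat ^ 'd \<Rightarrow> real \<Rightarrow> real"
  assumes subseq: "strict_mono \<sigma>"
    and sol_lim: "\<alpha> \<noteq> 0 \<Longrightarrow> 0 \<le> t \<Longrightarrow> (\<lambda>i. approx (\<sigma> i) t \<alpha>) \<longlonglongrightarrow> sol \<alpha> t"
    and sol_at_0: "sol 0 t = n0 0"
begin

lemma subseq_eventually: "(\<And>N. N0 \<le> N \<Longrightarrow> P N) \<Longrightarrow> \<forall>\<^sub>F i in sequentially. P (\<sigma> i)"
  unfolding eventually_sequentially using seq_suble[OF subseq] by (meson le_trans)

lemma step_subseq: "(\<lambda>i. step (\<sigma> i)) \<longlonglongrightarrow> 0"
  using LIMSEQ_subseq_LIMSEQ[OF step_tendsto subseq] by (simp add: o_def)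

lemma sol_nonneg: "\<alpha> \<noteq> 0 \<Longrightarrow> 0 \<le> t \<Longrightarrow> 0 \<le> sol \<alpha> t"
  by (rule LIMSEQ_le_const[OF sol_lim]) (auto simp: approx_nonneg)

lemma sol_init: "sol \<alpha> 0 = n0 \<alpha>"
proof (cases "\<alpha> = 0")
  case False
  obtain N0 :: nat where "sz \<alpha> \<le> real N0" using real_arch_simple by blast
  hence "\<forall>\<^sub>F i in sequentially. approx (\<sigma> i) 0 \<alpha> = n0 \<alpha>"
    using False by (intro subseq_eventually[of N0]) (auto simp: approx_def tidx_def lat_def)
  hence "(\<lambda>i. approx (\<sigma> i) 0 \<alpha>) \<longlonglongrightarrow> n0 \<alpha>" by (rule tendsto_eventually)
  thus ?thesis using sol_lim[OF False, of 0] LIMSEQ_unique by simp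
qed (simp add: sol_at_0)

lemma sol_lipschitz:
  assumes "\<alpha> \<noteq> 0" "0 \<le> s" "0 \<le> t"
  shows "\<bar>sol \<alpha> t - sol \<alpha> s\<bar> \<le> rate_bound \<alpha> * \<bar>t - s\<bar>"
proof (rule LIMSEQ_le)
  show "(\<lambda>i. \<bar>approx (\<sigma> i) t \<alpha> - approx (\<sigma> i) s \<alpha>\<bar>) \<longlonglongrightarrow> \<bar>sol \<alpha> t - sol \<alpha> s\<bar>"
    using assms by (intro tendsto_intros sol_lim)
  have "(\<lambda>i. rate_bound \<alpha> * (\<bar>t - s\<bar> + step (\<sigma> i))) \<longlonglongrightarrow> rate_bound \<alpha> * (\<bar>t - s\<bar> + 0)"
    by (intro tendsto_intros step_subseq)
  thus "(\<lambda>i. rate_bound \<alpha> * (\<bar>t - s\<bar> + step (\<sigma> i))) \<longlonglongrightarrow> rate_bound \<alpha> * \<bar>t - s\<bar>" by simp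
qed (use approx_increment assms in blast)

lemma sol_continuous: "\<alpha> \<noteq> 0 \<Longrightarrow> continuous_on {0..} (sol \<alpha>)"
proof -
  assume a: "\<alpha> \<noteq> 0"
  have "(rate_bound \<alpha>)-lipschitz_on {0..} (sol \<alpha>)"
    using sol_lipschitz[OF a] rate_bound_nonneg[OF a] by (intro lipschitz_onI) (auto simp: dist_real_def)
  thus ?thesis by (rule lipschitz_on_continuous_on)
qed

text \<open>Fatou's lemma for nonnegative test sums: a finite set of indices involves finitely many
  limits, and a bound that holds eventually along the subsequence survives.\<close>

lemma sum_sol_le:
  assumes F: "finite F" "F \<subseteq> nonzero_indices" and t: "0 \<le> t" and \<phi>: "\<And>\<alpha>. \<alpha> \<noteq> 0 \<Longrightarrow> 0 \<le> \<phi> \<alpha>"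
    and bound: "\<forall>\<^sub>F i in sequentially. mom (\<sigma> i) \<phi> (tidx (\<sigma> i) t) \<le> B"
  shows "(\<Sum>\<alpha>\<in>F. \<phi> \<alpha> * sol \<alpha> t) \<le> B"
proof (rule tendsto_upperbound)
  show "(\<lambda>i. \<Sum>\<alpha>\<in>F. \<phi> \<alpha> * approx (\<sigma> i) t \<alpha>) \<longlonglongrightarrow> (\<Sum>\<alpha>\<in>F. \<phi> \<alpha> * sol \<alpha> t)"
    using F t by (intro tendsto_intros sol_lim) auto
  have le: "(\<Sum>\<alpha>\<in>F. \<phi> \<alpha> * approx N t \<alpha>) \<le> mom N \<phi> (tidx N t)" for N
  proof -
    have "(\<Sum>\<alpha>\<in>F. \<phi> \<alpha> * approx N t \<alpha>) \<le> (\<Sum>\<alpha>\<in>F \<union> lat N. \<phi> \<alpha> * approx N t \<alpha>)"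
      using F by (intro sum_mono2 mult_nonneg_nonneg \<phi> approx_nonneg) (auto simp: lat_def)
    also have "\<dots> = (\<Sum>\<alpha>\<in>lat N. \<phi> \<alpha> * approx N t \<alpha>)"
      using F by (intro sum.mono_neutral_right) (auto simp: approx_def euler_outside)
    finally show ?thesis by (simp only: mom_approx)
  qed
  show "\<forall>\<^sub>F i in sequentially. (\<Sum>\<alpha>\<in>F. \<phi> \<alpha> * approx (\<sigma> i) t \<alpha>) \<le> B"
    using bound by eventually_elim (use le order_trans in blast)
qed simp

lemma summable_sol:
  assumes t: "0 \<le> t" and \<phi>: "\<And>\<alpha>. \<alpha> \<noteq> 0 \<Longrightarrow> 0 \<le> \<phi> \<alpha>"
    and bound: "\<forall>\<^sub>F i in sequentially. mom (\<sigma> i) \<phi> (tidx (\<sigma> i) t) \<le> B"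
  shows "(\<lambda>\<alpha>. \<phi> \<alpha> * sol \<alpha> t) summable_on nonzero_indices"
proof (rule nonneg_bdd_above_summable_on)
  show "bdd_above (sum (\<lambda>\<alpha>. \<phi> \<alpha> * sol \<alpha> t) ` {F. F \<subseteq> nonzero_indices \<and> finite F})"
    using sum_sol_le[OF _ _ assms] by (intro bdd_aboveI2[of _ _ B]) auto
qed (use assms sol_nonneg in auto)

lemma mass_summable: "0 \<le> t \<Longrightarrow> (\<lambda>\<alpha>. sz \<alpha> * sol \<alpha> t) summable_on nonzero_indices"
  by (rule summable_sol[of _ sz m0]) (auto simp: mom_mass massN_le)

text \<open>Uniform integrability of the size over all N and all times up to T, which excludes a
  loss of mass in the limit. With T fixed, the crude tail bound tends to zero as R grows.\<close>

lemma tails_uniform: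
  assumes e: "0 < e" and T: "0 \<le> T"
  obtains R :: nat where "0 < R" "\<And>N t. 0 \<le> t \<Longrightarrow> t \<le> T \<Longrightarrow> mom N (tail R) (tidx N t) \<le> e"
proof -
  obtain A0 where A0: "0 < A0" "\<And>A. A0 \<le> A \<Longrightarrow> init_tail A \<le> e / 2" using init_tail_small[of "e / 2"] e by auto
  define D where "D = 2 * C2 * m0\<^sup>2 * T"
  have "((\<lambda>R. D * real R powr (- gap)) \<longlonglongrightarrow> D * 0)"
    using gap_pos by (intro tendsto_intros tendsto_neg_powr filterlim_real_sequentially) auto
  hence "\<forall>\<^sub>F R in sequentially. D * real R powr (- gap) < e / 2" using e by (intro order_tendstoD) auto
  moreover have "\<forall>\<^sub>F R in sequentially. max 1 A0 \<le> real R"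
    using filterlim_real_sequentially unfolding filterlim_at_top by blast
  ultimately have "\<forall>\<^sub>F R in sequentially. D * real R powr (- gap) < e / 2 \<and> max 1 A0 \<le> real R"
    by (rule eventually_conj)
  then obtain R :: nat where R: "D * real R powr (- gap) < e / 2" "1 \<le> real R" "A0 \<le> real R"
    by (auto simp: eventually_sequentially)
  show thesis
  proof
    show "0 < R" using R by simp
    fix N t assume t: "0 \<le> t" "t \<le> T"
    have "mom N (tail R) (tidx N t) \<le> init_tail R + 2 * C2 * m0\<^sup>2 * R powr (- gap) * (real (tidx N t) * step N)"
      using R by (intro tail_crude) auto
    also have "\<dots> \<le> init_tail R + 2 * C2 * m0\<^sup>2 * R powr (- gap) * T"
      using tidx_le[OF t(1), of N] t C2_pos by (intro add_left_mono mult_left_mono) auto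
    also have "\<dots> = init_tail R + D * R powr (- gap)" by (simp add: D_def)
    also have "\<dots> \<le> e" using R A0(2)[of "real R"] by linarith
    finally show "mom N (tail R) (tidx N t) \<le> e" .
  qed
qed

lemma norm_weighted_tail_le:
  fixes w :: "nat ^ 'd \<Rightarrow> 'b::real_normed_vector"
  assumes F: "finite F" "F \<subseteq> nonzero_indices" "\<And>\<alpha>. \<alpha> \<in> F \<Longrightarrow> R < sz \<alpha>" and R: "0 < R"
    and C: "0 \<le> C" "\<And>\<alpha>. \<alpha> \<noteq> 0 \<Longrightarrow> norm (w \<alpha>) \<le> C * sz \<alpha>"
    and u: "\<And>\<alpha>. \<alpha> \<in> F \<Longrightarrow> 0 \<le> u \<alpha>" and le: "(\<Sum>\<alpha>\<in>F. tail R \<alpha> * u \<alpha>) \<le> e"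
  shows "norm (\<Sum>\<alpha>\<in>F. u \<alpha> *\<^sub>R w \<alpha>) \<le> C * (2 * e)"
proof -
  have "norm (\<Sum>\<alpha>\<in>F. u \<alpha> *\<^sub>R w \<alpha>) \<le> (\<Sum>\<alpha>\<in>F. C * (2 * (tail R \<alpha> * u \<alpha>)))"
  proof (rule sum_norm_le)
    fix \<alpha> assume a: "\<alpha> \<in> F"
    have "norm (w \<alpha>) \<le> C * sz \<alpha>" using a F(2) by (intro C(2)) auto
    also have "\<dots> \<le> C * (2 * tail R \<alpha>)" using F(3)[OF a] R C by (intro mult_left_mono le_two_tail) auto
    finally have "u \<alpha> * norm (w \<alpha>) \<le> u \<alpha> * (C * (2 * tail R \<alpha>))" using u[OF a] by (rule mult_left_mono)
    thus "norm (u \<alpha> *\<^sub>R w \<alpha>) \<le> C * (2 * (tail R \<alpha> * u \<alpha>))" using u[OF a] by (simp add: mult_ac)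
  qed
  also have "\<dots> = C * (2 * (\<Sum>\<alpha>\<in>F. tail R \<alpha> * u \<alpha>))" by (simp only: sum_distrib_left)
  also have "\<dots> \<le> C * (2 * e)" using le C by (intro mult_left_mono) auto
  finally show ?thesis .
qed

lemma weighted_abs_summable:
  fixes w :: "nat ^ 'd \<Rightarrow> 'b::banach"
  assumes t: "0 \<le> t" and C: "\<And>\<alpha>. \<alpha> \<noteq> 0 \<Longrightarrow> norm (w \<alpha>) \<le> C * sz \<alpha>"
  shows "(\<lambda>\<alpha>. norm (sol \<alpha> t *\<^sub>R w \<alpha>)) summable_on nonzero_indices"
proof (rule summable_on_comparison_test[OF summable_on_cmult_right[OF mass_summable[OF t], of C]])
  fix \<alpha> :: "nat ^ 'd" assume "\<alpha> \<in> nonzero_indices"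
  hence a: "\<alpha> \<noteq> 0" by simp
  from mult_left_mono[OF C[OF a] sol_nonneg[OF a t]]
  show "norm (sol \<alpha> t *\<^sub>R w \<alpha>) \<le> C * (sz \<alpha> * sol \<alpha> t)" using sol_nonneg[OF a t] by (simp add: mult_ac)
qed simp

lemma weighted_summable:
  fixes w :: "nat ^ 'd \<Rightarrow> 'b::banach"
  assumes "0 \<le> t" "\<And>\<alpha>. \<alpha> \<noteq> 0 \<Longrightarrow> norm (w \<alpha>) \<le> C * sz \<alpha>"
  shows "(\<lambda>\<alpha>. sol \<alpha> t *\<^sub>R w \<alpha>) summable_on nonzero_indices"
  by (rule abs_summable_summable[OF weighted_abs_summable[OF assms]])

text \<open>The error is uniform in t up to T, which makes the truncated loss sums converge
  uniformly in \<open>sol_rate_continuous\<close>.\<close>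

lemma weighted_truncation:
  fixes w :: "nat ^ 'd \<Rightarrow> 'b::banach"
  assumes t: "0 \<le> t" "t \<le> T" and C: "0 \<le> C" "\<And>\<alpha>. \<alpha> \<noteq> 0 \<Longrightarrow> norm (w \<alpha>) \<le> C * sz \<alpha>"
    and R: "0 < R" "\<And>N t. 0 \<le> t \<Longrightarrow> t \<le> T \<Longrightarrow> mom N (tail R) (tidx N t) \<le> e"
  shows "norm (infsum (\<lambda>\<alpha>. sol \<alpha> t *\<^sub>R w \<alpha>) nonzero_indices - (\<Sum>\<alpha>\<in>lat R. sol \<alpha> t *\<^sub>R w \<alpha>)) \<le> C * (2 * e)"
proof (rule tendsto_upperbound)
  let ?f = "\<lambda>\<alpha>. sol \<alpha> t *\<^sub>R w \<alpha>"
  show "(\<lambda>N. norm ((\<Sum>\<alpha>\<in>lat (real N). ?f \<alpha>) - (\<Sum>\<alpha>\<in>lat R. ?f \<alpha>))) \<longlonglongrightarrow>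
      norm (infsum ?f nonzero_indices - (\<Sum>\<alpha>\<in>lat R. ?f \<alpha>))"
    using weighted_summable[OF t(1) C(2)] by (intro tendsto_intros sum_lat_tendsto)
  have "norm ((\<Sum>\<alpha>\<in>lat (real N). ?f \<alpha>) - (\<Sum>\<alpha>\<in>lat R. ?f \<alpha>)) \<le> C * (2 * e)" if "R \<le> real N" for N
  proof -
    have "(\<Sum>\<alpha>\<in>lat (real N). ?f \<alpha>) - (\<Sum>\<alpha>\<in>lat R. ?f \<alpha>) = (\<Sum>\<alpha>\<in>lat (real N) - lat R. ?f \<alpha>)"
      by (rule sum_diff[OF finite_lat lat_mono[OF that], symmetric])
    also have "norm \<dots> \<le> C * (2 * e)"
    proof (rule norm_weighted_tail_le[OF _ _ _ R(1) C])
      show "(\<Sum>\<alpha>\<in>lat (real N) - lat R. tail R \<alpha> * sol \<alpha> t) \<le> e"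
        using R t by (intro sum_sol_le) (auto simp: lat_def tail_nonneg)
    qed (use t sol_nonneg in \<open>auto simp: lat_def\<close>)
    finally show ?thesis .
  qed
  moreover have "\<forall>\<^sub>F N in sequentially. R \<le> real N"
    using filterlim_real_sequentially unfolding filterlim_at_top by blast
  ultimately show "\<forall>\<^sub>F N in sequentially. norm ((\<Sum>\<alpha>\<in>lat (real N). ?f \<alpha>) - (\<Sum>\<alpha>\<in>lat R. ?f \<alpha>)) \<le> C * (2 * e)"
    by (auto elim: eventually_mono)
qed simp

text \<open>Vitali convergence for weights of at most linear growth. The weights may vary with i
  because the loss sum carries the cutoff kernel; mass, momentum and loss rate all pass to the limit
  this way.\<close>

lemma weighted_limit:
  fixes w :: "nat \<Rightarrow> nat ^ 'd \<Rightarrow> 'b::banach"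
  assumes t: "0 \<le> t" and C: "0 \<le> C" "\<And>i \<alpha>. \<alpha> \<noteq> 0 \<Longrightarrow> norm (w i \<alpha>) \<le> C * sz \<alpha>"
    and lim: "\<And>\<alpha>. \<alpha> \<noteq> 0 \<Longrightarrow> (\<lambda>i. w i \<alpha>) \<longlonglongrightarrow> w' \<alpha>"
  shows "(\<lambda>i. \<Sum>\<alpha>\<in>lat (real (\<sigma> i)). approx (\<sigma> i) t \<alpha> *\<^sub>R w i \<alpha>) \<longlonglongrightarrow> infsum (\<lambda>\<alpha>. sol \<alpha> t *\<^sub>R w' \<alpha>) nonzero_indices"
proof (rule LIMSEQ_I)
  fix e :: real assume e: "0 < e"
  \<comment> \<open>C + 1 instead of C, since C may be zero.\<close>
  define e' where "e' = e / (6 * (C + 1))"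
  have e': "0 < e'" using e C by (simp add: e'_def)
  have Ce: "C * (2 * e') \<le> e / 3"
  proof -
    have "C * (2 * e') \<le> (C + 1) * (2 * e')" using e' by (intro mult_right_mono) auto
    also have "\<dots> = e / 3" using C by (simp add: e'_def field_simps add_nonneg_eq_0_iff)
    finally show ?thesis .
  qed
  obtain R :: nat where R: "0 < R" "\<And>N s. 0 \<le> s \<Longrightarrow> s \<le> t \<Longrightarrow> mom N (tail R) (tidx N s) \<le> e'"
    using tails_uniform[OF e' t] by blast
  have C': "norm (w' \<alpha>) \<le> C * sz \<alpha>" if "\<alpha> \<noteq> 0" for \<alpha>
    using tendsto_upperbound[OF tendsto_norm[OF lim[OF that]] always_eventually] C(2)[OF that] by auto
  have far: "norm (infsum (\<lambda>\<alpha>. sol \<alpha> t *\<^sub>R w' \<alpha>) nonzero_indices - (\<Sum>\<alpha>\<in>lat R. sol \<alpha> t *\<^sub>R w' \<alpha>)) \<le> C * (2 * e')"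
    using R by (intro weighted_truncation[OF t order.refl C(1) C']) auto
  have "(\<lambda>i. \<Sum>\<alpha>\<in>lat R. approx (\<sigma> i) t \<alpha> *\<^sub>R w i \<alpha>) \<longlonglongrightarrow> (\<Sum>\<alpha>\<in>lat R. sol \<alpha> t *\<^sub>R w' \<alpha>)"
    using t by (intro tendsto_intros sol_lim lim) (auto simp: lat_def)
  from LIMSEQ_D[OF this, of "e / 3"] e obtain i0 where
    i0: "\<And>i. i \<ge> i0 \<Longrightarrow> norm ((\<Sum>\<alpha>\<in>lat R. approx (\<sigma> i) t \<alpha> *\<^sub>R w i \<alpha>) - (\<Sum>\<alpha>\<in>lat R. sol \<alpha> t *\<^sub>R w' \<alpha>)) < e / 3" by auto
  have "norm ((\<Sum>\<alpha>\<in>lat (real (\<sigma> i)). approx (\<sigma> i) t \<alpha> *\<^sub>R w i \<alpha>) - infsum (\<lambda>\<alpha>. sol \<alpha> t *\<^sub>R w' \<alpha>) nonzero_indices) < e"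
    if "i \<ge> max i0 R" for i
  proof -
    have "real R \<le> real (\<sigma> i)" using seq_suble[OF subseq, of i] that by simp
    from sum_diff[OF finite_lat lat_mono[OF this], symmetric]
    have "(\<Sum>\<alpha>\<in>lat (real (\<sigma> i)). approx (\<sigma> i) t \<alpha> *\<^sub>R w i \<alpha>) - (\<Sum>\<alpha>\<in>lat R. approx (\<sigma> i) t \<alpha> *\<^sub>R w i \<alpha>) =
        (\<Sum>\<alpha>\<in>lat (real (\<sigma> i)) - lat R. approx (\<sigma> i) t \<alpha> *\<^sub>R w i \<alpha>)"
      .
    also have "norm \<dots> \<le> C * (2 * e')"
    proof (rule norm_weighted_tail_le[where R = "real R"])
      have "(\<Sum>\<alpha>\<in>lat (real (\<sigma> i)) - lat R. tail R \<alpha> * approx (\<sigma> i) t \<alpha>) \<le> mom (\<sigma> i) (tail R) (tidx (\<sigma> i) t)"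
        unfolding mom_approx using R by (intro sum_mono2 mult_nonneg_nonneg tail_nonneg approx_nonneg) auto
      also have "\<dots> \<le> e'" using R t by auto
      finally show "(\<Sum>\<alpha>\<in>lat (real (\<sigma> i)) - lat R. tail R \<alpha> * approx (\<sigma> i) t \<alpha>) \<le> e'" .
    qed (use R C approx_nonneg in \<open>auto simp: lat_def\<close>)
    finally have 1: "norm ((\<Sum>\<alpha>\<in>lat (real (\<sigma> i)). approx (\<sigma> i) t \<alpha> *\<^sub>R w i \<alpha>) - (\<Sum>\<alpha>\<in>lat R. approx (\<sigma> i) t \<alpha> *\<^sub>R w i \<alpha>)) \<le> e / 3"
      using Ce by linarith
    have 2: "norm ((\<Sum>\<alpha>\<in>lat R. sol \<alpha> t *\<^sub>R w' \<alpha>) - infsum (\<lambda>\<alpha>. sol \<alpha> t *\<^sub>R w' \<alpha>) nonzero_indices) \<le> e / 3"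
      using far Ce by (subst norm_minus_commute) linarith
    have 3: "norm ((\<Sum>\<alpha>\<in>lat R. approx (\<sigma> i) t \<alpha> *\<^sub>R w i \<alpha>) - (\<Sum>\<alpha>\<in>lat R. sol \<alpha> t *\<^sub>R w' \<alpha>)) < e / 3"
      using i0 that by simp
    have tri: "norm (x - z) \<le> norm (x - a) + norm (a - b) + norm (b - z)" for x z a b :: 'b
      using norm_triangle_ineq[of "x - a" "a - b"] norm_triangle_ineq[of "x - b" "b - z"] by simp
    show ?thesis
      by (rule le_less_trans[OF tri[of _ _ "\<Sum>\<alpha>\<in>lat R. approx (\<sigma> i) t \<alpha> *\<^sub>R w i \<alpha>" "\<Sum>\<alpha>\<in>lat R. sol \<alpha> t *\<^sub>R w' \<alpha>"]])
        (use 1 2 3 in linarith)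
  qed
  thus "\<exists>no. \<forall>i\<ge>no. norm ((\<Sum>\<alpha>\<in>lat (real (\<sigma> i)). approx (\<sigma> i) t \<alpha> *\<^sub>R w i \<alpha>) - infsum (\<lambda>\<alpha>. sol \<alpha> t *\<^sub>R w' \<alpha>) nonzero_indices) < e"
    by blast
qed

lemma sol_mass:
  assumes "0 \<le> t" shows "(\<Sum>\<^sub>\<infinity>\<alpha>\<in>nonzero_indices. sz \<alpha> * sol \<alpha> t) = m0"
proof -
  have "(\<lambda>i. \<Sum>\<alpha>\<in>lat (real (\<sigma> i)). approx (\<sigma> i) t \<alpha> *\<^sub>R sz \<alpha>) \<longlonglongrightarrow> infsum (\<lambda>\<alpha>. sol \<alpha> t *\<^sub>R sz \<alpha>) nonzero_indices"
    by (rule weighted_limit[OF assms, of 1]) auto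
  moreover have "(\<Sum>\<alpha>\<in>lat (real N). approx N t \<alpha> *\<^sub>R sz \<alpha>) = massN N" for N
    using mom_mass[of N "tidx N t"] by (simp add: mom_approx mult.commute)
  ultimately have "(\<lambda>i. massN (\<sigma> i)) \<longlonglongrightarrow> (\<Sum>\<^sub>\<infinity>\<alpha>\<in>nonzero_indices. sz \<alpha> * sol \<alpha> t)"
    by (simp add: mult.commute)
  moreover have "(\<lambda>i. massN (\<sigma> i)) \<longlonglongrightarrow> m0"
    using LIMSEQ_subseq_LIMSEQ[OF massN_tendsto subseq] by (simp add: o_def)
  ultimately show ?thesis by (rule LIMSEQ_unique)
qed

lemma sol_momentum:
  assumes "0 \<le> t"
  shows "(\<Sum>\<^sub>\<infinity>\<alpha>\<in>nonzero_indices. sol \<alpha> t *\<^sub>R vec_of_nat \<alpha>) = (\<Sum>\<^sub>\<infinity>\<alpha>\<in>nonzero_indices. n0 \<alpha> *\<^sub>R vec_of_nat \<alpha>)"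
proof (rule LIMSEQ_unique)
  show "(\<lambda>i. \<Sum>\<alpha>\<in>lat (real (\<sigma> i)). approx (\<sigma> i) t \<alpha> *\<^sub>R vec_of_nat \<alpha>) \<longlonglongrightarrow> (\<Sum>\<^sub>\<infinity>\<alpha>\<in>nonzero_indices. sol \<alpha> t *\<^sub>R vec_of_nat \<alpha>)"
    by (rule weighted_limit[OF assms, of 1]) (auto simp: norm_vec_of_nat_le)
  show "(\<lambda>i. \<Sum>\<alpha>\<in>lat (real (\<sigma> i)). approx (\<sigma> i) t \<alpha> *\<^sub>R vec_of_nat \<alpha>) \<longlonglongrightarrow> (\<Sum>\<^sub>\<infinity>\<alpha>\<in>nonzero_indices. n0 \<alpha> *\<^sub>R vec_of_nat \<alpha>)"
    using LIMSEQ_subseq_LIMSEQ[OF sum_lat_tendsto[OF vec_summable] subseq]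
    by (simp add: o_def approx_def sum_vec_euler)
qed

end

section \<open>The limit equation and the long-time bounds of its solution\<close>

context coag_limit
begin

definition sol_rate :: "nat ^ 'd \<Rightarrow> real \<Rightarrow> real"
  where "sol_rate \<alpha> t = 1 / 2 * (\<Sum>(\<beta>, \<beta>')\<in>splits \<alpha>. k \<beta> \<beta>' * sol \<beta> t * sol \<beta>' t)
    - sol \<alpha> t * (\<Sum>\<^sub>\<infinity>\<beta>\<in>nonzero_indices. sol \<beta> t *\<^sub>R k \<alpha> \<beta>)"

lemma loss_const_nonneg: "0 \<le> C2 * sz \<alpha> powr (\<gamma> + pp)"
  using C2_pos by simp

lemma norm_k_le: "\<alpha> \<noteq> 0 \<Longrightarrow> \<beta> \<noteq> 0 \<Longrightarrow> norm (k \<alpha> \<beta>) \<le> C2 * sz \<alpha> powr (\<gamma> + pp) * sz \<beta>"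
  using k_le_linear[of \<alpha> \<beta>] k_nonneg[of \<alpha> \<beta>] by simp

lemma cut_lim: "(\<lambda>i. cut (real (\<sigma> i)) k \<alpha> \<beta>) \<longlonglongrightarrow> k \<alpha> \<beta>"
proof -
  obtain N0 :: nat where "sz \<alpha> + sz \<beta> \<le> real N0" using real_arch_simple by blast
  hence "\<forall>\<^sub>F i in sequentially. cut (real (\<sigma> i)) k \<alpha> \<beta> = k \<alpha> \<beta>"
    by (intro subseq_eventually[of N0]) (auto simp: cut_def)
  thus ?thesis by (rule tendsto_eventually)
qed

lemma rate_limit:
  assumes a: "\<alpha> \<noteq> 0" and t: "0 \<le> t"
  shows "(\<lambda>i. coag_rate (real (\<sigma> i)) (cut (real (\<sigma> i)) k) (approx (\<sigma> i) t) \<alpha>) \<longlonglongrightarrow> sol_rate \<alpha> t"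
proof -
  have "(\<lambda>i. \<Sum>\<beta>\<in>lat (real (\<sigma> i)). approx (\<sigma> i) t \<beta> *\<^sub>R cut (real (\<sigma> i)) k \<alpha> \<beta>) \<longlonglongrightarrow>
      (\<Sum>\<^sub>\<infinity>\<beta>\<in>nonzero_indices. sol \<beta> t *\<^sub>R k \<alpha> \<beta>)"
  proof (rule weighted_limit[OF t loss_const_nonneg[of \<alpha>]])
    fix i :: nat and \<beta> :: "nat ^ 'd" assume b: "\<beta> \<noteq> 0"
    show "norm (cut (real (\<sigma> i)) k \<alpha> \<beta>) \<le> C2 * sz \<alpha> powr (\<gamma> + pp) * sz \<beta>"
      using norm_k_le[OF a b] cut_le[OF a b, of "\<sigma> i"] cut_nonneg[OF a b, of "\<sigma> i"] k_nonneg[OF a b] by simp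
  qed (rule cut_lim)
  hence loss: "(\<lambda>i. \<Sum>\<beta>\<in>lat (real (\<sigma> i)). cut (real (\<sigma> i)) k \<alpha> \<beta> * approx (\<sigma> i) t \<beta>) \<longlonglongrightarrow>
      (\<Sum>\<^sub>\<infinity>\<beta>\<in>nonzero_indices. sol \<beta> t *\<^sub>R k \<alpha> \<beta>)"
    by (simp add: mult.commute)
  have gain: "(\<lambda>i. \<Sum>(\<beta>, \<beta>')\<in>splits \<alpha>. cut (real (\<sigma> i)) k \<beta> \<beta>' * approx (\<sigma> i) t \<beta> * approx (\<sigma> i) t \<beta>') \<longlonglongrightarrow>
      (\<Sum>(\<beta>, \<beta>')\<in>splits \<alpha>. k \<beta> \<beta>' * sol \<beta> t * sol \<beta>' t)"
    unfolding case_prod_beta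
    using t by (intro tendsto_intros cut_lim sol_lim) (auto simp: splits_def)
  show ?thesis unfolding coag_rate_def sol_rate_def
    by (intro tendsto_intros gain loss sol_lim a t)
qed

text \<open>On bounded time intervals the infinite loss sum is a uniform limit of finite sums by
  \<open>tails_uniform\<close>. Continuity of the rate is what makes the integral equation
  differentiable at every positive time.\<close>

lemma sol_rate_continuous:
  assumes a: "\<alpha> \<noteq> 0" and T: "0 \<le> T"
  shows "continuous_on {0..T} (sol_rate \<alpha>)"
proof -
  have cont: "continuous_on {0..T} (sol \<beta>)" if "\<beta> \<noteq> 0" for \<beta>
    by (rule continuous_on_subset[OF sol_continuous[OF that]]) auto
  define C where "C = C2 * sz \<alpha> powr (\<gamma> + pp)"
  have C: "0 \<le> C" unfolding C_def by (rule loss_const_nonneg)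
  have "uniform_limit {0..T} (\<lambda>R t. \<Sum>\<beta>\<in>lat (real R). sol \<beta> t *\<^sub>R k \<alpha> \<beta>)
      (\<lambda>t. \<Sum>\<^sub>\<infinity>\<beta>\<in>nonzero_indices. sol \<beta> t *\<^sub>R k \<alpha> \<beta>) sequentially"
  proof (rule uniform_limitI)
    fix e :: real assume e: "0 < e"
    define e' where "e' = e / (4 * (C + 1))"
    have e': "0 < e'" using e C by (simp add: e'_def)
    have "C * (2 * e') \<le> (C + 1) * (2 * e')" using e' by (intro mult_right_mono) auto
    also have "\<dots> = e / 2" using C by (simp add: e'_def field_simps add_nonneg_eq_0_iff)
    also have "\<dots> < e" using e by simp
    finally have Ce: "C * (2 * e') < e" .
    obtain R :: nat where R: "0 < R" "\<And>N t. 0 \<le> t \<Longrightarrow> t \<le> T \<Longrightarrow> mom N (tail R) (tidx N t) \<le> e'"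
      using tails_uniform[OF e' T] by blast
    have "dist (\<Sum>\<beta>\<in>lat (real n). sol \<beta> t *\<^sub>R k \<alpha> \<beta>) (\<Sum>\<^sub>\<infinity>\<beta>\<in>nonzero_indices. sol \<beta> t *\<^sub>R k \<alpha> \<beta>) < e"
      if n: "n \<ge> R" and t: "t \<in> {0..T}" for n t
    proof -
      have "norm ((\<Sum>\<^sub>\<infinity>\<beta>\<in>nonzero_indices. sol \<beta> t *\<^sub>R k \<alpha> \<beta>) - (\<Sum>\<beta>\<in>lat (real n). sol \<beta> t *\<^sub>R k \<alpha> \<beta>)) \<le> C * (2 * e')"
      proof (rule weighted_truncation[of t T])
        show "mom N (tail (real n)) (tidx N s) \<le> e'" if "0 \<le> s" "s \<le> T" for N s
        proof -
          have "mom N (tail (real n)) (tidx N s) \<le> mom N (tail (real R)) (tidx N s)"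
            using R n by (intro mom_mono tail_antimono) auto
          thus ?thesis using R(2)[OF that, of N] by linarith
        qed
      qed (use t R n C a norm_k_le in \<open>auto simp: C_def\<close>)
      thus ?thesis using Ce by (simp add: dist_norm norm_minus_commute)
    qed
    thus "\<forall>\<^sub>F n in sequentially. \<forall>t\<in>{0..T}. dist (\<Sum>\<beta>\<in>lat (real n). sol \<beta> t *\<^sub>R k \<alpha> \<beta>)
        (\<Sum>\<^sub>\<infinity>\<beta>\<in>nonzero_indices. sol \<beta> t *\<^sub>R k \<alpha> \<beta>) < e"
      unfolding eventually_sequentially by blast
  qed
  hence loss: "continuous_on {0..T} (\<lambda>t. \<Sum>\<^sub>\<infinity>\<beta>\<in>nonzero_indices. sol \<beta> t *\<^sub>R k \<alpha> \<beta>)"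
  proof (rule uniform_limit_theorem[rotated])
    show "\<forall>\<^sub>F R in sequentially. continuous_on {0..T} (\<lambda>t. \<Sum>\<beta>\<in>lat (real R). sol \<beta> t *\<^sub>R k \<alpha> \<beta>)"
      by (intro always_eventually allI continuous_intros cont) (auto simp: lat_def)
  qed simp
  show ?thesis unfolding sol_rate_def case_prod_beta
    by (intro continuous_intros cont loss a) (auto simp: splits_def)
qed

text \<open>The Euler increments telescope to the integral of the piecewise constant rate, up to the
  last incomplete step, which contributes at most \<open>rate_bound \<alpha> * step N\<close>. The
  same bound dominates the rates in the limit.\<close>

lemma sol_integral:
  assumes a: "\<alpha> \<noteq> 0" and t: "0 \<le> t"
  shows "integral {0..t} (sol_rate \<alpha>) = sol \<alpha> t - n0 \<alpha>"
proof -
  define f where "f N s = coag_rate (real N) (cut (real N) k) (approx N s) \<alpha>" for N :: nat and s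
  have f_int: "f N integrable_on {0..t}"
    and f_val: "\<bar>integral {0..t} (f N) - (approx N t \<alpha> - approx N 0 \<alpha>)\<bar> \<le> rate_bound \<alpha> * step N" for N
  proof -
    define q where "q j = coag_rate (real N) (cut (real N) k) (euler N j) \<alpha>" for j
    have fq: "f N = (\<lambda>s. q (nat \<lfloor>s / step N\<rfloor>))" by (simp add: fun_eq_iff f_def q_def approx_def tidx_def)
    have h: "0 < step N" by (rule step_pos)
    define J where "J = tidx N t"
    have J: "real J * step N \<le> t" "t < real (Suc J) * step N" "t - step N < real J * step N"
      using tidx_le[OF t, of N] tidx_gt[of t N] by (auto simp: J_def algebra_simps)
    have "f N integrable_on {0..real (Suc J) * step N}"
      unfolding fq using step_function_integral[OF h] by blast
    thus int: "f N integrable_on {0..t}"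
      by (rule integrable_on_subinterval) (use J in auto)
    have tele: "(\<Sum>i<j. step N * q i) = euler N j \<alpha> - euler N 0 \<alpha>" for j
      by (induction j) (auto simp: q_def)
    have "integral {0..real J * step N} (f N) = approx N t \<alpha> - approx N 0 \<alpha>"
      using integral_unique[OF step_function_integral[OF h, of q J]] unfolding fq tele
      by (simp add: approx_def J_def tidx_def)
    moreover have "integral {0..real J * step N} (f N) + integral {real J * step N..t} (f N) = integral {0..t} (f N)"
      using J h by (intro Henstock_Kurzweil_Integration.integral_combine int) auto
    moreover have "norm (integral {real J * step N..t} (f N)) \<le> rate_bound \<alpha> * (t - real J * step N)"
    proof -
      have "f N integrable_on {real J * step N..t}"
        by (rule integrable_on_subinterval[OF int]) (use J h in auto)
      hence "(f N has_integral integral {real J * step N..t} (f N)) {real J * step N..t}" by blast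
      from has_integral_bound_real[OF rate_bound_nonneg[OF a] _ this, of "{}"] J rate_bound[OF a]
      show "norm (integral {real J * step N..t} (f N)) \<le> rate_bound \<alpha> * (t - real J * step N)"
        by (simp add: f_def approx_def)
    qed
    moreover have "rate_bound \<alpha> * (t - real J * step N) \<le> rate_bound \<alpha> * step N"
      using J rate_bound_nonneg[OF a] by (intro mult_left_mono) auto
    ultimately show "\<bar>integral {0..t} (f N) - (approx N t \<alpha> - approx N 0 \<alpha>)\<bar> \<le> rate_bound \<alpha> * step N" by simp
  qed
  have lim1: "(\<lambda>i. integral {0..t} (f (\<sigma> i))) \<longlonglongrightarrow> integral {0..t} (sol_rate \<alpha>)"
  proof (rule dominated_convergence(2)[of _ _ "\<lambda>_. rate_bound \<alpha>"])
    show "f (\<sigma> i) integrable_on {0..t}" for i by (rule f_int)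
    show "(\<lambda>i. f (\<sigma> i) s) \<longlonglongrightarrow> sol_rate \<alpha> s" if "s \<in> {0..t}" for s
      unfolding f_def using that by (intro rate_limit a) auto
  qed (use rate_bound[OF a] in \<open>auto simp: f_def approx_def\<close>)
  have "(\<lambda>i. integral {0..t} (f (\<sigma> i)) - (approx (\<sigma> i) t \<alpha> - approx (\<sigma> i) 0 \<alpha>)) \<longlonglongrightarrow> 0"
  proof (rule Lim_null_comparison[OF always_eventually])
    show "\<forall>i. norm (integral {0..t} (f (\<sigma> i)) - (approx (\<sigma> i) t \<alpha> - approx (\<sigma> i) 0 \<alpha>)) \<le> rate_bound \<alpha> * step (\<sigma> i)"
      using f_val by simp
    show "(\<lambda>i. rate_bound \<alpha> * step (\<sigma> i)) \<longlonglongrightarrow> 0"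
      using tendsto_mult_left[OF step_subseq, of "rate_bound \<alpha>"] by simp
  qed
  moreover have "(\<lambda>i. approx (\<sigma> i) t \<alpha> - approx (\<sigma> i) 0 \<alpha>) \<longlonglongrightarrow> sol \<alpha> t - sol \<alpha> 0"
    by (intro tendsto_intros sol_lim a t) simp
  ultimately have "(\<lambda>i. (integral {0..t} (f (\<sigma> i)) - (approx (\<sigma> i) t \<alpha> - approx (\<sigma> i) 0 \<alpha>)) + (approx (\<sigma> i) t \<alpha> - approx (\<sigma> i) 0 \<alpha>))
      \<longlonglongrightarrow> 0 + (sol \<alpha> t - sol \<alpha> 0)" by (rule tendsto_add)
  hence "(\<lambda>i. integral {0..t} (f (\<sigma> i))) \<longlonglongrightarrow> sol \<alpha> t - n0 \<alpha>" by (simp add: sol_init)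
  with lim1 show ?thesis by (rule LIMSEQ_unique)
qed

lemma sol_deriv:
  assumes a: "\<alpha> \<noteq> 0" and t: "0 < t"
  shows "(sol \<alpha> has_real_derivative sol_rate \<alpha> t) (at t)"
proof -
  have "((\<lambda>x. integral {0..x} (sol_rate \<alpha>)) has_real_derivative sol_rate \<alpha> t) (at t within {0..t + 1})"
    using t by (intro integral_has_real_derivative sol_rate_continuous a) auto
  hence "((\<lambda>x. n0 \<alpha> + integral {0..x} (sol_rate \<alpha>)) has_real_derivative sol_rate \<alpha> t) (at t within {0..t + 1})"
    by (auto intro!: derivative_eq_intros)
  hence "(sol \<alpha> has_real_derivative sol_rate \<alpha> t) (at t within {0..t + 1})"
    by (rule has_field_derivative_transform_within[of _ _ _ _ 1]) (use t a sol_integral in auto)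
  moreover have "at t within {0..t + 1} = at t" using t by (intro at_within_Icc_at) auto
  ultimately show ?thesis by simp
qed

text \<open>The two moment bounds are taken to the limit rather than \<open>window_bound\<close>
  itself, whose window moves with the discrete time \<open>real j * step N\<close>.\<close>

lemma sol_window:
  obtains C where "0 < C"
    "\<And>t \<epsilon> F. 1 \<le> t \<Longrightarrow> 0 < \<epsilon> \<Longrightarrow> \<epsilon> \<le> 1 \<Longrightarrow> finite F \<Longrightarrow> F \<subseteq> nonzero_indices \<Longrightarrow>
      (\<Sum>\<alpha>\<in>{\<alpha>\<in>F. \<not> (\<epsilon> * t powr (1 / (1 - \<gamma>)) \<le> sz \<alpha> \<and> sz \<alpha> \<le> t powr (1 / (1 - \<gamma>)) / \<epsilon>)}. sz \<alpha> * sol \<alpha> t)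
      \<le> C * (\<epsilon> powr ((1 - \<gamma>) / 2) + \<epsilon> powr gap) + 2 * init_tail (t powr (1 / (1 - \<gamma>)))"
proof -
  define s where "s = (1 - \<gamma>) / 2"
  have s: "0 < s" "s < 1 - \<gamma>" using \<gamma> by (auto simp: s_def)
  obtain C1 where C1: "0 < C1" "\<And>T. \<exists>N0. \<forall>N\<ge>N0. \<forall>j. real j * step N \<le> T \<longrightarrow>
      mom N (\<lambda>\<alpha>. sz \<alpha> powr (1 - s)) j \<le> C1 * (1 + real j * step N) powr (- (s / (1 - \<gamma>)))"
    using moment_decay[OF s] by blast
  obtain C' where C': "0 < C'" "\<And>T. \<exists>N0. \<forall>N\<ge>N0. \<forall>j. real j * step N \<le> T \<longrightarrow> (\<forall>A>0.
      mom N (tail A) j \<le> init_tail A + C' * A powr (- gap) * (real j * step N) powr (gap / (1 - \<gamma>)))"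
    using tail_sharp by blast
  define C where "C = max C1 (2 * C')"
  show thesis
  proof
    show "0 < C" using C1 by (simp add: C_def)
    fix t \<epsilon> :: real and F :: "(nat ^ 'd) set"
    assume t: "1 \<le> t" and \<epsilon>: "0 < \<epsilon>" "\<epsilon> \<le> 1" and F: "finite F" "F \<subseteq> nonzero_indices"
    have t0: "0 \<le> t" using t by simp
    have low: "(\<Sum>\<alpha>\<in>F. sz \<alpha> powr (1 - s) * sol \<alpha> t) \<le> C1 * t powr (- (s / (1 - \<gamma>)))"
    proof (rule sum_sol_le[OF F t0])
      obtain N0 where N0: "\<And>N j. N \<ge> N0 \<Longrightarrow> real j * step N \<le> t \<Longrightarrow>
        mom N (\<lambda>\<alpha>. sz \<alpha> powr (1 - s)) j \<le> C1 * (1 + real j * step N) powr (- (s / (1 - \<gamma>)))"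
        using C1(2)[of t] by blast
      show "\<forall>\<^sub>F i in sequentially. mom (\<sigma> i) (\<lambda>\<alpha>. sz \<alpha> powr (1 - s)) (tidx (\<sigma> i) t) \<le> C1 * t powr (- (s / (1 - \<gamma>)))"
      proof (rule subseq_eventually)
        fix N assume "N0 \<le> N"
        hence "mom N (\<lambda>\<alpha>. sz \<alpha> powr (1 - s)) (tidx N t) \<le> C1 * (1 + real (tidx N t) * step N) powr (- (s / (1 - \<gamma>)))"
          by (rule N0[OF _ tidx_le[OF t0]])
        \<comment> \<open>Steps are at most 1, so 1 plus the discrete time is at least t.\<close>
        also have "\<dots> \<le> C1 * t powr (- (s / (1 - \<gamma>)))"
          using C1 t s \<gamma> tidx_gt[of t N] step_le_1[of N] by (intro mult_left_mono powr_mono2') auto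
        finally show "mom N (\<lambda>\<alpha>. sz \<alpha> powr (1 - s)) (tidx N t) \<le> C1 * t powr (- (s / (1 - \<gamma>)))" .
      qed
    qed simp
    have up: "(\<Sum>\<alpha>\<in>F. tail A \<alpha> * sol \<alpha> t) \<le> init_tail A + C' * A powr (- gap) * t powr (gap / (1 - \<gamma>))" if A: "0 < A" for A
    proof (rule sum_sol_le[OF F t0 tail_nonneg[OF A]])
      obtain N0 where N0: "\<And>N j A. N \<ge> N0 \<Longrightarrow> real j * step N \<le> t \<Longrightarrow> 0 < A \<Longrightarrow>
        mom N (tail A) j \<le> init_tail A + C' * A powr (- gap) * (real j * step N) powr (gap / (1 - \<gamma>))"
        using C'(2)[of t] by blast
      show "\<forall>\<^sub>F i in sequentially. mom (\<sigma> i) (tail A) (tidx (\<sigma> i) t) \<le> init_tail A + C' * A powr (- gap) * t powr (gap / (1 - \<gamma>))"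
      proof (rule subseq_eventually)
        fix N assume "N0 \<le> N"
        hence "mom N (tail A) (tidx N t) \<le> init_tail A + C' * A powr (- gap) * (real (tidx N t) * step N) powr (gap / (1 - \<gamma>))"
          by (rule N0[OF _ tidx_le[OF t0] A])
        also have "\<dots> \<le> init_tail A + C' * A powr (- gap) * t powr (gap / (1 - \<gamma>))"
          using C' gap_pos \<gamma> step_pos[of N] tidx_le[OF t0, of N] by (intro add_left_mono mult_left_mono powr_mono2) auto
        finally show "mom N (tail A) (tidx N t) \<le> init_tail A + C' * A powr (- gap) * t powr (gap / (1 - \<gamma>))" .
      qed
    qed
    have "(\<Sum>\<alpha>\<in>{\<alpha>\<in>F. \<not> (\<epsilon> * t powr (1 / (1 - \<gamma>)) \<le> sz \<alpha> \<and> sz \<alpha> \<le> t powr (1 / (1 - \<gamma>)) / \<epsilon>)}. sz \<alpha> * sol \<alpha> t)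
        \<le> C1 * \<epsilon> powr s + 2 * (init_tail (t powr (1 / (1 - \<gamma>))) + C' * \<epsilon> powr gap)"
      using F sol_nonneg[OF _ t0] by (intro window_from_moments[OF F(1) _ t \<epsilon> s(1) low up]) auto
    moreover have "C1 * \<epsilon> powr s + 2 * C' * \<epsilon> powr gap \<le> C * \<epsilon> powr s + C * \<epsilon> powr gap"
      by (intro add_mono mult_right_mono) (auto simp: C_def)
    ultimately show "(\<Sum>\<alpha>\<in>{\<alpha>\<in>F. \<not> (\<epsilon> * t powr (1 / (1 - \<gamma>)) \<le> sz \<alpha> \<and> sz \<alpha> \<le> t powr (1 / (1 - \<gamma>)) / \<epsilon>)}. sz \<alpha> * sol \<alpha> t)
      \<le> C * (\<epsilon> powr ((1 - \<gamma>) / 2) + \<epsilon> powr gap) + 2 * init_tail (t powr (1 / (1 - \<gamma>)))"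
      unfolding s_def[symmetric] by (simp only: distrib_left mult.assoc)
  qed
qed

lemma sol_spread:
  assumes "0 < \<eta>"
  obtains T1 where "0 \<le> T1"
    "\<And>t F. T1 \<le> t \<Longrightarrow> finite F \<Longrightarrow> F \<subseteq> nonzero_indices \<Longrightarrow> (\<Sum>\<alpha>\<in>F. spread theta0 \<alpha> * sol \<alpha> t) \<le> \<eta>"
proof -
  obtain T1 where T1: "\<And>T. \<exists>N0. \<forall>N\<ge>N0. \<forall>j. T1 \<le> real j * step N \<longrightarrow> real j * step N \<le> T \<longrightarrow>
      mom N (spread theta0) j \<le> 6 * (\<eta> / 6)"
    using spread_decay[of "\<eta> / 6"] assms by auto
  show thesis
  proof
    fix t and F :: "(nat ^ 'd) set"
    \<comment> \<open>One unit later than T1, because the discrete time may lag behind t by up to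
      one step.\<close>
    assume t: "max 0 (T1 + 1) \<le> t" and F: "finite F" "F \<subseteq> nonzero_indices"
    have t0: "0 \<le> t" using t by simp
    obtain N0 where N0: "\<And>N j. N \<ge> N0 \<Longrightarrow> T1 \<le> real j * step N \<Longrightarrow> real j * step N \<le> t \<Longrightarrow>
        mom N (spread theta0) j \<le> \<eta>"
      using T1[of t] by auto
    show "(\<Sum>\<alpha>\<in>F. spread theta0 \<alpha> * sol \<alpha> t) \<le> \<eta>"
    proof (rule sum_sol_le[OF F t0 spread_nonneg subseq_eventually])
      fix N assume "N0 \<le> N"
      moreover have "T1 \<le> real (tidx N t) * step N" using tidx_gt[of t N] step_le_1[of N] t by linarith
      ultimately show "mom N (spread theta0) (tidx N t) \<le> \<eta>" by (rule N0[OF _ _ tidx_le[OF t0]])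
    qed
  qed simp
qed

end

section \<open>Atomic measures on the lattice\<close>

abbreviation RB :: "(real ^ 'd) measure"
  where "RB \<equiv> restrict_space borel Rstar"

lemma space_atomic [simp]: "space (atomic_measure c) = Rstar"
  by (simp add: atomic_measure_def space_restrict_space)

lemma sets_atomic [simp, measurable_cong]: "sets (atomic_measure c) = sets RB"
  by (simp add: atomic_measure_def)

lemma vec_of_nat_measurable: "vec_of_nat \<in> measurable (point_measure nonzero_indices c) RB"
  by (auto simp: space_restrict_space vec_of_nat_in_Rstar)

lemma nn_integral_atomic:
  assumes g: "g \<in> borel_measurable RB"
  shows "(\<integral>\<^sup>+x. g x \<partial>atomic_measure c) = (\<integral>\<^sup>+\<alpha>. ennreal (c \<alpha>) * g (vec_of_nat \<alpha>) \<partial>count_space nonzero_indices)"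
  unfolding atomic_measure_def
  by (subst nn_integral_distr[OF vec_of_nat_measurable])
    (use g in \<open>simp_all add: point_measure_def nn_integral_density\<close>)

lemma
  fixes g :: "real ^ 'd \<Rightarrow> 'b::{banach, second_countable_topology}"
  assumes g: "g \<in> borel_measurable RB" and c: "\<And>\<alpha>. \<alpha> \<noteq> 0 \<Longrightarrow> 0 \<le> c \<alpha>"
    and summable: "(\<lambda>\<alpha>. norm (c \<alpha> *\<^sub>R g (vec_of_nat \<alpha>))) summable_on nonzero_indices"
  shows integrable_atomic: "integrable (atomic_measure c) g"
    and integral_atomic: "(\<integral>x. g x \<partial>atomic_measure c) = (\<Sum>\<^sub>\<infinity>\<alpha>\<in>nonzero_indices. c \<alpha> *\<^sub>R g (vec_of_nat \<alpha>))"
proof -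
  let ?f = "\<lambda>\<alpha>. c \<alpha> *\<^sub>R g (vec_of_nat \<alpha>)"
  have s: "Infinite_Set_Sum.abs_summable_on ?f nonzero_indices"
    using summable by (simp only: abs_summable_equivalent)
  hence int: "integrable (count_space nonzero_indices) ?f" by (simp add: abs_summable_on_def)
  have AE: "AE \<alpha> in count_space nonzero_indices. 0 \<le> c \<alpha>" using c by (simp add: AE_count_space)
  show "integrable (atomic_measure c) g"
    unfolding atomic_measure_def integrable_distr_eq[OF vec_of_nat_measurable g]
    unfolding point_measure_def using int AE by (subst integrable_density) simp_all
  have "(\<integral>x. g x \<partial>atomic_measure c) = (\<integral>\<alpha>. ?f \<alpha> \<partial>count_space nonzero_indices)"
    unfolding atomic_measure_def integral_distr[OF vec_of_nat_measurable g]
    unfolding point_measure_def using AE by (subst integral_density) simp_all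
  also have "\<dots> = (\<Sum>\<^sub>\<infinity>\<alpha>\<in>nonzero_indices. ?f \<alpha>)"
    using infsetsum_infsum[OF s] by (simp add: infsetsum_def)
  finally show "(\<integral>x. g x \<partial>atomic_measure c) = (\<Sum>\<^sub>\<infinity>\<alpha>\<in>nonzero_indices. ?f \<alpha>)" .
qed

lemma
  fixes g :: "real ^ 'd \<Rightarrow> 'b::{banach, second_countable_topology}"
  assumes g: "g \<in> borel_measurable RB" and c: "\<And>\<alpha>. \<alpha> \<noteq> 0 \<Longrightarrow> 0 \<le> c \<alpha>"
    and F: "finite F" "F \<subseteq> nonzero_indices" and zero: "\<And>\<alpha>. \<alpha> \<noteq> 0 \<Longrightarrow> \<alpha> \<notin> F \<Longrightarrow> g (vec_of_nat \<alpha>) = 0"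
  shows integrable_atomic_finite: "integrable (atomic_measure c) g"
    and integral_atomic_finite: "(\<integral>x. g x \<partial>atomic_measure c) = (\<Sum>\<alpha>\<in>F. c \<alpha> *\<^sub>R g (vec_of_nat \<alpha>))"
proof -
  have s: "(\<lambda>\<alpha>. norm (c \<alpha> *\<^sub>R g (vec_of_nat \<alpha>))) summable_on nonzero_indices"
    by (rule finite_nonzero_values_imp_summable_on, rule finite_subset[OF _ F(1)]) (use zero in auto)
  show "integrable (atomic_measure c) g" by (rule integrable_atomic[OF g c s])
  have "((\<lambda>\<alpha>. c \<alpha> *\<^sub>R g (vec_of_nat \<alpha>)) has_sum (\<Sum>\<alpha>\<in>F. c \<alpha> *\<^sub>R g (vec_of_nat \<alpha>))) nonzero_indices"
    by (rule has_sum_finite_neutralI[OF F]) (use zero in auto)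
  thus "(\<integral>x. g x \<partial>atomic_measure c) = (\<Sum>\<alpha>\<in>F. c \<alpha> *\<^sub>R g (vec_of_nat \<alpha>))"
    using integral_atomic[OF g c s] by (simp add: infsumI)
qed

text \<open>Lets Fubini's theorem in \<open>coag_integrable\<close> work with inner integrals whose
  existence is established at lattice points.\<close>

lemma AE_atomic: "AE x in (atomic_measure c :: (real ^ 'd) measure). x \<in> vec_of_nat ` nonzero_indices"
proof -
  let ?L = "vec_of_nat ` nonzero_indices :: (real ^ 'd) set"
  have "?L \<in> sets borel" by (rule sets.countable) auto
  hence "?L \<in> sets RB"
    by (auto simp: sets_restrict_space vec_of_nat_in_Rstar intro!: image_eqI[of _ _ ?L])
  moreover have "{x \<in> space RB. x \<in> ?L} = ?L"
    by (auto simp: space_restrict_space vec_of_nat_in_Rstar)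
  ultimately show ?thesis unfolding atomic_measure_def
    by (subst AE_distr_iff[OF vec_of_nat_measurable]) (auto simp: AE_point_measure)
qed

text \<open>The Borel algebra of pairs is the product of the Borel algebras, so continuity on
  \<open>Rstar \<times> Rstar\<close> alone gives measurability on the product of the restricted
  spaces.\<close>

lemma pair_continuous_measurable:
  fixes f :: "(real ^ 'd) \<times> (real ^ 'd) \<Rightarrow> real"
  assumes "continuous_on (Rstar \<times> Rstar) f"
  shows "f \<in> borel_measurable (RB \<Otimes>\<^sub>M RB)"
proof -
  have id: "(\<lambda>x. x) \<in> measurable RB (borel :: (real ^ 'd) measure)"
    by (rule measurable_restrict_space1) simp
  have "(\<lambda>z. (fst z, snd z)) \<in> measurable (RB \<Otimes>\<^sub>M RB) (borel \<Otimes>\<^sub>M borel :: ((real ^ 'd) \<times> (real ^ 'd)) measure)"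
    by (intro measurable_Pair measurable_compose[OF measurable_fst id] measurable_compose[OF measurable_snd id])
  hence "(\<lambda>z. z) \<in> measurable (RB \<Otimes>\<^sub>M RB) (borel :: ((real ^ 'd) \<times> (real ^ 'd)) measure)"
    by (simp add: borel_prod)
  hence "(\<lambda>z. z) \<in> measurable (RB \<Otimes>\<^sub>M RB) (restrict_space borel (Rstar \<times> Rstar :: ((real ^ 'd) \<times> (real ^ 'd)) set))"
    by (intro measurable_restrict_space2) (auto simp: space_pair_measure space_restrict_space)
  from measurable_compose[OF this borel_measurable_continuous_on_restrict[OF assms]]
  show ?thesis .
qed

text \<open>A test function of compact support meets finitely many lattice points, so its pairing
  with the solution is a finite sum of continuous functions of time.\<close>

lemma finite_lattice_points:
  fixes C :: "(real ^ 'd) set"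
  assumes "bounded C"
  shows "finite {\<alpha>. \<alpha> \<noteq> 0 \<and> vec_of_nat \<alpha> \<in> C}"
proof -
  obtain B where B: "\<And>x. x \<in> C \<Longrightarrow> norm x \<le> B" using assms by (auto simp: bounded_iff)
  have "sz \<alpha> \<le> real CARD('d) * B" if "vec_of_nat \<alpha> \<in> C" for \<alpha> :: "nat ^ 'd"
  proof -
    have "sz \<alpha> = (\<Sum>j\<in>UNIV. \<bar>vec_of_nat \<alpha> $ j\<bar>)" by (simp add: sz_def l1norm_def)
    also have "\<dots> \<le> (\<Sum>j\<in>(UNIV :: 'd set). B)"
      using B[OF that] component_le_norm_cart[of "vec_of_nat \<alpha> :: real ^ 'd"] by (intro sum_mono) (meson order_trans)
    finally show ?thesis by simp
  qed
  thus ?thesis by (intro finite_subset[OF _ finite_sz_le]) auto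
qed

lemma l1norm_measurable: "l1norm \<in> borel_measurable RB"
  unfolding l1norm_def[abs_def]
  by (intro borel_measurable_continuous_on_restrict continuous_intros)

lemma Rstar_add: "x \<in> Rstar \<Longrightarrow> y \<in> Rstar \<Longrightarrow> x + y \<in> Rstar"
  by (auto simp: Rstar_def vec_eq_iff add_nonneg_eq_0_iff)

section \<open>The limit as a family of measures\<close>

context coag_limit
begin

definition sol_measure :: "real \<Rightarrow> (real ^ 'd) measure"
  where "sol_measure t = atomic_measure (\<lambda>\<alpha>. sol \<alpha> t)"

lemma sol_measure_space [simp]: "space (sol_measure t) = Rstar" and sol_measure_sets [simp, measurable_cong]: "sets (sol_measure t) = sets RB"
  by (simp_all add: sol_measure_def)

text \<open>Sizes are at least 1, so the number of particles is at most the mass.\<close>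

lemma sol_measure_finite: "0 \<le> t \<Longrightarrow> finite_measure (sol_measure t)"
proof (rule finite_measureI)
  assume t: "0 \<le> t"
  have "integrable (sol_measure t) (\<lambda>_. 1 :: real)" unfolding sol_measure_def
    using weighted_abs_summable[OF t, of "\<lambda>_. 1 :: real" 1] sz_ge_1 sol_nonneg t
    by (intro integrable_atomic) auto
  thus "emeasure (sol_measure t) (space (sol_measure t)) \<noteq> \<infinity>" unfolding integrable_iff_bounded by (auto simp: less_top)
qed

lemma sol_measure_radon: "0 \<le> t \<Longrightarrow> sol_measure t \<in> radon_measures"
  using finite_measure.emeasure_finite[OF sol_measure_finite] by (auto simp: radon_measures_def less_top)

lemma sol_measure_mass:
  assumes t: "0 \<le> t"
  shows "(\<integral>\<^sup>+x. ennreal (l1norm x) \<partial>sol_measure t) = ennreal m0"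
proof -
  have s: "(\<lambda>\<alpha>. norm (sol \<alpha> t *\<^sub>R l1norm (vec_of_nat \<alpha>))) summable_on nonzero_indices"
    by (rule weighted_abs_summable[OF t, of _ 1]) (auto simp flip: sz_def)
  have nn: "0 \<le> l1norm x" for x :: "real ^ 'd" by (simp add: l1norm_def sum_nonneg)
  have "(\<integral>\<^sup>+x. ennreal (l1norm x) \<partial>sol_measure t) = ennreal (\<integral>x. l1norm x \<partial>sol_measure t)" unfolding sol_measure_def
    using sol_nonneg t nn by (intro nn_integral_eq_integral integrable_atomic l1norm_measurable s) auto
  also have "(\<integral>x. l1norm x \<partial>sol_measure t) = (\<Sum>\<^sub>\<infinity>\<alpha>\<in>nonzero_indices. sol \<alpha> t *\<^sub>R l1norm (vec_of_nat \<alpha>))"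
    unfolding sol_measure_def using sol_nonneg t by (intro integral_atomic l1norm_measurable s) auto
  also have "\<dots> = m0" using sol_mass[OF t] by (simp add: sz_def mult.commute)
  finally show ?thesis .
qed

lemma sol_measure_continuous: "continuous_map (top_of_set {0..}) weak_star_topology sol_measure"
  unfolding weak_star_topology_def
proof (rule continuous_map_pullback')
  show "topspace (top_of_set {0..}) \<subseteq> sol_measure -` radon_measures" using sol_measure_radon by auto
  show "continuous_map (top_of_set {0..}) (product_topology (\<lambda>_. euclideanreal) Cc_Rstar)
      ((\<lambda>\<mu>. restrict (\<lambda>\<phi>. \<integral>x. \<phi> x \<partial>\<mu>) Cc_Rstar) \<circ> sol_measure)"
    unfolding continuous_map_componentwise
  proof (intro conjI ballI)
    fix \<phi> :: "real ^ 'd \<Rightarrow> real" assume \<phi>: "\<phi> \<in> Cc_Rstar"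
    then obtain C where C: "continuous_on Rstar \<phi>" "compact C" "C \<subseteq> Rstar" "\<And>x. x \<in> Rstar - C \<Longrightarrow> \<phi> x = 0"
      by (auto simp: Cc_Rstar_def)
    define F where "F = {\<alpha>. \<alpha> \<noteq> 0 \<and> vec_of_nat \<alpha> \<in> C}"
    have F: "finite F" unfolding F_def by (rule finite_lattice_points[OF compact_imp_bounded[OF C(2)]])
    have "(\<integral>x. \<phi> x \<partial>sol_measure t) = (\<Sum>\<alpha>\<in>F. sol \<alpha> t *\<^sub>R \<phi> (vec_of_nat \<alpha>))" if "0 \<le> t" for t
      unfolding sol_measure_def using F that C(4) vec_of_nat_in_Rstar sol_nonneg
      by (intro integral_atomic_finite borel_measurable_continuous_on_restrict C(1)) (auto simp: F_def)
    moreover have "continuous_on {0..} (\<lambda>t. \<Sum>\<alpha>\<in>F. sol \<alpha> t *\<^sub>R \<phi> (vec_of_nat \<alpha>))"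
      by (intro continuous_intros sol_continuous) (auto simp: F_def)
    ultimately have "continuous_on {0..} (\<lambda>t. \<integral>x. \<phi> x \<partial>sol_measure t)"
      by (subst continuous_on_cong[OF refl]) auto
    thus "continuous_map (top_of_set {0..}) euclideanreal
        (\<lambda>x. ((\<lambda>\<mu>. restrict (\<lambda>\<phi>. \<integral>x. \<phi> x \<partial>\<mu>) Cc_Rstar) \<circ> sol_measure) x \<phi>)"
      using \<phi> by simp
  qed auto
qed

text \<open>On the lattice both weights are at most the size. For the first this follows from
  \<gamma> + p < 1 and sizes at least 1; the second region contains only lattice points of size
  exactly 1, where every power is 1.\<close>

lemma sol_measure_moments:
  "(SUP t\<in>{1/T..T}.
     (\<integral>\<^sup>+x\<in>{x. 1 \<le> l1norm x}. ennreal (l1norm x powr (\<gamma> + p)) \<partial>sol_measure t) +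
     (\<integral>\<^sup>+x\<in>{x. l1norm x \<le> 1}. ennreal (l1norm x powr (1 - p)) \<partial>sol_measure t)) < \<infinity>" if T: "1 < T"
proof -
  note l1norm_measurable[measurable]
  have le: "(\<integral>\<^sup>+x. ennreal (g x) * indicator S x \<partial>sol_measure t) \<le> ennreal m0"
    if t: "0 \<le> t" and g: "g \<in> borel_measurable RB" and S: "{x \<in> space RB. x \<in> S} \<in> sets RB"
      and gS: "\<And>\<alpha>. \<alpha> \<noteq> 0 \<Longrightarrow> vec_of_nat \<alpha> \<in> S \<Longrightarrow> g (vec_of_nat \<alpha>) \<le> sz \<alpha>" for g S t
  proof -
    have S': "(indicator S :: real ^ 'd \<Rightarrow> ennreal) \<in> borel_measurable RB"
      using S by (subst borel_measurable_indicator_iff) (simp add: Int_def conj_commute)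
    have "(\<integral>\<^sup>+x. ennreal (g x) * indicator S x \<partial>sol_measure t) =
        (\<integral>\<^sup>+\<alpha>. ennreal (sol \<alpha> t) * (ennreal (g (vec_of_nat \<alpha>)) * indicator S (vec_of_nat \<alpha>)) \<partial>count_space nonzero_indices)"
      unfolding sol_measure_def using g S' by (intro nn_integral_atomic) simp
    also have "\<dots> \<le> (\<integral>\<^sup>+\<alpha>. ennreal (sol \<alpha> t) * ennreal (l1norm (vec_of_nat \<alpha>)) \<partial>count_space nonzero_indices)"
      using gS by (intro nn_integral_mono mult_left_mono) (auto simp: indicator_def sz_def intro: ennreal_leI)
    also have "\<dots> = (\<integral>\<^sup>+x. ennreal (l1norm x) \<partial>sol_measure t)"
      unfolding sol_measure_def by (rule nn_integral_atomic[symmetric]) measurable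
    finally show ?thesis by (simp add: sol_measure_mass[OF t])
  qed
  have "(\<integral>\<^sup>+x\<in>{x. 1 \<le> l1norm x}. ennreal (l1norm x powr (\<gamma> + p)) \<partial>sol_measure t) +
     (\<integral>\<^sup>+x\<in>{x. l1norm x \<le> 1}. ennreal (l1norm x powr (1 - p)) \<partial>sol_measure t) \<le> ennreal m0 + ennreal m0"
    if t: "t \<in> {1/T..T}" for t
  proof (rule add_mono)
    have t0: "0 \<le> t" using t T by (auto intro: order_trans[of 0 "1 / T"])
    show "(\<integral>\<^sup>+x\<in>{x. 1 \<le> l1norm x}. ennreal (l1norm x powr (\<gamma> + p)) \<partial>sol_measure t) \<le> ennreal m0"
    proof (rule le[OF t0])
      fix \<alpha> :: "nat ^ 'd" assume "\<alpha> \<noteq> 0"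
      hence "sz \<alpha> powr (\<gamma> + p) \<le> sz \<alpha> powr 1" using \<gamma>p sz_ge_1 by (intro powr_mono) auto
      hence "sz \<alpha> powr (\<gamma> + p) \<le> sz \<alpha>" by simp
      thus "l1norm (vec_of_nat \<alpha>) powr (\<gamma> + p) \<le> sz \<alpha>" by (simp only: sz_def)
    qed measurable
    show "(\<integral>\<^sup>+x\<in>{x. l1norm x \<le> 1}. ennreal (l1norm x powr (1 - p)) \<partial>sol_measure t) \<le> ennreal m0"
    proof (rule le[OF t0])
      fix \<alpha> :: "nat ^ 'd" assume "\<alpha> \<noteq> 0" "vec_of_nat \<alpha> \<in> {x. l1norm x \<le> 1}"
      hence "sz \<alpha> = 1" using sz_ge_1[of \<alpha>] by (simp add: sz_def)
      thus "l1norm (vec_of_nat \<alpha>) powr (1 - p) \<le> sz \<alpha>" by (simp add: sz_def)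
    qed measurable
  qed
  hence "(SUP t\<in>{1/T..T}.
     (\<integral>\<^sup>+x\<in>{x. 1 \<le> l1norm x}. ennreal (l1norm x powr (\<gamma> + p)) \<partial>sol_measure t) +
     (\<integral>\<^sup>+x\<in>{x. l1norm x \<le> 1}. ennreal (l1norm x powr (1 - p)) \<partial>sol_measure t)) \<le> ennreal m0 + ennreal m0"
    by (intro SUP_least)
  also have "\<dots> < \<infinity>" by (simp add: less_top flip: ennreal_plus)
  finally show ?thesis .
qed

lemma sol_measure_momentum:
  assumes t: "0 \<le> t"
  shows "has_bochner_integral (sol_measure t) (\<lambda>x. x) (\<integral>x. x \<partial>sol_measure 0)"
proof -
  have id: "(\<lambda>x. x) \<in> measurable RB (borel :: (real ^ 'd) measure)"
    by (rule measurable_restrict_space1) simp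
  have s: "(\<lambda>\<alpha>. norm (sol \<alpha> t *\<^sub>R (vec_of_nat \<alpha> :: real ^ 'd))) summable_on nonzero_indices" if "0 \<le> t" for t
    by (rule weighted_abs_summable[OF that, of _ 1]) (simp add: norm_vec_of_nat_le)
  have "(\<integral>x. x \<partial>sol_measure s) = (\<Sum>\<^sub>\<infinity>\<alpha>\<in>nonzero_indices. n0 \<alpha> *\<^sub>R vec_of_nat \<alpha>)" if "0 \<le> s" for s
    unfolding sol_measure_def sol_momentum[OF that, symmetric]
    by (rule integral_atomic[OF id sol_nonneg[OF _ that] s[OF that]])
  moreover have "integrable (sol_measure t) (\<lambda>x. x)" unfolding sol_measure_def
    by (rule integrable_atomic[OF id sol_nonneg[OF _ t] s[OF t]])
  ultimately show ?thesis using has_bochner_integral_integrable[of "sol_measure t" "\<lambda>x. x"] t by simp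
qed

end

section \<open>The weak formulation\<close>

text \<open>\<phi> vanishes at the ends a and b themselves, which kills the boundary terms of the
  fundamental theorem of calculus. For the derivative the complement of the closed interval is
  claimed, since there \<phi> is zero in a neighbourhood.\<close>

lemma test_function_data:
  fixes \<phi> :: "(real ^ 'd) \<times> real \<Rightarrow> real"
  assumes "\<phi> \<in> C1c_Rstar_time"
  obtains \<phi>' and F :: "(nat ^ 'd) set" and a b :: real where
    "\<And>x t. x \<in> Rstar \<Longrightarrow> 0 < t \<Longrightarrow> ((\<lambda>s. \<phi> (x, s)) has_real_derivative \<phi>' (x, t)) (at t)"
    "continuous_on (Rstar \<times> {0<..}) \<phi>" "continuous_on (Rstar \<times> {0<..}) \<phi>'"
    "finite F" "F \<subseteq> nonzero_indices" "0 < a" "a \<le> b"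
    "\<And>\<alpha> t. \<alpha> \<noteq> 0 \<Longrightarrow> 0 < t \<Longrightarrow> \<alpha> \<notin> F \<or> t \<notin> {a<..<b} \<Longrightarrow> \<phi> (vec_of_nat \<alpha>, t) = 0"
    "\<And>\<alpha> t. \<alpha> \<noteq> 0 \<Longrightarrow> 0 < t \<Longrightarrow> \<alpha> \<notin> F \<or> t \<notin> {a..b} \<Longrightarrow> \<phi>' (vec_of_nat \<alpha>, t) = 0"
proof -
  let ?S = "Rstar \<times> {0<..} :: ((real ^ 'd) \<times> real) set"
  note test = assms[unfolded C1c_Rstar_time_def, THEN CollectD]
  from conjunct1[OF test] obtain D :: "(real ^ 'd) \<times> real \<Rightarrow> ((real ^ 'd) \<times> real) \<Rightarrow>\<^sub>L real" where
    D: "continuous_on ?S D" "\<And>z. z \<in> ?S \<Longrightarrow> (\<phi> has_derivative blinfun_apply (D z)) (at z within ?S)"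
    by (elim exE conjE) (rule that, assumption, erule bspec)
  from conjunct2[OF test] obtain C where
    C: "compact C" "C \<subseteq> ?S" "\<And>z. z \<in> ?S - C \<Longrightarrow> \<phi> z = 0"
    by (elim exE conjE) (rule that, assumption, assumption, erule bspec)
  define \<phi>' where "\<phi>' z = blinfun_apply (D z) (0, 1)" for z
  have deriv: "((\<lambda>s. \<phi> (x, s)) has_real_derivative \<phi>' (x, t)) (at t)" if x: "x \<in> Rstar" and t: "0 < t" for x t
  proof -
    have "((\<lambda>s. (x, s)) has_derivative (\<lambda>h. (0, h))) (at t within {0<..})"
      by (intro has_derivative_Pair has_derivative_const has_derivative_ident)
    moreover have "(\<phi> has_derivative blinfun_apply (D (x, t))) (at (x, t) within (\<lambda>s. (x, s)) ` {0<..})"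
      using x t by (intro has_derivative_subset[OF D(2)]) auto
    ultimately have "((\<phi> \<circ> (\<lambda>s. (x, s))) has_derivative (blinfun_apply (D (x, t)) \<circ> (\<lambda>h. (0, h)))) (at t within {0<..})"
      by (rule diff_chain_within)
    moreover have "blinfun_apply (D (x, t)) (0, h) = \<phi>' (x, t) * h" for h
      using blinfun.scaleR_right[of "D (x, t)" h "(0, 1)"] by (simp add: \<phi>'_def mult.commute)
    ultimately have "((\<lambda>s. \<phi> (x, s)) has_derivative (\<lambda>h. \<phi>' (x, t) * h)) (at t within {0<..})"
      by (simp add: o_def)
    thus ?thesis using t by (simp add: has_field_derivative_def at_within_open[of t "{0<..}"])
  qed
  have cont: "continuous_on ?S \<phi>"
    unfolding continuous_on_eq_continuous_within by (intro ballI has_derivative_continuous[OF D(2)])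
  have cont': "continuous_on ?S \<phi>'" unfolding \<phi>'_def
    by (intro continuous_intros D(1))
  define F where "F = {\<alpha> :: nat ^ 'd. \<alpha> \<noteq> 0 \<and> vec_of_nat \<alpha> \<in> fst ` C}"
  have F: "finite F" unfolding F_def
    by (intro finite_lattice_points compact_imp_bounded compact_continuous_image C(1) continuous_intros)
  have sC: "compact (snd ` C)" by (intro compact_continuous_image C(1) continuous_intros)
  obtain a b where ab: "0 < a" "a \<le> b" "snd ` C \<subseteq> {a<..<b}"
  proof (cases "C = {}")
    case False
    obtain l where l: "l \<in> snd ` C" "\<And>y. y \<in> snd ` C \<Longrightarrow> l \<le> y"
      using compact_attains_inf[OF sC] False by auto
    obtain u where u: "u \<in> snd ` C" "\<And>y. y \<in> snd ` C \<Longrightarrow> y \<le> u"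
      using compact_attains_sup[OF sC] False by auto
    have "0 < l" using l(1) C(2) by auto
    show thesis
    \<comment> \<open>Leaves room on both sides of the compact time projection while keeping a
      positive.\<close>
    proof (rule that[of "l / 2" "u + 1"])
      show "snd ` C \<subseteq> {l / 2<..<u + 1}" using l(2) u(2) \<open>0 < l\<close> by fastforce
      show "l / 2 \<le> u + 1" using l(2)[OF u(1)] \<open>0 < l\<close> by linarith
    qed (use \<open>0 < l\<close> in auto)
  qed (use that[of 1 1] in auto)
  have zero: "\<phi> (vec_of_nat \<alpha>, t) = 0" if "\<alpha> \<noteq> 0" "0 < t" "\<alpha> \<notin> F \<or> t \<notin> {a<..<b}" for \<alpha> t
  proof (rule C(3))
    have "(vec_of_nat \<alpha>, t) \<notin> C"
    proof
      assume "(vec_of_nat \<alpha>, t) \<in> C"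
      from imageI[OF this, of fst] imageI[OF this, of snd] ab(3) that show False by (auto simp: F_def)
    qed
    thus "(vec_of_nat \<alpha>, t) \<in> ?S - C" using that by (simp add: vec_of_nat_in_Rstar)
  qed
  have zero': "\<phi>' (vec_of_nat \<alpha>, t) = 0" if a: "\<alpha> \<noteq> 0" and t: "0 < t" and out: "\<alpha> \<notin> F \<or> t \<notin> {a..b}" for \<alpha> t
  proof -
    define T where "T = (if \<alpha> \<in> F then {0<..<a} \<union> {b<..} else {0<..})"
    have T: "open T" "t \<in> T" using t out by (auto simp: T_def intro: open_Un)
    have "((\<lambda>s. 0) has_real_derivative 0) (at t)" by simp
    hence "((\<lambda>s. \<phi> (vec_of_nat \<alpha>, s)) has_real_derivative 0) (at t)"
    proof (rule has_field_derivative_transform_within_open[OF _ T])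
      fix s assume "s \<in> T"
      hence "\<phi> (vec_of_nat \<alpha>, s) = 0" using ab(1,2) by (intro zero a) (auto simp: T_def split: if_splits)
      thus "0 = \<phi> (vec_of_nat \<alpha>, s)" ..
    qed
    with deriv[OF vec_of_nat_in_Rstar[OF a] t] show ?thesis by (rule DERIV_unique)
  qed
  show thesis
    by (rule that[OF deriv cont cont' F _ ab(1,2) zero zero']) (auto simp: F_def)
qed

lemma
  fixes X G :: "real \<Rightarrow> real"
  assumes eq: "\<And>t. 0 < t \<Longrightarrow> X t = G t" and cont: "continuous_on {0<..} G" and a: "0 < a"
    and zero: "\<And>t. 0 < t \<Longrightarrow> t \<notin> {a..b} \<Longrightarrow> G t = 0"
  shows time_integrable: "set_integrable lborel {0<..} X"
    and time_integral: "(LINT t:{0<..}|lborel. X t) = (LINT t:{a..b}|lborel. G t)"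
    and time_integrable_Icc: "set_integrable lborel {a..b} G"
proof -
  have ind: "(\<lambda>t. indicator {0<..} t *\<^sub>R X t) = (\<lambda>t. indicator {a..b} t *\<^sub>R G t)"
    using eq zero a by (fastforce simp: indicator_def fun_eq_iff)
  show i: "set_integrable lborel {a..b} G"
    using a by (intro borel_integrable_atLeastAtMost' continuous_on_subset[OF cont]) auto
  thus "set_integrable lborel {0<..} X" unfolding set_integrable_def ind .
  show "(LINT t:{0<..}|lborel. X t) = (LINT t:{a..b}|lborel. G t)"
    unfolding set_lebesgue_integral_def ind ..
qed

context coag_limit
begin

text \<open>The gain meets only the finitely many splittings of indices in F. The loss is infinite
  in the partner index and is treated as an absolutely summable double series; the second loss term
  is its mirror image. The factor 2 is undone by the 1 / 2 of the weak equation.\<close>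

lemma pair_has_sum:
  assumes t: "0 \<le> t" and F: "finite F" "F \<subseteq> nonzero_indices" and \<psi>: "\<And>\<alpha>. \<alpha> \<noteq> 0 \<Longrightarrow> \<alpha> \<notin> F \<Longrightarrow> \<psi> \<alpha> = 0"
  defines "H \<equiv> \<lambda>(\<alpha>, \<beta>). sol \<alpha> t * (sol \<beta> t * (k \<alpha> \<beta> * (\<psi> (\<alpha> + \<beta>) - \<psi> \<alpha> - \<psi> \<beta>)))"
  shows "(H has_sum 2 * (\<Sum>\<alpha>\<in>F. \<psi> \<alpha> * sol_rate \<alpha> t)) (nonzero_indices \<times> nonzero_indices)"
proof -
  let ?N = "nonzero_indices :: (nat ^ 'd) set"
  define H1 where "H1 = (\<lambda>(\<alpha>, \<beta>). sol \<alpha> t * sol \<beta> t * k \<alpha> \<beta> * \<psi> (\<alpha> + \<beta>))"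
  define H2 where "H2 = (\<lambda>(\<alpha>, \<beta>). sol \<alpha> t * sol \<beta> t * k \<alpha> \<beta> * \<psi> \<alpha>)"
  define g where "g \<gamma>' = (\<Sum>(\<beta>, \<beta>')\<in>splits \<gamma>'. k \<beta> \<beta>' * sol \<beta> t * sol \<beta>' t)" for \<gamma>'
  define l where "l \<alpha> = (\<Sum>\<^sub>\<infinity>\<beta>\<in>?N. sol \<beta> t *\<^sub>R k \<alpha> \<beta>)" for \<alpha>
  have h1: "(H1 has_sum (\<Sum>\<gamma>'\<in>F. \<psi> \<gamma>' * g \<gamma>')) (?N \<times> ?N)"
  proof (rule has_sum_finite_neutralI)
    show "finite (\<Union>\<gamma>'\<in>F. splits \<gamma>')" using F by simp
    show "(\<Union>\<gamma>'\<in>F. splits \<gamma>') \<subseteq> ?N \<times> ?N" by (auto simp: splits_def)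
    show "H1 x = 0" if x: "x \<in> ?N \<times> ?N - (\<Union>\<gamma>'\<in>F. splits \<gamma>')" for x
    proof -
      obtain \<alpha> \<beta> where ab: "x = (\<alpha>, \<beta>)" "\<alpha> \<noteq> 0" "\<beta> \<noteq> 0" using x by auto
      hence "\<alpha> + \<beta> \<notin> F" using x by (auto simp: splits_def)
      hence "\<psi> (\<alpha> + \<beta>) = 0" using ab by (intro \<psi> add_nonzero)
      thus ?thesis by (simp add: H1_def ab)
    qed
    have "(\<Sum>x\<in>(\<Union>\<gamma>'\<in>F. splits \<gamma>'). H1 x) = (\<Sum>\<gamma>'\<in>F. \<Sum>x\<in>splits \<gamma>'. H1 x)"
      using F(1) by (intro sum.UNION_disjoint ballI finite_splits) (auto simp: splits_def)
    also have "\<dots> = (\<Sum>\<gamma>'\<in>F. \<psi> \<gamma>' * g \<gamma>')" unfolding g_def sum_distrib_left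
      by (intro sum.cong refl) (auto simp: splits_def H1_def)
    finally show "(\<Sum>\<gamma>'\<in>F. \<psi> \<gamma>' * g \<gamma>') = (\<Sum>x\<in>(\<Union>\<gamma>'\<in>F. splits \<gamma>'). H1 x)" ..
  qed
  have inner: "(\<Sum>\<^sub>\<infinity>\<beta>\<in>?N. H2 (\<alpha>, \<beta>)) = \<psi> \<alpha> * (sol \<alpha> t * l \<alpha>)" for \<alpha>
  proof -
    have "(\<Sum>\<^sub>\<infinity>\<beta>\<in>?N. H2 (\<alpha>, \<beta>)) = (\<Sum>\<^sub>\<infinity>\<beta>\<in>?N. (\<psi> \<alpha> * sol \<alpha> t) * (sol \<beta> t *\<^sub>R k \<alpha> \<beta>))"
      by (intro infsum_cong) (simp add: H2_def mult_ac)
    thus ?thesis unfolding l_def by (simp only: infsum_cmult_right' mult.assoc)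
  qed
  have "(\<lambda>x. norm (H2 x)) summable_on (?N \<times> ?N)"
  proof (rule Infinite_Sum.abs_summable_on_Sigma_iff[THEN iffD2], intro conjI ballI)
    fix \<alpha> assume "\<alpha> \<in> ?N"
    hence a: "\<alpha> \<noteq> 0" by simp
    have "(\<lambda>\<beta>. norm (sol \<beta> t *\<^sub>R (sol \<alpha> t * \<psi> \<alpha> * k \<alpha> \<beta>))) summable_on ?N"
    proof (rule weighted_abs_summable[OF t])
      fix \<beta> :: "nat ^ 'd" assume "\<beta> \<noteq> 0"
      from mult_left_mono[OF norm_k_le[OF a this], of "\<bar>sol \<alpha> t * \<psi> \<alpha>\<bar>"]
      show "norm (sol \<alpha> t * \<psi> \<alpha> * k \<alpha> \<beta>) \<le> \<bar>sol \<alpha> t * \<psi> \<alpha>\<bar> * (C2 * sz \<alpha> powr (\<gamma> + pp)) * sz \<beta>"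
        by (simp add: abs_mult mult_ac)
    qed
    thus "(\<lambda>\<beta>. norm (H2 (\<alpha>, \<beta>))) summable_on ?N" by (simp add: H2_def mult_ac)
  next
    have "\<alpha> \<in> F" if "\<alpha> \<noteq> 0" "(\<Sum>\<^sub>\<infinity>\<beta>\<in>?N. norm (H2 (\<alpha>, \<beta>))) \<noteq> 0" for \<alpha>
    proof (rule ccontr)
      assume "\<alpha> \<notin> F"
      hence "(\<Sum>\<^sub>\<infinity>\<beta>\<in>?N. norm (H2 (\<alpha>, \<beta>))) = 0" using \<psi>[OF that(1)] by (simp add: H2_def)
      with that(2) show False ..
    qed
    thus "(\<lambda>\<alpha>. norm (\<Sum>\<^sub>\<infinity>\<beta>\<in>?N. norm (H2 (\<alpha>, \<beta>)))) summable_on ?N"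
      by (intro finite_nonzero_values_imp_summable_on finite_subset[OF _ F(1)]) auto
  qed
  hence sum2: "H2 summable_on (?N \<times> ?N)" by (rule abs_summable_summable)
  have "infsum H2 (?N \<times> ?N) = (\<Sum>\<^sub>\<infinity>\<alpha>\<in>?N. \<psi> \<alpha> * (sol \<alpha> t * l \<alpha>))"
    using infsum_Sigma_banach[OF sum2] by (simp add: inner)
  also have "\<dots> = (\<Sum>\<alpha>\<in>F. \<psi> \<alpha> * (sol \<alpha> t * l \<alpha>))"
    by (rule infsumI, rule has_sum_finite_neutralI[OF F]) (auto simp: \<psi>)
  finally have h2: "(H2 has_sum (\<Sum>\<alpha>\<in>F. \<psi> \<alpha> * (sol \<alpha> t * l \<alpha>))) (?N \<times> ?N)"
    using has_sum_infsum[OF sum2] by simp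
  hence h3: "((\<lambda>(\<alpha>, \<beta>). H2 (\<beta>, \<alpha>)) has_sum (\<Sum>\<alpha>\<in>F. \<psi> \<alpha> * (sol \<alpha> t * l \<alpha>))) (?N \<times> ?N)"
    by (simp only: has_sum_swap[of H2])
  have e: "\<psi> \<alpha> * sol_rate \<alpha> t = 1 / 2 * (\<psi> \<alpha> * g \<alpha>) - \<psi> \<alpha> * (sol \<alpha> t * l \<alpha>)" for \<alpha>
    by (simp add: sol_rate_def g_def l_def right_diff_distrib)
  have "((\<lambda>x. H1 x + (- 1 * H2 x + - 1 * (case x of (\<alpha>, \<beta>) \<Rightarrow> H2 (\<beta>, \<alpha>)))) has_sum
      (\<Sum>\<gamma>'\<in>F. \<psi> \<gamma>' * g \<gamma>') + (- 1 * (\<Sum>\<alpha>\<in>F. \<psi> \<alpha> * (sol \<alpha> t * l \<alpha>)) + - 1 * (\<Sum>\<alpha>\<in>F. \<psi> \<alpha> * (sol \<alpha> t * l \<alpha>)))) (?N \<times> ?N)"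
    by (intro has_sum_add has_sum_cmult_right h1 h2 h3)
  also have "(\<Sum>\<gamma>'\<in>F. \<psi> \<gamma>' * g \<gamma>') + (- 1 * (\<Sum>\<alpha>\<in>F. \<psi> \<alpha> * (sol \<alpha> t * l \<alpha>)) + - 1 * (\<Sum>\<alpha>\<in>F. \<psi> \<alpha> * (sol \<alpha> t * l \<alpha>))) =
      2 * (\<Sum>\<alpha>\<in>F. \<psi> \<alpha> * sol_rate \<alpha> t)"
    unfolding e by (simp only: sum_subtractf sum_distrib_left[symmetric]) simp
  also have "((\<lambda>x. H1 x + (- 1 * H2 x + - 1 * (case x of (\<alpha>, \<beta>) \<Rightarrow> H2 (\<beta>, \<alpha>)))) has_sum
      2 * (\<Sum>\<alpha>\<in>F. \<psi> \<alpha> * sol_rate \<alpha> t)) (?N \<times> ?N) \<longleftrightarrow> (H has_sum 2 * (\<Sum>\<alpha>\<in>F. \<psi> \<alpha> * sol_rate \<alpha> t)) (?N \<times> ?N)"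
    by (intro has_sum_cong) (auto simp: H_def H1_def H2_def algebra_simps k_sym)
  finally show ?thesis .
qed

end

locale coag_weak = coag_limit k c1 c2 \<gamma> p n0 \<sigma> sol
  for k :: "nat ^ 'd \<Rightarrow> nat ^ 'd \<Rightarrow> real" and c1 c2 \<gamma> p n0 \<sigma> sol +
  fixes K :: "real ^ 'd \<Rightarrow> real ^ 'd \<Rightarrow> real"
  assumes k_eq: "\<alpha> \<noteq> 0 \<Longrightarrow> \<beta> \<noteq> 0 \<Longrightarrow> K (vec_of_nat \<alpha>) (vec_of_nat \<beta>) = k \<alpha> \<beta>"
    and K_cont: "continuous_on (Rstar \<times> Rstar) (\<lambda>(x, y). K x y)"
begin

text \<open>The measures are atomic, so both integrals are double series over the lattice, whose
  value comes from \<open>pair_has_sum\<close>. The work lies in measurability, which continuity of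
  \<open>K\<close> provides, and in the absolute summability behind Fubini's theorem.\<close>

lemma
  assumes t: "0 < t" and F: "finite F" "F \<subseteq> nonzero_indices"
    and \<phi>: "continuous_on (Rstar \<times> {0<..}) \<phi>" "\<And>\<alpha>. \<alpha> \<noteq> 0 \<Longrightarrow> \<alpha> \<notin> F \<Longrightarrow> \<phi> (vec_of_nat \<alpha>, t) = 0"
  shows coag_integrable: "integrable (sol_measure t \<Otimes>\<^sub>M sol_measure t) (\<lambda>(x, y). coag_integrand K \<phi> t x y)"
    and coag_integral: "(\<integral>x. (\<integral>y. coag_integrand K \<phi> t x y \<partial>sol_measure t) \<partial>sol_measure t) = 2 * (\<Sum>\<alpha>\<in>F. \<phi> (vec_of_nat \<alpha>, t) * sol_rate \<alpha> t)"
proof -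
  let ?N = "nonzero_indices :: (nat ^ 'd) set"
  have t0: "0 \<le> t" using t by simp
  define \<psi> where "\<psi> \<alpha> = \<phi> (vec_of_nat \<alpha>, t)" for \<alpha>
  define H where "H = (\<lambda>(\<alpha>, \<beta>). sol \<alpha> t * (sol \<beta> t * (k \<alpha> \<beta> * (\<psi> (\<alpha> + \<beta>) - \<psi> \<alpha> - \<psi> \<beta>))))"
  let ?g = "coag_integrand K \<phi> t"
  have \<psi>0: "\<psi> \<alpha> = 0" if "\<alpha> \<noteq> 0" "\<alpha> \<notin> F" for \<alpha> using \<phi>(2) that by (simp add: \<psi>_def)
  have H: "(H has_sum 2 * (\<Sum>\<alpha>\<in>F. \<psi> \<alpha> * sol_rate \<alpha> t)) (?N \<times> ?N)"
    unfolding H_def by (rule pair_has_sum[OF t0 F \<psi>0])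
  have g: "?g (vec_of_nat \<alpha>) (vec_of_nat \<beta>) = k \<alpha> \<beta> * (\<psi> (\<alpha> + \<beta>) - \<psi> \<alpha> - \<psi> \<beta>)" if "\<alpha> \<noteq> 0" "\<beta> \<noteq> 0" for \<alpha> \<beta>
    using that by (simp add: coag_integrand_def \<psi>_def vec_of_nat_add k_eq)
  have meas: "(\<lambda>(x, y). ?g x y) \<in> borel_measurable (RB \<Otimes>\<^sub>M RB)"
  proof (rule pair_continuous_measurable)
    have c: "continuous_on (Rstar \<times> Rstar) (\<lambda>z. \<phi> (h z, t))"
      if "continuous_on (Rstar \<times> Rstar) h" "\<And>z. z \<in> Rstar \<times> Rstar \<Longrightarrow> h z \<in> Rstar" for h :: "(real ^ 'd) \<times> (real ^ 'd) \<Rightarrow> real ^ 'd"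
      using that t by (intro continuous_on_compose2[OF \<phi>(1)] continuous_intros) auto
    show "continuous_on (Rstar \<times> Rstar) (\<lambda>(x, y). ?g x y)"
      unfolding coag_integrand_def case_prod_beta
      by (intro continuous_on_mult continuous_on_diff c K_cont[unfolded case_prod_beta] continuous_intros)
        (auto intro: Rstar_add)
  qed
  interpret pair_sigma_finite "sol_measure t" "sol_measure t"
    using finite_measure.axioms(1)[OF sol_measure_finite[OF t0]] by (intro pair_sigma_finite.intro)
  have meas1: "(\<lambda>y. ?g x y) \<in> borel_measurable RB" if "x \<in> Rstar" for x
    using measurable_Pair2[OF meas, of x] that by (simp add: space_restrict_space)
  \<comment> \<open>A bound for \<psi> at all indices; with it the inner series is dominated by a
    multiple of the mass.\<close>
  define M where "M = (\<Sum>\<alpha>\<in>F. \<bar>\<psi> \<alpha>\<bar>)"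
  have M: "\<bar>\<psi> \<alpha>\<bar> \<le> M" if "\<alpha> \<noteq> 0" for \<alpha>
  proof (cases "\<alpha> \<in> F")
    case True
    thus ?thesis unfolding M_def using F by (intro member_le_sum[of _ _ "\<lambda>\<alpha>. \<bar>\<psi> \<alpha>\<bar>"]) auto
  next
    case False
    thus ?thesis using \<psi>0[OF that] by (simp add: M_def sum_nonneg)
  qed
  have inner_summable: "(\<lambda>\<beta>. norm (sol \<beta> t *\<^sub>R ?g (vec_of_nat \<alpha>) (vec_of_nat \<beta>))) summable_on ?N" if a: "\<alpha> \<noteq> 0" for \<alpha>
  proof (rule weighted_abs_summable[OF t0])
    fix \<beta> :: "nat ^ 'd" assume b: "\<beta> \<noteq> 0"
    have "\<bar>\<psi> (\<alpha> + \<beta>) - \<psi> \<alpha> - \<psi> \<beta>\<bar> \<le> 3 * M"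
      using M[OF a] M[OF b] M[OF add_nonzero[OF a, of \<beta>]] by linarith
    hence "\<bar>k \<alpha> \<beta>\<bar> * \<bar>\<psi> (\<alpha> + \<beta>) - \<psi> \<alpha> - \<psi> \<beta>\<bar> \<le> (C2 * sz \<alpha> powr (\<gamma> + pp) * sz \<beta>) * (3 * M)"
      using norm_k_le[OF a b] loss_const_nonneg[of \<alpha>] by (intro mult_mono) auto
    thus "norm (?g (vec_of_nat \<alpha>) (vec_of_nat \<beta>)) \<le> C2 * sz \<alpha> powr (\<gamma> + pp) * (3 * M) * sz \<beta>"
      by (simp add: g[OF a b] abs_mult mult_ac)
  qed
  have inner_int: "integrable (sol_measure t) (?g (vec_of_nat \<alpha>))" if a: "\<alpha> \<noteq> 0" for \<alpha>
    unfolding sol_measure_def using a t0 sol_nonneg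
    by (intro integrable_atomic meas1 inner_summable vec_of_nat_in_Rstar) auto
  have inner_val: "sol \<alpha> t *\<^sub>R (\<integral>y. ?g (vec_of_nat \<alpha>) y \<partial>sol_measure t) = (\<Sum>\<^sub>\<infinity>\<beta>\<in>?N. H (\<alpha>, \<beta>))" if a: "\<alpha> \<noteq> 0" for \<alpha>
  proof -
    have "(\<integral>y. ?g (vec_of_nat \<alpha>) y \<partial>sol_measure t) = (\<Sum>\<^sub>\<infinity>\<beta>\<in>?N. sol \<beta> t *\<^sub>R ?g (vec_of_nat \<alpha>) (vec_of_nat \<beta>))"
      unfolding sol_measure_def using a t0 sol_nonneg
      by (intro integral_atomic meas1 inner_summable vec_of_nat_in_Rstar) auto
    hence "sol \<alpha> t *\<^sub>R (\<integral>y. ?g (vec_of_nat \<alpha>) y \<partial>sol_measure t) =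
        (\<Sum>\<^sub>\<infinity>\<beta>\<in>?N. sol \<alpha> t * (sol \<beta> t *\<^sub>R ?g (vec_of_nat \<alpha>) (vec_of_nat \<beta>)))"
      by (simp add: infsum_cmult_right')
    also have "\<dots> = (\<Sum>\<^sub>\<infinity>\<beta>\<in>?N. H (\<alpha>, \<beta>))" using a by (intro infsum_cong) (simp add: g H_def)
    finally show ?thesis .
  qed
  have inner_norm: "norm (sol \<alpha> t *\<^sub>R (\<integral>y. norm (?g (vec_of_nat \<alpha>) y) \<partial>sol_measure t)) = (\<Sum>\<^sub>\<infinity>\<beta>\<in>?N. norm (H (\<alpha>, \<beta>)))" if a: "\<alpha> \<noteq> 0" for \<alpha>
  proof -
    have "(\<integral>y. norm (?g (vec_of_nat \<alpha>) y) \<partial>sol_measure t) = (\<Sum>\<^sub>\<infinity>\<beta>\<in>?N. sol \<beta> t *\<^sub>R norm (?g (vec_of_nat \<alpha>) (vec_of_nat \<beta>)))"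
      unfolding sol_measure_def
    proof (rule integral_atomic[OF measurable_compose[OF meas1[OF vec_of_nat_in_Rstar[OF a]] borel_measurable_norm]])
      show "(\<lambda>\<beta>. norm (sol \<beta> t *\<^sub>R norm (?g (vec_of_nat \<alpha>) (vec_of_nat \<beta>)))) summable_on ?N"
        using inner_summable[OF a] by (simp add: abs_mult)
    qed (rule sol_nonneg[OF _ t0])
    hence "sol \<alpha> t *\<^sub>R (\<integral>y. norm (?g (vec_of_nat \<alpha>) y) \<partial>sol_measure t) =
        (\<Sum>\<^sub>\<infinity>\<beta>\<in>?N. sol \<alpha> t * (sol \<beta> t *\<^sub>R norm (?g (vec_of_nat \<alpha>) (vec_of_nat \<beta>))))"
      by (simp add: infsum_cmult_right')
    also have "\<dots> = (\<Sum>\<^sub>\<infinity>\<beta>\<in>?N. norm (H (\<alpha>, \<beta>)))"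
      using a sol_nonneg t0 by (intro infsum_cong) (auto simp: g H_def abs_mult)
    finally show ?thesis by (simp add: infsum_nonneg)
  qed
  have ms: "borel_measurable (sol_measure t \<Otimes>\<^sub>M sol_measure t) = (borel_measurable (RB \<Otimes>\<^sub>M RB) :: ((real ^ 'd) \<times> (real ^ 'd) \<Rightarrow> real) set)"
      "borel_measurable (RB \<Otimes>\<^sub>M sol_measure t) = (borel_measurable (RB \<Otimes>\<^sub>M RB) :: ((real ^ 'd) \<times> (real ^ 'd) \<Rightarrow> real) set)"
    by (intro measurable_cong_sets sets_pair_measure_cong sol_measure_sets refl)+
  \<comment> \<open>Real summable families are absolutely summable; this turns
    \<open>pair_has_sum\<close> into the integrability that Fubini's theorem asks for.\<close>
  have H_abs: "(\<lambda>x. norm (H x)) summable_on (?N \<times> ?N)"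
    by (rule summable_on_iff_abs_summable_on_real[THEN iffD1, OF has_sum_imp_summable[OF H]])
  have AE: "AE x in sol_measure t. x \<in> vec_of_nat ` ?N" unfolding sol_measure_def by (rule AE_atomic)
  show "integrable (sol_measure t \<Otimes>\<^sub>M sol_measure t) (\<lambda>(x, y). ?g x y)"
  proof (rule Fubini_integrable)
    show "(\<lambda>(x, y). ?g x y) \<in> borel_measurable (sol_measure t \<Otimes>\<^sub>M sol_measure t)"
      using meas by (simp only: ms)
    have "(\<lambda>x. \<integral>y. norm (?g x y) \<partial>sol_measure t) \<in> borel_measurable RB"
    proof (rule M1.borel_measurable_lebesgue_integral)
      have "(\<lambda>z. norm ((\<lambda>(x, y). ?g x y) z)) \<in> borel_measurable (RB \<Otimes>\<^sub>M sol_measure t)"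
        unfolding ms by (rule measurable_compose[OF meas borel_measurable_norm])
      thus "(\<lambda>(x, y). norm (?g x y)) \<in> borel_measurable (RB \<Otimes>\<^sub>M sol_measure t)" by (simp add: case_prod_beta)
    qed
    moreover have "(\<lambda>\<alpha>. norm (sol \<alpha> t *\<^sub>R (\<integral>y. norm (?g (vec_of_nat \<alpha>) y) \<partial>sol_measure t))) summable_on ?N"
    proof -
      have "(\<lambda>\<alpha>. norm (\<Sum>\<^sub>\<infinity>\<beta>\<in>?N. norm (H (\<alpha>, \<beta>)))) summable_on ?N"
        using Infinite_Sum.abs_summable_on_Sigma_iff[THEN iffD1, OF H_abs] by blast
      also have "?this \<longleftrightarrow> ?thesis"
        using inner_norm by (intro summable_on_cong) (simp add: infsum_nonneg)
      finally show ?thesis .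
    qed
    ultimately have "integrable (sol_measure t) (\<lambda>x. \<integral>y. norm (?g x y) \<partial>sol_measure t)"
      unfolding sol_measure_def[of t] using sol_nonneg t0 by (intro integrable_atomic) auto
    thus "integrable (sol_measure t) (\<lambda>x. \<integral>y. norm (case (x, y) of (x, y) \<Rightarrow> ?g x y) \<partial>sol_measure t)" by simp
    show "AE x in sol_measure t. integrable (sol_measure t) (\<lambda>y. case (x, y) of (x, y) \<Rightarrow> ?g x y)"
      using AE by eventually_elim (auto intro: inner_int)
  qed
  have "(\<integral>x. (\<integral>y. ?g x y \<partial>sol_measure t) \<partial>sol_measure t) = (\<Sum>\<^sub>\<infinity>\<alpha>\<in>?N. sol \<alpha> t *\<^sub>R (\<integral>y. ?g (vec_of_nat \<alpha>) y \<partial>sol_measure t))"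
    unfolding sol_measure_def[of t]
  proof (rule integral_atomic)
    show "(\<lambda>x. \<integral>y. ?g x y \<partial>atomic_measure (\<lambda>\<alpha>. sol \<alpha> t)) \<in> borel_measurable RB"
      unfolding sol_measure_def[of t, symmetric]
      by (rule M1.borel_measurable_lebesgue_integral)
        (use meas in \<open>simp only: ms\<close>)
    have "(\<lambda>(\<alpha>, \<beta>). H (\<alpha>, \<beta>)) summable_on (?N \<times> ?N)"
      using has_sum_imp_summable[OF H] by simp
    hence "(\<lambda>\<alpha>. \<Sum>\<^sub>\<infinity>\<beta>\<in>?N. H (\<alpha>, \<beta>)) summable_on ?N"
      by (rule summable_on_Sigma_banach)
    hence "(\<lambda>\<alpha>. norm (\<Sum>\<^sub>\<infinity>\<beta>\<in>?N. H (\<alpha>, \<beta>))) summable_on ?N"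
      by (rule summable_on_iff_abs_summable_on_real[THEN iffD1])
    also have "?this \<longleftrightarrow> (\<lambda>\<alpha>. norm (sol \<alpha> t *\<^sub>R (\<integral>y. ?g (vec_of_nat \<alpha>) y \<partial>sol_measure t))) summable_on ?N"
      using inner_val by (intro summable_on_cong) simp
    finally show "(\<lambda>\<alpha>. norm (sol \<alpha> t *\<^sub>R (\<integral>y. ?g (vec_of_nat \<alpha>) y \<partial>atomic_measure (\<lambda>\<alpha>. sol \<alpha> t)))) summable_on ?N"
      by (simp only: sol_measure_def)
  qed (use sol_nonneg t0 in auto)
  also have "\<dots> = (\<Sum>\<^sub>\<infinity>\<alpha>\<in>?N. \<Sum>\<^sub>\<infinity>\<beta>\<in>?N. H (\<alpha>, \<beta>))"
    using inner_val by (intro infsum_cong) simp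
  also have "\<dots> = 2 * (\<Sum>\<alpha>\<in>F. \<psi> \<alpha> * sol_rate \<alpha> t)"
    using infsum_Sigma_banach[OF has_sum_imp_summable[OF H]] infsumI[OF H] by simp
  finally show "(\<integral>x. (\<integral>y. ?g x y \<partial>sol_measure t) \<partial>sol_measure t) = 2 * (\<Sum>\<alpha>\<in>F. \<phi> (vec_of_nat \<alpha>, t) * sol_rate \<alpha> t)"
    by (simp only: \<psi>_def)
qed

text \<open>The pairing \<open>W\<close> of the solution with \<phi> is a finite sum, has derivative
  \<open>G1 t + 1 / 2 * G2 t\<close>, and vanishes at a and b. The fundamental theorem of calculus
  is then the weak equation.\<close>

lemma weak_formulation:
  assumes "\<phi> \<in> C1c_Rstar_time"
  shows "(\<forall>t>0. integrable (sol_measure t) (\<lambda>x. deriv (\<lambda>s. \<phi> (x, s)) t) \<and>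
               integrable (sol_measure t \<Otimes>\<^sub>M sol_measure t) (\<lambda>(x, y). coag_integrand K \<phi> t x y)) \<and>
        set_integrable lborel {0<..} (\<lambda>t. \<integral>x. deriv (\<lambda>s. \<phi> (x, s)) t \<partial>sol_measure t) \<and>
        set_integrable lborel {0<..} (\<lambda>t. \<integral>x. (\<integral>y. coag_integrand K \<phi> t x y \<partial>sol_measure t) \<partial>sol_measure t) \<and>
        0 = (LINT t:{0<..}|lborel. (\<integral>x. deriv (\<lambda>s. \<phi> (x, s)) t \<partial>sol_measure t)) +
            1/2 * (LINT t:{0<..}|lborel. (\<integral>x. (\<integral>y. coag_integrand K \<phi> t x y \<partial>sol_measure t) \<partial>sol_measure t))"
proof -
  obtain \<phi>' and F :: "(nat ^ 'd) set" and a b where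
    deriv: "\<And>x t. x \<in> Rstar \<Longrightarrow> 0 < t \<Longrightarrow> ((\<lambda>s. \<phi> (x, s)) has_real_derivative \<phi>' (x, t)) (at t)"
    and cont: "continuous_on (Rstar \<times> {0<..}) \<phi>" "continuous_on (Rstar \<times> {0<..}) \<phi>'"
    and F: "finite F" "F \<subseteq> nonzero_indices" and ab: "0 < a" "a \<le> b"
    and zero: "\<And>\<alpha> t. \<alpha> \<noteq> 0 \<Longrightarrow> 0 < t \<Longrightarrow> \<alpha> \<notin> F \<or> t \<notin> {a<..<b} \<Longrightarrow> \<phi> (vec_of_nat \<alpha>, t) = 0"
    and zero': "\<And>\<alpha> t. \<alpha> \<noteq> 0 \<Longrightarrow> 0 < t \<Longrightarrow> \<alpha> \<notin> F \<or> t \<notin> {a..b} \<Longrightarrow> \<phi>' (vec_of_nat \<alpha>, t) = 0"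
    by (rule test_function_data[OF assms]) (rule that, assumption+)
  define G1 where "G1 t = (\<Sum>\<alpha>\<in>F. sol \<alpha> t * \<phi>' (vec_of_nat \<alpha>, t))" for t
  define G2 where "G2 t = 2 * (\<Sum>\<alpha>\<in>F. \<phi> (vec_of_nat \<alpha>, t) * sol_rate \<alpha> t)" for t
  have Fnz: "\<alpha> \<noteq> 0" if "\<alpha> \<in> F" for \<alpha> using F that by auto
  have meas: "(\<lambda>x. deriv (\<lambda>s. \<phi> (x, s)) t) \<in> borel_measurable RB" if t: "0 < t" for t
  proof -
    have "continuous_on Rstar (\<lambda>x. \<phi>' (x, t))"
      using t by (intro continuous_on_compose2[OF cont(2)] continuous_intros) auto
    hence "(\<lambda>x. \<phi>' (x, t)) \<in> borel_measurable RB" by (rule borel_measurable_continuous_on_restrict)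
    also have "?this \<longleftrightarrow> ?thesis"
      using DERIV_imp_deriv[OF deriv[OF _ t]] by (intro measurable_cong) (simp add: space_restrict_space)
    finally show ?thesis .
  qed
  have d: "deriv (\<lambda>s. \<phi> (vec_of_nat \<alpha>, s)) t = \<phi>' (vec_of_nat \<alpha>, t)" if "\<alpha> \<noteq> 0" "0 < t" for \<alpha> t
    by (rule DERIV_imp_deriv[OF deriv[OF vec_of_nat_in_Rstar[OF that(1)] that(2)]])
  have int1: "integrable (sol_measure t) (\<lambda>x. deriv (\<lambda>s. \<phi> (x, s)) t)" if t: "0 < t" for t
    unfolding sol_measure_def using t F sol_nonneg zero' by (intro integrable_atomic_finite[where F = F] meas) (auto simp: d)
  have val1: "(\<integral>x. deriv (\<lambda>s. \<phi> (x, s)) t \<partial>sol_measure t) = G1 t" if t: "0 < t" for t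
  proof -
    have "(\<integral>x. deriv (\<lambda>s. \<phi> (x, s)) t \<partial>sol_measure t) = (\<Sum>\<alpha>\<in>F. sol \<alpha> t *\<^sub>R deriv (\<lambda>s. \<phi> (vec_of_nat \<alpha>, s)) t)"
      unfolding sol_measure_def using t F sol_nonneg zero' by (intro integral_atomic_finite meas) (auto simp: d)
    also have "\<dots> = G1 t" unfolding G1_def using Fnz t by (intro sum.cong) (auto simp: d)
    finally show ?thesis .
  qed
  have val2: "(\<integral>x. (\<integral>y. coag_integrand K \<phi> t x y \<partial>sol_measure t) \<partial>sol_measure t) = G2 t" if t: "0 < t" for t
    unfolding G2_def using zero t by (intro coag_integral[OF t F cont(1)]) auto
  have solc: "continuous_on {0<..} (sol \<alpha>)" if "\<alpha> \<noteq> 0" for \<alpha>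
    by (rule continuous_on_subset[OF sol_continuous[OF that]]) auto
  have Qc: "continuous_on {0<..} (sol_rate \<alpha>)" if "\<alpha> \<noteq> 0" for \<alpha>
  proof (rule continuous_at_imp_continuous_on, intro ballI)
    fix t :: real assume "t \<in> {0<..}"
    hence "t \<in> interior {0..t + 1}" by simp
    thus "isCont (sol_rate \<alpha>) t"
      using sol_rate_continuous[OF that, of "t + 1"] \<open>t \<in> {0<..}\<close> by (intro continuous_on_interior) auto
  qed
  have sec: "continuous_on {0<..} (\<lambda>t. h (vec_of_nat \<alpha>, t))" if "continuous_on (Rstar \<times> {0<..}) h" "\<alpha> \<noteq> 0"
    for h :: "(real ^ 'd) \<times> real \<Rightarrow> real" and \<alpha>
    using that vec_of_nat_in_Rstar by (intro continuous_on_compose2[OF that(1)] continuous_intros) auto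
  have c1: "continuous_on {0<..} G1" unfolding G1_def
    by (intro continuous_on_sum continuous_on_mult solc sec cont Fnz)
  have c2: "continuous_on {0<..} G2" unfolding G2_def
    by (intro continuous_on_sum continuous_on_mult continuous_on_const Qc sec cont Fnz)
  have z1: "G1 t = 0" if "0 < t" "t \<notin> {a..b}" for t unfolding G1_def
    using Fnz zero' that by (intro sum.neutral) auto
  have z2: "G2 t = 0" if "0 < t" "t \<notin> {a..b}" for t
  proof -
    have "(\<Sum>\<alpha>\<in>F. \<phi> (vec_of_nat \<alpha>, t) * sol_rate \<alpha> t) = 0"
      using Fnz zero that by (intro sum.neutral) auto
    thus ?thesis by (simp add: G2_def)
  qed
  note T1 = time_integrable[OF val1 c1 ab(1) z1] time_integral[OF val1 c1 ab(1) z1] time_integrable_Icc[OF val1 c1 ab(1) z1]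
  note T2 = time_integrable[OF val2 c2 ab(1) z2] time_integral[OF val2 c2 ab(1) z2] time_integrable_Icc[OF val2 c2 ab(1) z2]
  define W where "W t = (\<Sum>\<alpha>\<in>F. sol \<alpha> t * \<phi> (vec_of_nat \<alpha>, t))" for t
  have W: "(W has_real_derivative G1 t + 1 / 2 * G2 t) (at t)" if t: "0 < t" for t
  proof -
    have "(W has_real_derivative (\<Sum>\<alpha>\<in>F. sol_rate \<alpha> t * \<phi> (vec_of_nat \<alpha>, t) + \<phi>' (vec_of_nat \<alpha>, t) * sol \<alpha> t)) (at t)"
      unfolding W_def using Fnz t vec_of_nat_in_Rstar by (intro DERIV_sum DERIV_mult sol_deriv deriv) auto
    thus ?thesis by (simp add: G1_def G2_def sum.distrib mult.commute add.commute)
  qed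
  have W0: "W t = 0" if "0 < t" "t \<notin> {a<..<b}" for t unfolding W_def
    using Fnz zero that by (intro sum.neutral) auto
  have "(LINT t:{a..b}|lborel. G1 t) + 1 / 2 * (LINT t:{a..b}|lborel. G2 t) = (LINT t:{a..b}|lborel. G1 t + 1 / 2 * G2 t)"
    using T1(3) T2(3) by (subst set_integral_add(2)) auto
  also have "\<dots> = W b - W a" unfolding set_lebesgue_integral_def
  proof (rule integral_FTC_atLeastAtMost[OF ab(2)])
    fix t assume "a \<le> t" "t \<le> b"
    hence "(W has_vector_derivative G1 t + 1 / 2 * G2 t) (at t)"
      using W[of t] ab by (simp add: has_real_derivative_iff_has_vector_derivative)
    thus "(W has_vector_derivative G1 t + 1 / 2 * G2 t) (at t within {a..b})"
      by (rule has_vector_derivative_at_within)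
  next
    show "continuous_on {a..b} (\<lambda>t. G1 t + 1 / 2 * G2 t)"
      using ab by (intro continuous_intros continuous_on_subset[OF c1] continuous_on_subset[OF c2]) auto
  qed
  also have "\<dots> = 0" using ab by (simp add: W0)
  finally have "(LINT t:{a..b}|lborel. G1 t) + 1 / 2 * (LINT t:{a..b}|lborel. G2 t) = 0" .
  moreover have "integrable (sol_measure t \<Otimes>\<^sub>M sol_measure t) (\<lambda>(x, y). coag_integrand K \<phi> t x y)" if t: "0 < t" for t
    using zero t by (intro coag_integrable[OF t F cont(1)]) auto
  ultimately show ?thesis using int1 T1(1,2) T2(1,2) by simp
qed

lemma weak_solution_sol_measure: "weak_solution \<gamma> p K (atomic_measure n0) sol_measure"
proof -
  have f0: "sol_measure 0 = atomic_measure n0" by (simp add: sol_measure_def sol_init)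
  have "sol_measure 0 \<in> radon_measures" "(\<integral>\<^sup>+x. ennreal (l1norm x) \<partial>sol_measure 0) < \<infinity>"
    using sol_measure_radon[of 0] sol_measure_mass[of 0] by auto
  thus ?thesis unfolding weak_solution_def f0[symmetric]
    using sol_measure_continuous sol_measure_moments sol_measure_momentum weak_formulation by (intro conjI) auto
qed

end

section \<open>Localization\<close>

text \<open>
  The smallest 1-Lipschitz majorant of a nonincreasing function that tends to zero
  tends to zero as well; it makes the diagonal choice of \<open>\<delta>\<close> continuous.
\<close>

lemma diagonal_scale:
  fixes P :: "real \<Rightarrow> real \<Rightarrow> bool"
  assumes mono: "\<And>\<epsilon> \<epsilon>' t. 0 < t \<Longrightarrow> 0 < \<epsilon> \<Longrightarrow> \<epsilon> \<le> \<epsilon>' \<Longrightarrow> P \<epsilon> t \<Longrightarrow> P \<epsilon>' t"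
    and ev: "\<And>\<epsilon>. 0 < \<epsilon> \<Longrightarrow> \<exists>T. \<forall>t\<ge>T. P \<epsilon> t"
  obtains \<delta> :: "real \<Rightarrow> real" where "continuous_on {0<..} \<delta>" "\<And>t. 0 < t \<Longrightarrow> 0 < \<delta> t"
    "(\<delta> \<longlongrightarrow> 0) at_top" "\<forall>\<^sub>F t in at_top. P (\<delta> t) t"
proof -
  \<comment> \<open>The alternative 1 \<le> \<epsilon> keeps the set nonempty at all times, so the
    infimum is at most 1; the quantifier over s \<ge> t makes the infimum nonincreasing in
    t.\<close>
  define B where "B t = {\<epsilon>. 0 < \<epsilon> \<and> (1 \<le> \<epsilon> \<or> (\<forall>s\<ge>t. P \<epsilon> s))}" for t
  define e where "e t = Inf (B t)" for t
  have B1: "1 \<in> B t" for t by (simp add: B_def)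
  have bdd: "bdd_below (B t)" for t by (rule bdd_belowI[of _ 0]) (auto simp: B_def)
  have e0: "0 \<le> e t" for t unfolding e_def
  proof (rule cInf_greatest)
    show "B t \<noteq> {}" using B1 by blast
  qed (simp add: B_def)
  have e1: "e t \<le> 1" for t unfolding e_def by (rule cInf_lower[OF B1 bdd])
  have anti: "e t \<le> e s" if "s \<le> t" for s t
    unfolding e_def
  proof (rule cInf_superset_mono[OF _ bdd])
    show "B s \<noteq> {}" using B1 by blast
    show "B s \<subseteq> B t" using that by (auto simp: B_def)
  qed
  have e_lim: "\<exists>T. \<forall>t\<ge>T. e t \<le> \<epsilon>" if \<epsilon>: "0 < \<epsilon>" for \<epsilon>
  proof -
    obtain T where T: "\<And>t. t \<ge> T \<Longrightarrow> P \<epsilon> t" using ev[OF \<epsilon>] by blast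
    have "e t \<le> \<epsilon>" if "t \<ge> T" for t
      unfolding e_def using \<epsilon> T that by (intro cInf_lower bdd) (auto simp: B_def)
    thus ?thesis by blast
  qed
  define S where "S t = (SUP s\<in>{0<..}. e s - \<bar>t - s\<bar>)" for t
  have bddS: "bdd_above ((\<lambda>s. e s - \<bar>t - s\<bar>) ` {0<..})" for t
  proof (rule bdd_aboveI2[of _ _ 1])
    show "e s - \<bar>t - s\<bar> \<le> 1" for s using e1[of s] by linarith
  qed
  have S_ge: "e s - \<bar>t - s\<bar> \<le> S t" if "0 < s" for s t
    unfolding S_def using that by (intro cSUP_upper bddS) auto
  have S_le: "S t \<le> M" if "\<And>s. 0 < s \<Longrightarrow> e s - \<bar>t - s\<bar> \<le> M" for t M
    unfolding S_def using that by (intro cSUP_least) auto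
  have lip: "S t \<le> S t' + \<bar>t - t'\<bar>" for t t'
  proof (rule S_le)
    fix s :: real assume "0 < s"
    from S_ge[OF this, of t'] show "e s - \<bar>t - s\<bar> \<le> S t' + \<bar>t - t'\<bar>" by linarith
  qed
  have contS: "continuous_on A S" for A
  proof -
    have "1-lipschitz_on A S"
    proof (rule lipschitz_onI)
      show "dist (S x) (S y) \<le> 1 * dist x y" for x y
        using lip[of x y] lip[of y x] by (simp add: dist_real_def abs_le_iff abs_minus_commute)
    qed simp
    thus ?thesis by (rule lipschitz_on_continuous_on)
  qed
  have S_pos: "e t \<le> S t" if "0 < t" for t using S_ge[OF that, of t] by simp
  have S_lim: "(S \<longlongrightarrow> 0) at_top"
  proof (rule tendstoI)
    fix \<epsilon> :: real assume \<epsilon>: "0 < \<epsilon>"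
    obtain T where T: "\<And>t. t \<ge> T \<Longrightarrow> e t \<le> \<epsilon> / 2" using e_lim[of "\<epsilon> / 2"] \<epsilon> by auto
    \<comment> \<open>For s < t / 2 the penalty exceeds t / 2 \<ge> 1 \<ge> e s, so early values of
      e cannot contribute.\<close>
    have "dist (S t) 0 < \<epsilon>" if t: "t \<ge> max 2 (2 * T)" for t
    proof -
      have "S t \<le> \<epsilon> / 2"
      proof (rule S_le)
        fix s :: real assume "0 < s"
        show "e s - \<bar>t - s\<bar> \<le> \<epsilon> / 2"
        proof (cases "t / 2 \<le> s")
          case True
          hence "T \<le> s" using t by auto
          thus ?thesis using T[of s] abs_ge_zero[of "t - s"] by linarith
        next
          case False
          thus ?thesis using e1[of s] t \<epsilon> by linarith
        qed
      qed
      moreover have "0 \<le> S t" using S_pos[of t] e0[of t] t by linarith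
      ultimately show ?thesis using \<epsilon> by simp
    qed
    thus "\<forall>\<^sub>F t in at_top. dist (S t) 0 < \<epsilon>" unfolding eventually_at_top_linorder by blast
  qed
  \<comment> \<open>The added term makes \<delta> positive and strictly larger than e, so some
    member of \<open>B t\<close> lies below \<delta> t; once \<delta> t < 1, this member cannot come
    from the trivial alternative.\<close>
  define \<delta> where "\<delta> t = S t + 1 / (1 + t)" for t
  have inv: "((\<lambda>t::real. 1 / (1 + t)) \<longlongrightarrow> 0) at_top"
    by (intro tendsto_divide_0[OF tendsto_const] filterlim_at_top_imp_at_infinity
        filterlim_tendsto_add_at_top[OF tendsto_const filterlim_ident])
  have \<delta>_lim: "(\<delta> \<longlongrightarrow> 0) at_top" unfolding \<delta>_def using tendsto_add[OF S_lim inv] by simp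
  show thesis
  proof
    show "continuous_on {0<..} \<delta>" unfolding \<delta>_def by (intro continuous_intros contS) auto
    show "0 < \<delta> t" if "0 < t" for t
      using S_pos[OF that] e0[of t] that unfolding \<delta>_def by (intro add_nonneg_pos) auto
    show "(\<delta> \<longlongrightarrow> 0) at_top" by (rule \<delta>_lim)
    have "\<forall>\<^sub>F t in at_top. \<delta> t < 1" by (rule order_tendstoD[OF \<delta>_lim]) simp
    moreover have "\<forall>\<^sub>F t in at_top. (0::real) < t" by (rule eventually_gt_at_top)
    ultimately show "\<forall>\<^sub>F t in at_top. P (\<delta> t) t"
    proof eventually_elim
      case (elim t)
      have "0 < 1 / (1 + t)" using elim by simp
      hence "e t < \<delta> t" using S_pos[of t] elim unfolding \<delta>_def by linarith
      then obtain \<epsilon> where "\<epsilon> \<in> B t" "\<epsilon> < \<delta> t"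
        unfolding e_def using cInf_less_iff[OF _ bdd] B1 by blast
      thus "P (\<delta> t) t" using elim mono[of t \<epsilon> "\<delta> t"] by (auto simp: B_def)
    qed
  qed
qed

lemma l1norm_le_norm:
  fixes v :: "real ^ 'd"
  shows "l1norm v \<le> real CARD('d) * norm v"
proof -
  have "l1norm v \<le> (\<Sum>j\<in>(UNIV :: 'd set). norm v)"
    unfolding l1norm_def by (intro sum_mono component_le_norm_cart)
  thus ?thesis by simp
qed

text \<open>Chebyshev's inequality in pointwise form; \<open>CARD('d)\<close> is the cost of passing
  from \<open>l1norm\<close> to the Euclidean norm.\<close>

lemma sz_le_spread:
  fixes \<theta> :: "real ^ 'd"
  assumes a: "\<alpha> \<noteq> 0" and \<delta>: "0 < \<delta>" and far: "\<delta> < l1norm ((1 / sz \<alpha>) *\<^sub>R vec_of_nat \<alpha> - \<theta>)"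
  shows "sz \<alpha> \<le> (real CARD('d) / \<delta>)\<^sup>2 * spread \<theta> \<alpha>"
proof -
  have X: "0 < sz \<alpha>" by (rule sz_pos[OF a])
  define n where "n = norm (excess \<theta> \<alpha>) / sz \<alpha>"
  have "norm ((1 / sz \<alpha>) *\<^sub>R vec_of_nat \<alpha> - \<theta>) = n"
  proof -
    have "(1 / sz \<alpha>) *\<^sub>R vec_of_nat \<alpha> - \<theta> = (1 / sz \<alpha>) *\<^sub>R excess \<theta> \<alpha>"
      using X by (simp add: excess_def scaleR_diff_right)
    thus ?thesis using X by (simp add: n_def)
  qed
  hence "\<delta> \<le> real CARD('d) * n" using far l1norm_le_norm[of "(1 / sz \<alpha>) *\<^sub>R vec_of_nat \<alpha> - \<theta>"] by simp
  hence "1 \<le> real CARD('d) / \<delta> * n" using \<delta> by (simp add: pos_le_divide_eq)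
  hence "1\<^sup>2 \<le> (real CARD('d) / \<delta> * n)\<^sup>2" by (intro power_mono) auto
  hence "sz \<alpha> * 1 \<le> sz \<alpha> * (real CARD('d) / \<delta> * n)\<^sup>2" using X by (intro mult_left_mono) auto
  also have "\<dots> = (real CARD('d) / \<delta>)\<^sup>2 * (sz \<alpha> * n\<^sup>2)"
    by (simp add: power_mult_distrib power_divide)
  also have "sz \<alpha> * n\<^sup>2 = spread \<theta> \<alpha>" using X by (simp add: n_def spread_def power2_eq_square)
  finally show ?thesis by simp
qed

section \<open>Concentration in size and direction\<close>

context coag_data
begin

text \<open>On nonnegative vectors \<open>l1norm\<close> is the sum of the components, a linear map,
  so it commutes with the infinite sum.\<close>

lemma theta0_simplex: "theta0 \<in> unit_simplex"
proof -
  have comp: "theta0 $ j = 1 / m0 * (\<Sum>\<^sub>\<infinity>\<alpha>\<in>nonzero_indices. n0 \<alpha> * (vec_of_nat \<alpha> $ j))" for j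
  proof -
    have "(\<Sum>\<^sub>\<infinity>\<alpha>\<in>nonzero_indices. n0 \<alpha> *\<^sub>R vec_of_nat \<alpha>) $ j = (\<Sum>\<^sub>\<infinity>\<alpha>\<in>nonzero_indices. (n0 \<alpha> *\<^sub>R vec_of_nat \<alpha>) $ j)"
      by (rule infsumI[symmetric, OF has_sum_bounded_linear[OF bounded_linear_vec_nth has_sum_infsum[OF vec_summable]]])
    thus ?thesis by (simp add: theta0_def)
  qed
  have nn: "0 \<le> theta0 $ j" for j
    unfolding comp using m0_pos n0_nonneg
    by (intro mult_nonneg_nonneg infsum_nonneg) (auto simp: vec_of_nat_def)
  have "l1norm theta0 = (\<Sum>j\<in>UNIV. theta0 $ j)" using nn by (simp add: l1norm_def)
  also have "\<dots> = 1 / m0 * (\<Sum>j\<in>UNIV. (\<Sum>\<^sub>\<infinity>\<alpha>\<in>nonzero_indices. n0 \<alpha> *\<^sub>R vec_of_nat \<alpha>) $ j)"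
    by (simp add: theta0_def sum_distrib_left)
  also have "(\<Sum>j\<in>UNIV. (\<Sum>\<^sub>\<infinity>\<alpha>\<in>nonzero_indices. n0 \<alpha> *\<^sub>R vec_of_nat \<alpha>) $ j) =
      (\<Sum>\<^sub>\<infinity>\<alpha>\<in>nonzero_indices. \<Sum>j\<in>UNIV. (n0 \<alpha> *\<^sub>R vec_of_nat \<alpha>) $ j)"
    by (rule infsumI[symmetric, OF has_sum_bounded_linear[OF bounded_linear_sum[OF bounded_linear_vec_nth]
        has_sum_infsum[OF vec_summable]]])
  also have "\<dots> = m0" unfolding m0_def
    by (intro infsum_cong) (simp add: sz_def l1norm_def vec_of_nat_def sum_distrib_left mult.commute)
  finally have "l1norm theta0 = 1" using m0_pos by simp
  moreover have "theta0 \<noteq> 0" using \<open>l1norm theta0 = 1\<close> by (auto simp: l1norm_def)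
  ultimately show ?thesis using nn by (simp add: unit_simplex_def Rstar_def)
qed

lemma init_tail_tendsto: "((\<lambda>t. init_tail (t powr (1 / (1 - \<gamma>)))) \<longlongrightarrow> 0) at_top"
proof (rule tendstoI)
  fix e :: real assume e: "0 < e"
  obtain A0 where A0: "0 < A0" "\<And>A. A0 \<le> A \<Longrightarrow> init_tail A \<le> e / 2" using init_tail_small[of "e / 2"] e by auto
  have "dist (init_tail (t powr (1 / (1 - \<gamma>)))) 0 < e" if t: "t \<ge> A0 powr (1 - \<gamma>)" for t
  proof -
    have "(A0 powr (1 - \<gamma>)) powr (1 / (1 - \<gamma>)) \<le> t powr (1 / (1 - \<gamma>))"
      using t \<gamma> by (intro powr_mono2) auto
    hence A: "A0 \<le> t powr (1 / (1 - \<gamma>))" using A0(1) \<gamma> by (simp add: powr_powr)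
    hence "0 \<le> init_tail (t powr (1 / (1 - \<gamma>)))" unfolding init_tail_def
      using A0(1) n0_nonneg by (intro infsum_nonneg mult_nonneg_nonneg tail_nonneg) auto
    thus ?thesis using A0(2)[OF A] e by simp
  qed
  thus "\<forall>\<^sub>F t in at_top. dist (init_tail (t powr (1 / (1 - \<gamma>)))) 0 < e" unfolding eventually_at_top_linorder by blast
qed

end

context coag_limit
begin

text \<open>The directions alone limit how fast \<delta> may decrease, since Chebyshev's inequality
  divides the spread by the square of \<delta>. The bound for the mass outside the size window tends
  to zero for any \<delta> tending to zero, because its constant is uniform in time.\<close>

lemma localization:
  obtains \<delta> :: "real \<Rightarrow> real" where "continuous_on {0<..} \<delta>" "\<And>t. 0 < t \<Longrightarrow> 0 < \<delta> t" "(\<delta> \<longlongrightarrow> 0) at_top"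
    "((\<lambda>t. \<bar>(\<Sum>\<^sub>\<infinity>\<alpha>\<in>localization_indices (\<delta> t) (t powr (1 / (1 - \<gamma>))) theta0. sz \<alpha> * sol \<alpha> t) - m0\<bar>) \<longlongrightarrow> 0) at_top"
proof -
  define d where "d = real CARD('d)"
  have d: "0 < d" by (simp add: d_def)
  \<comment> \<open>By \<open>sz_le_spread\<close> this forces the mass whose direction is off by
    more than \<epsilon> to be at most \<epsilon>. Stated for finite sets, it matches the form of
    \<open>sol_spread\<close>.\<close>
  define P where "P \<epsilon> t \<longleftrightarrow> (\<forall>F. finite F \<longrightarrow> F \<subseteq> nonzero_indices \<longrightarrow>
      (d / \<epsilon>)\<^sup>2 * (\<Sum>\<alpha>\<in>F. spread theta0 \<alpha> * sol \<alpha> t) \<le> \<epsilon>)" for \<epsilon> t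
  obtain \<delta> :: "real \<Rightarrow> real" where \<delta>: "continuous_on {0<..} \<delta>" "\<And>t. 0 < t \<Longrightarrow> 0 < \<delta> t"
    "(\<delta> \<longlongrightarrow> 0) at_top" "\<forall>\<^sub>F t in at_top. P (\<delta> t) t"
  proof (rule diagonal_scale[of P])
    fix \<epsilon> \<epsilon>' t :: real assume t: "0 < t" and \<epsilon>: "0 < \<epsilon>" "\<epsilon> \<le> \<epsilon>'" and P: "P \<epsilon> t"
    show "P \<epsilon>' t" unfolding P_def
    proof (intro allI impI)
      fix F :: "(nat ^ 'd) set" assume F: "finite F" "F \<subseteq> nonzero_indices"
      have "0 \<le> (\<Sum>\<alpha>\<in>F. spread theta0 \<alpha> * sol \<alpha> t)"
        using F t sol_nonneg by (intro sum_nonneg mult_nonneg_nonneg spread_nonneg) auto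
      moreover have "(d / \<epsilon>')\<^sup>2 \<le> (d / \<epsilon>)\<^sup>2" using \<epsilon> d by (intro power_mono divide_left_mono) auto
      ultimately have "(d / \<epsilon>')\<^sup>2 * (\<Sum>\<alpha>\<in>F. spread theta0 \<alpha> * sol \<alpha> t) \<le> (d / \<epsilon>)\<^sup>2 * (\<Sum>\<alpha>\<in>F. spread theta0 \<alpha> * sol \<alpha> t)"
        by (rule mult_right_mono[rotated])
      also have "\<dots> \<le> \<epsilon>" using P F by (simp add: P_def)
      finally show "(d / \<epsilon>')\<^sup>2 * (\<Sum>\<alpha>\<in>F. spread theta0 \<alpha> * sol \<alpha> t) \<le> \<epsilon>'" using \<epsilon> by linarith
    qed
  next
    fix \<epsilon> :: real assume \<epsilon>: "0 < \<epsilon>"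
    have "0 < \<epsilon> * (\<epsilon> / d)\<^sup>2" using \<epsilon> d by simp
    then obtain T where "0 \<le> T" and T: "\<And>t F. T \<le> t \<Longrightarrow> finite F \<Longrightarrow> F \<subseteq> nonzero_indices \<Longrightarrow>
        (\<Sum>\<alpha>\<in>F. spread theta0 \<alpha> * sol \<alpha> t) \<le> \<epsilon> * (\<epsilon> / d)\<^sup>2"
      by (rule sol_spread) (rule that, assumption+)
    have "P \<epsilon> t" if "t \<ge> T" for t unfolding P_def
    proof (intro allI impI)
      fix F :: "(nat ^ 'd) set" assume F: "finite F" "F \<subseteq> nonzero_indices"
      have "(d / \<epsilon>)\<^sup>2 * (\<Sum>\<alpha>\<in>F. spread theta0 \<alpha> * sol \<alpha> t) \<le> (d / \<epsilon>)\<^sup>2 * (\<epsilon> * (\<epsilon> / d)\<^sup>2)"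
        using T[OF that F] by (intro mult_left_mono) auto
      also have "\<dots> = \<epsilon>" using \<epsilon> d by (simp add: power_divide)
      finally show "(d / \<epsilon>)\<^sup>2 * (\<Sum>\<alpha>\<in>F. spread theta0 \<alpha> * sol \<alpha> t) \<le> \<epsilon>" .
    qed
    thus "\<exists>T. \<forall>t\<ge>T. P \<epsilon> t" by blast
  qed blast
  obtain C where C: "0 < C" "\<And>t \<epsilon> F. 1 \<le> t \<Longrightarrow> 0 < \<epsilon> \<Longrightarrow> \<epsilon> \<le> 1 \<Longrightarrow> finite F \<Longrightarrow> F \<subseteq> nonzero_indices \<Longrightarrow>
      (\<Sum>\<alpha>\<in>{\<alpha>\<in>F. \<not> (\<epsilon> * t powr (1 / (1 - \<gamma>)) \<le> sz \<alpha> \<and> sz \<alpha> \<le> t powr (1 / (1 - \<gamma>)) / \<epsilon>)}. sz \<alpha> * sol \<alpha> t)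
      \<le> C * (\<epsilon> powr ((1 - \<gamma>) / 2) + \<epsilon> powr gap) + 2 * init_tail (t powr (1 / (1 - \<gamma>)))"
    by (rule sol_window) (rule that, assumption+)
  define bound where "bound t = C * (\<delta> t powr ((1 - \<gamma>) / 2) + \<delta> t powr gap) + 2 * init_tail (t powr (1 / (1 - \<gamma>))) + \<delta> t" for t
  have \<delta>ev: "\<forall>\<^sub>F t in at_top. 0 \<le> \<delta> t"
    using eventually_gt_at_top[of "0::real"] by eventually_elim (rule less_imp_le[OF \<delta>(2)])
  have "((\<lambda>t. C * (\<delta> t powr ((1 - \<gamma>) / 2) + \<delta> t powr gap) + 2 * init_tail (t powr (1 / (1 - \<gamma>))) + \<delta> t) \<longlongrightarrow> C * (0 + 0) + 2 * 0 + 0) at_top"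
    using \<gamma> gap_pos
    by (intro tendsto_add tendsto_mult tendsto_const init_tail_tendsto \<delta>(3) tendsto_zero_powrI[OF \<delta>(3) tendsto_const \<delta>ev]) auto
  hence bound_lim: "(bound \<longlongrightarrow> 0) at_top" by (simp add: bound_def[abs_def])
  show thesis
  proof (rule that[OF \<delta>(1) \<delta>(2) \<delta>(3) Lim_null_comparison[OF _ bound_lim]])
    have "\<forall>\<^sub>F t in at_top. \<delta> t < 1" by (rule order_tendstoD[OF \<delta>(3)]) simp
    with \<delta>(4) eventually_ge_at_top[of "1::real"]
    show "\<forall>\<^sub>F t in at_top. norm \<bar>(\<Sum>\<^sub>\<infinity>\<alpha>\<in>localization_indices (\<delta> t) (t powr (1 / (1 - \<gamma>))) theta0. sz \<alpha> * sol \<alpha> t) - m0\<bar> \<le> bound t"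
    proof eventually_elim
      case (elim t)
      have t: "1 \<le> t" "0 \<le> t" and \<delta>t: "0 < \<delta> t" "\<delta> t \<le> 1" using elim \<delta>(2)[of t] by auto
      define R where "R = t powr (1 / (1 - \<gamma>))"
      define I where "I = localization_indices (\<delta> t) R theta0"
      have I: "I \<subseteq> nonzero_indices" by (auto simp: I_def localization_indices_def)
      have sumI: "(\<lambda>\<alpha>. sz \<alpha> * sol \<alpha> t) summable_on I" "(\<lambda>\<alpha>. sz \<alpha> * sol \<alpha> t) summable_on (nonzero_indices - I)"
        by (rule summable_on_subset_banach[OF mass_summable[OF t(2)]], use I in auto)+
      have split: "(\<Sum>\<^sub>\<infinity>\<alpha>\<in>nonzero_indices - I. sz \<alpha> * sol \<alpha> t) = m0 - (\<Sum>\<^sub>\<infinity>\<alpha>\<in>I. sz \<alpha> * sol \<alpha> t)"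
        using infsum_Diff[OF mass_summable[OF t(2)] sumI(1) I] sol_mass[OF t(2)] by simp
      have "0 \<le> (\<Sum>\<^sub>\<infinity>\<alpha>\<in>nonzero_indices - I. sz \<alpha> * sol \<alpha> t)"
        using t sol_nonneg by (intro infsum_nonneg) auto
      moreover have "(\<Sum>\<^sub>\<infinity>\<alpha>\<in>nonzero_indices - I. sz \<alpha> * sol \<alpha> t) \<le> bound t"
      proof (rule infsum_le_finite_sums[OF sumI(2)])
        fix F assume F: "finite F" "F \<subseteq> nonzero_indices - I"
        define W where "W = {\<alpha>\<in>F. \<not> (\<delta> t * R \<le> sz \<alpha> \<and> sz \<alpha> \<le> R / \<delta> t)}"
        have "(\<Sum>\<alpha>\<in>F. sz \<alpha> * sol \<alpha> t) = (\<Sum>\<alpha>\<in>W. sz \<alpha> * sol \<alpha> t) + (\<Sum>\<alpha>\<in>F - W. sz \<alpha> * sol \<alpha> t)"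
          using F by (subst sum.subset_diff[of W F]) (auto simp: W_def)
        also have "(\<Sum>\<alpha>\<in>W. sz \<alpha> * sol \<alpha> t) \<le> C * (\<delta> t powr ((1 - \<gamma>) / 2) + \<delta> t powr gap) + 2 * init_tail R"
          unfolding W_def R_def using t \<delta>t F by (intro C(2)) auto
        \<comment> \<open>An index inside the size window but outside \<open>I\<close> must violate
          the condition on the direction.\<close>
        also have "(\<Sum>\<alpha>\<in>F - W. sz \<alpha> * sol \<alpha> t) \<le> (\<Sum>\<alpha>\<in>F - W. (d / \<delta> t)\<^sup>2 * (spread theta0 \<alpha> * sol \<alpha> t))"
        proof (rule sum_mono)
          fix \<alpha> assume a: "\<alpha> \<in> F - W"
          hence nz: "\<alpha> \<noteq> 0" "\<alpha> \<notin> I" and w: "\<delta> t * R \<le> sz \<alpha>" "sz \<alpha> \<le> R / \<delta> t" using F by (auto simp: W_def)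
          hence "\<delta> t < l1norm ((1 / sz \<alpha>) *\<^sub>R vec_of_nat \<alpha> - theta0)"
            by (auto simp: I_def localization_indices_def sz_def[symmetric] divide_inverse mult.commute)
          from mult_right_mono[OF sz_le_spread[OF nz(1) \<delta>t(1) this] sol_nonneg[OF nz(1) t(2)]]
          show "sz \<alpha> * sol \<alpha> t \<le> (d / \<delta> t)\<^sup>2 * (spread theta0 \<alpha> * sol \<alpha> t)" by (simp add: d_def mult.assoc)
        qed
        also have "\<dots> = (d / \<delta> t)\<^sup>2 * (\<Sum>\<alpha>\<in>F - W. spread theta0 \<alpha> * sol \<alpha> t)" by (simp only: sum_distrib_left)
        also have "\<dots> \<le> \<delta> t" using elim(1) F unfolding P_def by (auto intro!: finite_Diff)
        finally show "(\<Sum>\<alpha>\<in>F. sz \<alpha> * sol \<alpha> t) \<le> bound t" by (simp add: bound_def R_def)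
      qed
      ultimately show ?case unfolding I_def[symmetric] R_def[symmetric] split by simp
    qed
  qed
qed

end

section \<open>From the continuous kernel to the lattice population\<close>

theorem theorem1p4:
  fixes K :: "real ^ 'd \<Rightarrow> real ^ 'd \<Rightarrow> real"
    and Kd :: "nat ^ 'd \<Rightarrow> nat ^ 'd \<Rightarrow> real"
    and n0 :: "nat ^ 'd \<Rightarrow> real"
    and c1 c2 \<gamma> p r :: real
  assumes Kd_nonneg: "\<And>\<alpha> \<beta>. \<alpha> \<noteq> 0 \<Longrightarrow> \<beta> \<noteq> 0 \<Longrightarrow> 0 \<le> Kd \<alpha> \<beta>"
    and Kd_eq: "\<And>\<alpha> \<beta>. \<alpha> \<noteq> 0 \<Longrightarrow> \<beta> \<noteq> 0 \<Longrightarrow> Kd \<alpha> \<beta> = K (vec_of_nat \<alpha>) (vec_of_nat \<beta>)"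
    and K_cont: "continuous_on (Rstar \<times> Rstar) (\<lambda>(x, y). K x y)"
    and K_nonneg: "\<And>x y. x \<in> Rstar \<Longrightarrow> y \<in> Rstar \<Longrightarrow> 0 \<le> K x y"
    and K_sym: "\<And>x y. x \<in> Rstar \<Longrightarrow> y \<in> Rstar \<Longrightarrow> K x y = K y x"
    and K_lower: "\<And>x y. x \<in> Rstar \<Longrightarrow> y \<in> Rstar \<Longrightarrow>
      c1 * (l1norm x + l1norm y) powr \<gamma> * \<Phi> p (l1norm x / (l1norm x + l1norm y)) \<le> K x y"
    and K_upper: "\<And>x y. x \<in> Rstar \<Longrightarrow> y \<in> Rstar \<Longrightarrow>
      K x y \<le> c2 * (l1norm x + l1norm y) powr \<gamma> * \<Phi> p (l1norm x / (l1norm x + l1norm y))"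
    and constants: "0 < c1" "c1 \<le> c2"
    and gamma: "0 \<le> \<gamma>" "\<gamma> < 1"
    and gamma_p: "0 \<le> \<gamma> + 2 * p" "0 \<le> \<gamma> + p" "\<gamma> + p < 1"
    and n0_nonneg: "\<And>\<alpha>. \<alpha> \<noteq> 0 \<Longrightarrow> 0 \<le> n0 \<alpha>"
    and r: "0 < r"
    and n0_moment: "(\<lambda>\<alpha>. l1norm (vec_of_nat \<alpha>) powr (1 + r) * n0 \<alpha>) summable_on nonzero_indices"
      "0 < (\<Sum>\<^sub>\<infinity>\<alpha>\<in>nonzero_indices. l1norm (vec_of_nat \<alpha>) powr (1 + r) * n0 \<alpha>)"
  shows "\<exists>n :: nat ^ 'd \<Rightarrow> real \<Rightarrow> real.
    discrete_coagulation_solution \<gamma> p K n0 n \<and>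
    (\<forall>\<alpha>\<in>nonzero_indices. n \<alpha> 0 = n0 \<alpha>) \<and>
    ((\<lambda>\<alpha>. l1norm (vec_of_nat \<alpha>) * n0 \<alpha>) has_sum total_mass n0) nonzero_indices \<and>
    0 < total_mass n0 \<and>
    (\<forall>t>0. ((\<lambda>\<alpha>. l1norm (vec_of_nat \<alpha>) * n \<alpha> t) has_sum total_mass n0) nonzero_indices) \<and>
    (\<lambda>\<alpha>. n0 \<alpha> *\<^sub>R vec_of_nat \<alpha>) summable_on nonzero_indices \<and>
    mean_direction n0 \<in> unit_simplex \<and>
    (\<exists>\<delta> :: real \<Rightarrow> real.
       continuous_on {0<..} \<delta> \<and> (\<forall>t>0. 0 < \<delta> t) \<and> (\<delta> \<longlongrightarrow> 0) at_top \<and>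
       ((\<lambda>t. \<bar>(\<Sum>\<^sub>\<infinity>\<alpha>\<in>localization_indices (\<delta> t) (t powr (1 / (1 - \<gamma>))) (mean_direction n0).
                l1norm (vec_of_nat \<alpha>) * n \<alpha> t) - total_mass n0\<bar>) \<longlongrightarrow> 0) at_top)"
proof -
  define k where "k \<alpha> \<beta> = K (vec_of_nat \<alpha>) (vec_of_nat \<beta>)" for \<alpha> \<beta> :: "nat ^ 'd"
  have kernel: "(x + y) powr \<gamma> * \<Phi> p (x / (x + y)) = (x + y) powr (\<gamma> + 2 * p) * x powr (- p) * y powr (- p)"
    if "0 < x" "0 < y" for x y :: real
  proof -
    have "1 - x / (x + y) = y / (x + y)" using that by (simp add: field_simps)
    hence "(x + y) powr \<gamma> * \<Phi> p (x / (x + y)) =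
        (x + y) powr \<gamma> * (x + y) powr p * (x + y) powr p * (x powr (- p) * y powr (- p))"
      by (simp add: \<Phi>_def powr_divide powr_minus_divide)
    also have "(x + y) powr \<gamma> * (x + y) powr p * (x + y) powr p = (x + y) powr (\<gamma> + 2 * p)"
      by (simp only: powr_add[symmetric]) (simp add: algebra_simps)
    finally show ?thesis by (simp only: mult.assoc)
  qed
  \<comment> \<open>Sizes are at least 1, so the moment of order 1 + r dominates the mass.\<close>
  have mass: "(\<lambda>\<alpha>. sz \<alpha> * n0 \<alpha>) summable_on nonzero_indices"
    using n0_moment(1) unfolding sz_def[symmetric]
  proof (rule summable_on_comparison_test)
    fix \<alpha> :: "nat ^ 'd" assume a: "\<alpha> \<in> nonzero_indices"
    have "sz \<alpha> powr 1 \<le> sz \<alpha> powr (1 + r)" using a sz_ge_1 r by (intro powr_mono) auto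
    thus "sz \<alpha> * n0 \<alpha> \<le> sz \<alpha> powr (1 + r) * n0 \<alpha>" using a n0_nonneg by (intro mult_right_mono) auto
    show "0 \<le> sz \<alpha> * n0 \<alpha>" using a n0_nonneg by simp
  qed
  \<comment> \<open>A positive moment of order 1 + r requires an index that is actually populated,
    and this index carries positive mass.\<close>
  have mass_pos: "0 < (\<Sum>\<^sub>\<infinity>\<alpha>\<in>nonzero_indices. sz \<alpha> * n0 \<alpha>)"
  proof -
    have "\<exists>\<alpha>\<in>nonzero_indices. n0 \<alpha> \<noteq> 0"
    proof (rule ccontr)
      assume "\<not> ?thesis"
      hence "(\<Sum>\<^sub>\<infinity>\<alpha>\<in>nonzero_indices. l1norm (vec_of_nat \<alpha>) powr (1 + r) * n0 \<alpha>) = 0"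
        by (intro infsum_0) auto
      with n0_moment(2) show False by simp
    qed
    then obtain \<alpha> where a: "\<alpha> \<noteq> 0" "n0 \<alpha> \<noteq> 0" by blast
    have "0 < sz \<alpha> * n0 \<alpha>" using sz_pos[OF a(1)] n0_nonneg[OF a(1)] a(2) by simp
    also have "\<dots> \<le> (\<Sum>\<^sub>\<infinity>\<alpha>\<in>nonzero_indices. sz \<alpha> * n0 \<alpha>)"
      using finite_sum_le_infsum[OF mass, of "{\<alpha>}"] a n0_nonneg by simp
    finally show ?thesis .
  qed
  have data: "coag_data k c1 c2 \<gamma> p n0"
  proof
    fix \<alpha> \<beta> :: "nat ^ 'd" assume ab: "\<alpha> \<noteq> 0" "\<beta> \<noteq> 0"
    note in_R = vec_of_nat_in_Rstar[OF ab(1)] vec_of_nat_in_Rstar[OF ab(2)]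
    show "k \<alpha> \<beta> = k \<beta> \<alpha>" unfolding k_def by (rule K_sym[OF in_R])
    note ker = kernel[OF sz_pos[OF ab(1)] sz_pos[OF ab(2)]]
    show "c1 * ((sz \<alpha> + sz \<beta>) powr (\<gamma> + 2 * p) * sz \<alpha> powr (- p) * sz \<beta> powr (- p)) \<le> k \<alpha> \<beta>"
      unfolding ker[symmetric] k_def using K_lower[OF in_R] by (simp only: sz_def mult.assoc)
    show "k \<alpha> \<beta> \<le> c2 * ((sz \<alpha> + sz \<beta>) powr (\<gamma> + 2 * p) * sz \<alpha> powr (- p) * sz \<beta> powr (- p))"
      unfolding ker[symmetric] k_def using K_upper[OF in_R] by (simp only: sz_def mult.assoc)
  qed (use constants gamma gamma_p n0_nonneg mass mass_pos in auto)
  obtain \<sigma> :: "nat \<Rightarrow> nat" and sol where \<sigma>: "strict_mono \<sigma>"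
    "\<And>\<alpha> t. \<alpha> \<noteq> 0 \<Longrightarrow> 0 \<le> t \<Longrightarrow> (\<lambda>i. coag_data.approx k n0 (\<sigma> i) t \<alpha>) \<longlonglongrightarrow> sol \<alpha> t" "\<And>t. sol 0 t = n0 0"
    by (rule coag_data.approx_limit[OF data]) (rule that, assumption+)
  interpret coag_weak k c1 c2 \<gamma> p n0 \<sigma> sol K
  proof (intro coag_weak.intro coag_limit.intro data coag_limit_axioms.intro coag_weak_axioms.intro \<sigma>)
    show "continuous_on (Rstar \<times> Rstar) (\<lambda>(x, y). K x y)" by (rule K_cont)
  qed (simp_all add: k_def)
  have total: "total_mass n0 = m0" by (simp add: total_mass_def m0_def sz_def)
  have mean: "mean_direction n0 = theta0" by (simp add: mean_direction_def theta0_def total)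
  have sol_measure_eq: "sol_measure = (\<lambda>t. atomic_measure (\<lambda>\<alpha>. sol \<alpha> t))" by (simp add: fun_eq_iff sol_measure_def)
  obtain \<delta> :: "real \<Rightarrow> real" where \<delta>: "continuous_on {0<..} \<delta>" "\<And>t. 0 < t \<Longrightarrow> 0 < \<delta> t" "(\<delta> \<longlongrightarrow> 0) at_top"
    "((\<lambda>t. \<bar>(\<Sum>\<^sub>\<infinity>\<alpha>\<in>localization_indices (\<delta> t) (t powr (1 / (1 - \<gamma>))) theta0. sz \<alpha> * sol \<alpha> t) - m0\<bar>) \<longlongrightarrow> 0) at_top"
    by (rule localization) (rule that, assumption+)
  have "discrete_coagulation_solution \<gamma> p K n0 sol"
    unfolding discrete_coagulation_solution_def using sol_nonneg weak_solution_sol_measure by (auto simp: sol_measure_eq)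
  moreover have "((\<lambda>\<alpha>. l1norm (vec_of_nat \<alpha>) * n0 \<alpha>) has_sum total_mass n0) nonzero_indices"
    using has_sum_infsum[OF n0_mass] unfolding total m0_def by (simp add: sz_def)
  moreover have "((\<lambda>\<alpha>. l1norm (vec_of_nat \<alpha>) * sol \<alpha> t) has_sum total_mass n0) nonzero_indices" if "0 < t" for t
    using has_sum_infsum[OF mass_summable[of t]] that unfolding total by (simp add: sol_mass) (simp add: sz_def)
  ultimately show ?thesis
    using sol_init m0_pos vec_summable theta0_simplex \<delta>
    unfolding total mean by (intro exI[of _ sol] conjI exI[of _ \<delta>]) (auto simp: sz_def)
qed

end
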